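(* Let $x$, $\Delta$ and $g$ be positive integers. Suppose $G$ is a graph with maximum degree $\Delta(G)\le\Delta$ and chromatic number $\chi(G)>x$. Suppose that $m$ is an integer with $m> x(x\Delta)^{2g-4}$. Then there exists a subgraph $H$ of $G^{(m)}$ with girth more than $g$ and chromatic number more than $x$.
   Context: For a graph $G$ and positive integer $m$, the blow-up $G^{(m)}$ is the graph obtained from $G$ by replacing each vertex by an independent set of size $m$, and for each edge $ab$ of $G$ joining the two sets replacing $a$ and $b$ by a complete bipartite graph $K_{m,m}$ (no other edges). *)

theory Defs
  imports Complex_Main "HOL-Library.Extended_Nat"
begin

type_synonym 'a ugraph = "'a set \<times> 'a set set"

abbreviation verts :: "'a ugraph \<Rightarrow> 'a set" where
  "verts G \<equiv> fst G"

abbreviation edges :: "'a ugraph \<Rightarrow> 'a set set" where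
  "edges G \<equiv> snd G"

definition simple_graph :: "'a ugraph \<Rightarrow> bool" where
  "simple_graph G \<longleftrightarrow> (\<forall>e\<in>edges G. e \<subseteq> verts G \<and> card e = 2)"

definition is_subgraph :: "'a ugraph \<Rightarrow> 'a ugraph \<Rightarrow> bool" where
  "is_subgraph H G \<longleftrightarrow> simple_graph H \<and> verts H \<subseteq> verts G \<and> edges H \<subseteq> edges G"

definition neighbours :: "'a ugraph \<Rightarrow> 'a \<Rightarrow> 'a set" where
  "neighbours G v = {u. {v, u} \<in> edges G}"

(* Graphs may be infinite, so degrees, chromatic number and girth take values in enat. *)
definition vertex_degree :: "'a ugraph \<Rightarrow> 'a \<Rightarrow> enat" where
  "vertex_degree G v =
     (if finite (neighbours G v) then enat (card (neighbours G v)) else \<infinity>)"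

definition max_degree :: "'a ugraph \<Rightarrow> enat" where
  "max_degree G = (SUP v\<in>verts G. vertex_degree G v)"

definition proper_colouring :: "'a ugraph \<Rightarrow> nat \<Rightarrow> ('a \<Rightarrow> nat) \<Rightarrow> bool" where
  "proper_colouring G k c \<longleftrightarrow>
     (\<forall>v\<in>verts G. c v < k) \<and> (\<forall>u v. {u, v} \<in> edges G \<longrightarrow> c u \<noteq> c v)"

(* Value \<infinity> if there is no proper colouring with finitely many colours. *)
definition chromatic_number :: "'a ugraph \<Rightarrow> enat" where
  "chromatic_number G = (INF k\<in>{k. \<exists>c. proper_colouring G k c}. enat k)"

(* The vertices of a cycle in cyclic order, without repeating the first one at the end. *)
definition is_cycle :: "'a ugraph \<Rightarrow> 'a list \<Rightarrow> bool" where
  "is_cycle G p \<longleftrightarrow> 3 \<le> length p \<and> distinct p \<and>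
     (\<forall>i<length p. {p ! i, p ! (Suc i mod length p)} \<in> edges G)"

(* Value \<infinity> for an acyclic graph. *)
definition girth :: "'a ugraph \<Rightarrow> enat" where
  "girth G = (INF p\<in>{p. is_cycle G p}. enat (length p))"

definition blow_up :: "'a ugraph \<Rightarrow> nat \<Rightarrow> ('a \<times> nat) ugraph" where
  "blow_up G m =
     (verts G \<times> {..<m},
      {{(a, i), (b, j)} |a b i j. {a, b} \<in> edges G \<and> i < m \<and> j < m})"

lemma simple_graph_blow_up:
  assumes "simple_graph G"
  shows "simple_graph (blow_up G m)"
proof -
  have "a \<noteq> b \<and> a \<in> verts G \<and> b \<in> verts G" if "{a, b} \<in> edges G" for a b
    using assms that by (fastforce simp: simple_graph_def)
  then show ?thesis
    by (fastforce simp: simple_graph_def blow_up_def card_2_iff)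
qed

end

(*
  By compactness one may pass to a finite induced subgraph that is minimal with respect to not being
  x-colourable; its degrees lie between x and Delta.

  For x >= 3, apart from g = 3 and x < 23, a random subgraph of the blow-up with edge probability
  D/m works for a suitable constant D.  Let an edge set be bad if it contains a short cycle or if it
  avoids, for some would-be colouring, all the monochromatic edges which that colouring forces.  Having a
  short cycle is an increasing event and avoiding a set of edges is a decreasing one, so in the local
  lemma only dependencies between the two kinds count, and a single cycle meets few groups of avoidance
  events.  These groups are: A' x B' inside the bipartite graph of an edge ab, with |A'| = |B'| = N; and,
  at a vertex a, the pairs of equal colour between the part of a and the parts of x neighbours.

  For g = 3 and 3 <= x < 23 the parts are joined by a fixed triangle-free regular graph with small
  second eigenvalue, Parsons' graph on the points (y, z) over F_p with 2z - y^2 a non-square.  For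
  x = 2 they are joined along an odd cycle longer than g, so that all short cycles are even;
  deleting edges while the graph stays non-bipartite then destroys all of them.
*)
theory Submission
  imports Defs "HOL-Analysis.Analysis" "HOL-Number_Theory.Number_Theory"
begin

section \<open>Random subsets and a lopsided local lemma\<close>

text \<open>The hypothesis on \<open>m\<close> fixes what can be afforded. With edge probability
  \<open>D / m\<close> the short cycles through an edge cost about L / m with L = (D^2 / x) * (D /
  (x^2 * \<Delta>))^(g-2), and only E = D - L is left to make missed edge sets unlikely. Holes of
  side m / x between adjacent parts ask for E > 2 * x * (1 + ln x). The critical case is \<Delta> =
  x. For g >= 4 and D of order x^2 the cost is of lower order than D, which suffices from x = 7 on.
  For x <= 6 the side is raised to \<sigma> * m with \<sigma> > 1 / x, which lowers the demand on E;
  the colourings without a class of that size are the price, and the groups at the vertices pay for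
  them. For g = 3 and D = c * x^2 the cost is c^3 * x^2, of the same order as D, so that E stays
  below 0.39 * x^2. The demand is then met only for x above 20 or so, and 23 leaves some slack. The
  explicit graph used below that bound needs a prime congruent to 1 modulo 4 between about 4 * x^2
  and 1.4 * x^(5/2); for finitely many x a table of primes provides one.\<close>

text \<open>The probability that a random subset of \<open>E\<close>, keeping each element
  independently with probability \<open>p\<close>, satisfies \<open>Q\<close>. As a finite sum it
  obeys the recursion \<open>sub_weight_insert\<close>, from which the correlation inequalities
  follow.\<close>

definition sub_weight :: "real \<Rightarrow> 'a set \<Rightarrow> ('a set \<Rightarrow> bool) \<Rightarrow> real" where
  "sub_weight p E Q = (\<Sum>F | F \<subseteq> E \<and> Q F. p ^ card F * (1 - p) ^ card (E - F))"

lemma sub_weight_mono: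
  assumes "finite E" "0 \<le> p" "p \<le> 1" "\<And>F. F \<subseteq> E \<Longrightarrow> Q F \<Longrightarrow> R F"
  shows "sub_weight p E Q \<le> sub_weight p E R"
  unfolding sub_weight_def
  by (rule sum_mono2) (use assms in auto)

lemma sub_weight_cong:
  assumes "\<And>F. F \<subseteq> E \<Longrightarrow> Q F = R F"
  shows "sub_weight p E Q = sub_weight p E R"
  unfolding sub_weight_def by (rule sum.cong) (use assms in auto)

lemma sub_weight_nonneg:
  assumes "0 \<le> p" "p \<le> 1"
  shows "0 \<le> sub_weight p E Q"
  unfolding sub_weight_def by (rule sum_nonneg) (use assms in auto)

lemma sub_weight_split:
  assumes "finite E"
  shows "sub_weight p E Q = sub_weight p E (\<lambda>F. R F \<and> Q F) + sub_weight p E (\<lambda>F. \<not> R F \<and> Q F)"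
proof -
  let ?w = "\<lambda>F. p ^ card F * (1 - p) ^ card (E - F)"
  have "sum ?w {F. F \<subseteq> E \<and> Q F} = sum ?w ({F. F \<subseteq> E \<and> R F \<and> Q F} \<union> {F. F \<subseteq> E \<and> \<not> R F \<and> Q F})"
    by (rule sum.cong) auto
  also have "\<dots> = sum ?w {F. F \<subseteq> E \<and> R F \<and> Q F} + sum ?w {F. F \<subseteq> E \<and> \<not> R F \<and> Q F}"
    by (rule sum.union_disjoint) (use assms in auto)
  finally show ?thesis unfolding sub_weight_def .
qed

lemma sub_weight_union_bound:
  assumes E: "finite E" "0 \<le> p" "p \<le> 1" and "finite \<W>"
  shows "sub_weight p E (\<lambda>F. \<exists>W\<in>\<W>. R W F) \<le> (\<Sum>W\<in>\<W>. sub_weight p E (R W))"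
  using \<open>finite \<W>\<close>
proof (induction \<W>)
  case empty
  then show ?case by (simp add: sub_weight_def)
next
  case (insert W \<W>)
  have "sub_weight p E (\<lambda>F. \<exists>W\<in>insert W \<W>. R W F)
    = sub_weight p E (\<lambda>F. R W F \<and> (\<exists>W\<in>insert W \<W>. R W F)) + sub_weight p E (\<lambda>F. \<not> R W F \<and> (\<exists>W\<in>insert W \<W>. R W F))"
    by (rule sub_weight_split) (rule E)
  also have "\<dots> \<le> sub_weight p E (R W) + sub_weight p E (\<lambda>F. \<exists>W\<in>\<W>. R W F)"
    by (intro add_mono sub_weight_mono E) auto
  finally show ?case using insert by simp
qed

lemma sub_weight_insert:
  assumes "finite E" "e \<notin> E"
  shows "sub_weight p (insert e E) Q
    = p * sub_weight p E (\<lambda>F. Q (insert e F)) + (1 - p) * sub_weight p E Q"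
proof -
  let ?w = "\<lambda>F. p ^ card F * (1 - p) ^ card (insert e E - F)"
  have "sum ?w {F. F \<subseteq> insert e E \<and> Q F} = sum ?w (insert e ` {F. F \<subseteq> E \<and> Q (insert e F)} \<union> {F. F \<subseteq> E \<and> Q F})"
  proof (rule sum.cong)
    show "{F. F \<subseteq> insert e E \<and> Q F} = insert e ` {F. F \<subseteq> E \<and> Q (insert e F)} \<union> {F. F \<subseteq> E \<and> Q F}" (is "?L = ?R")
    proof (intro Set.set_eqI iffI)
      fix F assume F: "F \<in> ?L"
      show "F \<in> ?R"
      proof (cases "e \<in> F")
        case True
        then have "F = insert e (F - {e})" by auto
        then show ?thesis using F by (intro UnI1 image_eqI[of _ _ "F - {e}"]) auto
      qed (use F in auto)
    qed auto
  qed auto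
  also have "\<dots> = sum ?w (insert e ` {F. F \<subseteq> E \<and> Q (insert e F)}) + sum ?w {F. F \<subseteq> E \<and> Q F}"
    by (rule sum.union_disjoint) (use assms in auto)
  also have "sum ?w (insert e ` {F. F \<subseteq> E \<and> Q (insert e F)}) = (\<Sum>F | F \<subseteq> E \<and> Q (insert e F). ?w (insert e F))"
    by (subst sum.reindex) (use assms in \<open>auto simp: inj_on_def\<close>)
  also have "\<dots> = (\<Sum>F | F \<subseteq> E \<and> Q (insert e F). p * (p ^ card F * (1 - p) ^ card (E - F)))"
  proof (rule sum.cong)
    fix F assume "F \<in> {F. F \<subseteq> E \<and> Q (insert e F)}"
    then have "finite F" "e \<notin> F" using assms finite_subset by auto
    moreover have "insert e E - insert e F = E - F" using assms by auto
    ultimately show "?w (insert e F) = p * (p ^ card F * (1 - p) ^ card (E - F))" by simp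
  qed simp
  also have "sum ?w {F. F \<subseteq> E \<and> Q F} = (\<Sum>F | F \<subseteq> E \<and> Q F. (1 - p) * (p ^ card F * (1 - p) ^ card (E - F)))"
  proof (rule sum.cong)
    fix F assume "F \<in> {F. F \<subseteq> E \<and> Q F}"
    then have "finite F" "e \<notin> F" "F \<subseteq> E" using assms finite_subset by auto
    moreover have "insert e E - F = insert e (E - F)" using calculation by auto
    ultimately show "?w F = (1 - p) * (p ^ card F * (1 - p) ^ card (E - F))" using assms by simp
  qed simp
  finally show ?thesis unfolding sub_weight_def by (simp add: sum_distrib_left)
qed

lemma sub_weight_True:
  assumes "finite E"
  shows "sub_weight p E (\<lambda>_. True) = 1"
  using assms
proof induction
  case empty
  then show ?case by (simp add: sub_weight_def)
next
  case (insert e E)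
  then show ?case by (simp add: sub_weight_insert)
qed

text \<open>One-element case of the Harris inequality: a property that survives the removal of
  \<open>e\<close> is at least as likely without \<open>e\<close> as with it. Monotonicity is asked
  in \<open>e\<close> alone, so the iterated forms ask it only on the set \<open>C\<close> or
  \<open>W\<close>; in the local lemma this holds once the events touching that set are set
  aside.\<close>

lemma sub_weight_mem_le:
  assumes E: "finite E" "0 \<le> p" "p \<le> 1" and "e \<in> E" and D: "\<And>F. D (insert e F) \<Longrightarrow> D F"
  shows "sub_weight p E (\<lambda>F. e \<in> F \<and> D F) \<le> p * sub_weight p E D"
proof -
  obtain E' where E': "E = insert e E'" "e \<notin> E'" using \<open>e \<in> E\<close> by (metis Set.set_insert)
  have fin: "finite E'" using E E' by simp
  have a: "sub_weight p E' (\<lambda>F. e \<in> F \<and> D F) = 0"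
    unfolding sub_weight_def by (rule sum.neutral) (use E' in auto)
  have b: "sub_weight p E' (\<lambda>F. D (insert e F)) \<le> sub_weight p E' D"
    by (rule sub_weight_mono) (use fin E D in auto)
  have "sub_weight p E' (\<lambda>F. D (insert e F))
      = p * sub_weight p E' (\<lambda>F. D (insert e F)) + (1 - p) * sub_weight p E' (\<lambda>F. D (insert e F))"
    by (simp add: algebra_simps)
  also have "\<dots> \<le> p * sub_weight p E' (\<lambda>F. D (insert e F)) + (1 - p) * sub_weight p E' D"
    using b E by (intro add_left_mono mult_left_mono) auto
  finally show ?thesis
    unfolding E'(1) sub_weight_insert[OF fin E'(2)] using a E by (simp add: mult_left_mono)
qed

lemma sub_weight_notmem_le:
  assumes E: "finite E" "0 \<le> p" "p \<le> 1" and "e \<in> E" and D: "\<And>F. D F \<Longrightarrow> D (insert e F)"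
  shows "sub_weight p E (\<lambda>F. e \<notin> F \<and> D F) \<le> (1 - p) * sub_weight p E D"
proof -
  obtain E' where E': "E = insert e E'" "e \<notin> E'" using \<open>e \<in> E\<close> by (metis Set.set_insert)
  have fin: "finite E'" using E E' by simp
  have a: "sub_weight p E' (\<lambda>F. e \<notin> F \<and> D F) = sub_weight p E' D"
    by (rule sub_weight_cong) (use E' in auto)
  have a': "sub_weight p E' (\<lambda>F. e \<notin> insert e F \<and> D (insert e F)) = 0"
    unfolding sub_weight_def by (rule sum.neutral) auto
  have b: "sub_weight p E' D \<le> sub_weight p E' (\<lambda>F. D (insert e F))"
    by (rule sub_weight_mono) (use fin E D in auto)
  have "sub_weight p E' D = p * sub_weight p E' D + (1 - p) * sub_weight p E' D"
    by (simp add: algebra_simps)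
  also have "\<dots> \<le> p * sub_weight p E' (\<lambda>F. D (insert e F)) + (1 - p) * sub_weight p E' D"
    using b E by (intro add_right_mono mult_left_mono) auto
  finally show ?thesis
    unfolding E'(1) sub_weight_insert[OF fin E'(2)] using a a' E by (simp add: mult_left_mono)
qed

lemma sub_weight_superset_le:
  assumes E: "finite E" "0 \<le> p" "p \<le> 1" and "C \<subseteq> E" and D: "\<And>e F. e \<in> C \<Longrightarrow> D (insert e F) \<Longrightarrow> D F"
  shows "sub_weight p E (\<lambda>F. C \<subseteq> F \<and> D F) \<le> p ^ card C * sub_weight p E D"
proof -
  have "finite C" using E \<open>C \<subseteq> E\<close> finite_subset by auto
  then show ?thesis using \<open>C \<subseteq> E\<close> D
  proof (induction C)
    case empty
    then show ?case by simp
  next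
    case (insert e C)
    have "sub_weight p E (\<lambda>F. insert e C \<subseteq> F \<and> D F) = sub_weight p E (\<lambda>F. e \<in> F \<and> (C \<subseteq> F \<and> D F))"
      by simp
    also have "\<dots> \<le> p * sub_weight p E (\<lambda>F. C \<subseteq> F \<and> D F)"
      by (rule sub_weight_mem_le[OF E]) (use insert.prems insert.hyps in auto)
    also have "\<dots> \<le> p * (p ^ card C * sub_weight p E D)"
      by (rule mult_left_mono[OF insert.IH]) (use insert.prems E in auto)
    finally show ?case using insert.hyps by simp
  qed
qed

lemma sub_weight_disjoint_le:
  assumes E: "finite E" "0 \<le> p" "p \<le> 1" and "W \<subseteq> E" and D: "\<And>e F. e \<in> W \<Longrightarrow> D F \<Longrightarrow> D (insert e F)"
  shows "sub_weight p E (\<lambda>F. F \<inter> W = {} \<and> D F) \<le> (1 - p) ^ card W * sub_weight p E D"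
proof -
  have "finite W" using E \<open>W \<subseteq> E\<close> finite_subset by auto
  then show ?thesis using \<open>W \<subseteq> E\<close> D
  proof (induction W)
    case empty
    then show ?case by simp
  next
    case (insert e W)
    have "sub_weight p E (\<lambda>F. F \<inter> insert e W = {} \<and> D F) = sub_weight p E (\<lambda>F. e \<notin> F \<and> (F \<inter> W = {} \<and> D F))"
      by simp
    also have "\<dots> \<le> (1 - p) * sub_weight p E (\<lambda>F. F \<inter> W = {} \<and> D F)"
      by (rule sub_weight_notmem_le[OF E]) (use insert.prems insert.hyps in auto)
    also have "\<dots> \<le> (1 - p) * ((1 - p) ^ card W * sub_weight p E D)"
      by (rule mult_left_mono[OF insert.IH]) (use insert.prems E in auto)
    finally show ?case using insert.hyps by simp
  qed
qed

lemma sum_UN_le: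
  fixes f :: "'b \<Rightarrow> real"
  assumes "finite I" "\<And>i. i \<in> I \<Longrightarrow> finite (A i)" "\<And>i x. i \<in> I \<Longrightarrow> x \<in> A i \<Longrightarrow> 0 \<le> f x"
  shows "sum f (\<Union>i\<in>I. A i) \<le> (\<Sum>i\<in>I. sum f (A i))"
  using assms
proof (induction I)
  case empty
  then show ?case by simp
next
  case (insert i I)
  have "sum f (A i \<union> (\<Union>i\<in>I. A i)) + sum f (A i \<inter> (\<Union>i\<in>I. A i)) = sum f (A i) + sum f (\<Union>i\<in>I. A i)"
    by (rule sum.union_inter) (use insert in auto)
  moreover have "0 \<le> sum f (A i \<inter> (\<Union>i\<in>I. A i))" by (rule sum_nonneg) (use insert in auto)
  moreover have "sum f (\<Union>i\<in>I. A i) \<le> (\<Sum>i\<in>I. sum f (A i))" using insert by auto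
  ultimately show ?case using insert.hyps by simp
qed

text \<open>
  A lopsided local lemma: containing a member of \<open>\<C>\<close> is an increasing property of the random
  set and missing a member of \<open>\<W> j\<close> is a decreasing one, so events of the same kind only help
  each other and dependencies have to be counted between the two kinds alone.
\<close>

lemma lopsided_local_lemma:
  fixes p \<eta> \<zeta> \<mu> :: real
  assumes E: "finite E" and \<C>: "finite \<C>" "\<And>C. C \<in> \<C> \<Longrightarrow> C \<subseteq> E"
    and J: "finite J" "\<And>j. j \<in> J \<Longrightarrow> finite (\<W> j)" "\<And>j W. j \<in> J \<Longrightarrow> W \<in> \<W> j \<Longrightarrow> W \<subseteq> E"
    and p: "0 \<le> p" "p \<le> 1" and \<zeta>: "0 \<le> \<zeta>" "\<zeta> < 1" and \<eta>: "0 \<le> \<eta>"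
    and small: "\<And>C. C \<in> \<C> \<Longrightarrow> \<eta> * p ^ card C < 1"
    and touch: "\<And>C. C \<in> \<C> \<Longrightarrow> 1 \<le> \<eta> * (1 - \<zeta>) ^ card {j \<in> J. \<exists>W\<in>\<W> j. C \<inter> W \<noteq> {}}"
    and loss: "\<And>e. e \<in> E \<Longrightarrow> (\<Sum>C | C \<in> \<C> \<and> e \<in> C. \<eta> * p ^ card C / (1 - \<eta> * p ^ card C)) \<le> p - \<mu>"
    and group: "\<And>j. j \<in> J \<Longrightarrow> (\<Sum>W\<in>\<W> j. exp (- \<mu> * card W)) \<le> \<zeta>"
  shows "\<exists>F\<subseteq>E. (\<forall>C\<in>\<C>. \<not> C \<subseteq> F) \<and> (\<forall>j\<in>J. \<forall>W\<in>\<W> j. F \<inter> W \<noteq> {})"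
proof -
  \<comment> \<open>The weights of the asymmetric local lemma. The factor \<eta> is the price of
    conditioning on the groups that a cycle touches.\<close>
  define y where "y C = \<eta> * p ^ card C" for C :: "'a set"
  define N where "N S T F \<longleftrightarrow> (\<forall>C\<in>S. \<not> C \<subseteq> F) \<and> (\<forall>j\<in>T. \<forall>W\<in>\<W> j. F \<inter> W \<noteq> {})" for S T F
  define P where "P = sub_weight p E"
  have P_mono: "P Q \<le> P R" if "\<And>F. F \<subseteq> E \<Longrightarrow> Q F \<Longrightarrow> R F" for Q R
    unfolding P_def by (rule sub_weight_mono[OF E p that])
  have P_nonneg: "0 \<le> P Q" for Q unfolding P_def by (rule sub_weight_nonneg[OF p])
  have y0: "0 \<le> y C" for C using \<eta> p by (simp add: y_def)
  have y1: "y C < 1" if "C \<in> \<C>" for C using small[OF that] by (simp add: y_def)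

  have P_split: "P Q = P (\<lambda>F. R F \<and> Q F) + P (\<lambda>F. \<not> R F \<and> Q F)" for Q R
    unfolding P_def by (rule sub_weight_split[OF E])

  \<comment> \<open>Chain rule: the groups of \<open>T'\<close> are added one by one, each at the
    cost of a factor \<open>1 - \<zeta>\<close>. The conditional bound is asked for all subsets
    because the order of insertion is not fixed.\<close>
  have add_groups: "(1 - \<zeta>) ^ card T' * P (N S T) \<le> P (N S (T \<union> T'))"
    if fin: "finite T'" and H: "\<And>j T''. j \<in> T' \<Longrightarrow> T'' \<subseteq> T' - {j} \<Longrightarrow>
        P (\<lambda>F. (\<exists>W\<in>\<W> j. F \<inter> W = {}) \<and> N S (T \<union> T'') F) \<le> \<zeta> * P (N S (T \<union> T''))" for S T T'
    using fin H
  proof (induction T')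
    case empty
    then show ?case by simp
  next
    case (insert j T')
    have IH: "(1 - \<zeta>) ^ card T' * P (N S T) \<le> P (N S (T \<union> T'))"
    proof (rule insert.IH)
      fix i T'' assume "i \<in> T'" "T'' \<subseteq> T' - {i}"
      then show "P (\<lambda>F. (\<exists>W\<in>\<W> i. F \<inter> W = {}) \<and> N S (T \<union> T'') F) \<le> \<zeta> * P (N S (T \<union> T''))"
        using insert.prems[of i T''] by blast
    qed
    let ?h = "\<lambda>F. \<exists>W\<in>\<W> j. F \<inter> W = {}"
    have "P (\<lambda>F. ?h F \<and> N S (T \<union> T') F) \<le> \<zeta> * P (N S (T \<union> T'))"
      by (rule insert.prems) (use insert.hyps in auto)
    moreover have "P (\<lambda>F. \<not> ?h F \<and> N S (T \<union> T') F) = P (N S (T \<union> insert j T'))"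
      by (rule arg_cong[of _ _ P]) (auto simp: N_def fun_eq_iff)
    ultimately have "(1 - \<zeta>) * P (N S (T \<union> T')) \<le> P (N S (T \<union> insert j T'))"
      using P_split[of "N S (T \<union> T')" ?h] by (simp add: algebra_simps)
    moreover have "(1 - \<zeta>) * ((1 - \<zeta>) ^ card T' * P (N S T)) \<le> (1 - \<zeta>) * P (N S (T \<union> T'))"
      using IH \<zeta> by (intro mult_left_mono) auto
    ultimately show ?case using insert.hyps by simp
  qed

  have add_cycles: "(\<Prod>C\<in>S'. 1 - y C) * P (N S T) \<le> P (N (S \<union> S') T)"
    if fin: "finite S'" and sub: "S' \<subseteq> \<C>" and H: "\<And>C S''. C \<in> S' \<Longrightarrow> S'' \<subseteq> S' - {C} \<Longrightarrow>
        P (\<lambda>F. C \<subseteq> F \<and> N (S \<union> S'') T F) \<le> y C * P (N (S \<union> S'') T)" for S S' T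
    using fin sub H
  proof (induction S')
    case empty
    then show ?case by simp
  next
    case (insert C S')
    have IH: "(\<Prod>C\<in>S'. 1 - y C) * P (N S T) \<le> P (N (S \<union> S') T)"
    proof (rule insert.IH)
      fix D S'' assume "D \<in> S'" "S'' \<subseteq> S' - {D}"
      then show "P (\<lambda>F. D \<subseteq> F \<and> N (S \<union> S'') T F) \<le> y D * P (N (S \<union> S'') T)"
        using insert.prems(2)[of D S''] by blast
    qed (use insert.prems in auto)
    have "P (\<lambda>F. C \<subseteq> F \<and> N (S \<union> S') T F) \<le> y C * P (N (S \<union> S') T)"
      by (rule insert.prems) (use insert.hyps in auto)
    moreover have "P (\<lambda>F. \<not> C \<subseteq> F \<and> N (S \<union> S') T F) = P (N (S \<union> insert C S') T)"
      by (rule arg_cong[of _ _ P]) (auto simp: N_def fun_eq_iff)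
    ultimately have "(1 - y C) * P (N (S \<union> S') T) \<le> P (N (S \<union> insert C S') T)"
      using P_split[of "N (S \<union> S') T" "\<lambda>F. C \<subseteq> F"] by (simp add: algebra_simps)
    moreover have "(1 - y C) * ((\<Prod>C\<in>S'. 1 - y C) * P (N S T)) \<le> (1 - y C) * P (N (S \<union> S') T)"
      using IH y1[of C] insert.prems by (intro mult_left_mono) auto
    ultimately show ?case using insert.hyps by simp
  qed

  \<comment> \<open>Both kinds of conditional bound are proved together, by induction on the number
    of conditioning events: each kind uses the other on smaller families.\<close>
  have main: "(\<forall>C\<in>\<C>. P (\<lambda>F. C \<subseteq> F \<and> N S T F) \<le> y C * P (N S T)) \<and>
      (\<forall>j\<in>J. P (\<lambda>F. (\<exists>W\<in>\<W> j. F \<inter> W = {}) \<and> N S T F) \<le> \<zeta> * P (N S T))"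
    if "S \<subseteq> \<C>" "T \<subseteq> J" for S T
    using that
  proof (induction "card S + card T" arbitrary: S T rule: less_induct)
    case less
    have finS: "finite S" and finT: "finite T"
      using finite_subset[OF less.prems(1) \<C>(1)] finite_subset[OF less.prems(2) J(1)] .
    have IH: "(C \<in> \<C> \<longrightarrow> P (\<lambda>F. C \<subseteq> F \<and> N S' T' F) \<le> y C * P (N S' T')) \<and>
      (j \<in> J \<longrightarrow> P (\<lambda>F. (\<exists>W\<in>\<W> j. F \<inter> W = {}) \<and> N S' T' F) \<le> \<zeta> * P (N S' T'))"
      if "S' \<subseteq> S" "T' \<subseteq> T" "S' \<noteq> S \<or> T' \<noteq> T" for S' T' C j
    proof -
      have "card S' + card T' < card S + card T"
      proof (cases "S' = S")
        case True
        then have "T' \<subset> T" using that by auto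
        then show ?thesis using True psubset_card_mono[OF finT] by simp
      next
        case False
        then have "card S' < card S" using that psubset_card_mono[OF finS] by blast
        then show ?thesis using card_mono[OF finT that(2)] by linarith
      qed
      then show ?thesis using less.hyps[of S' T'] that less.prems by blast
    qed
    show ?case
    proof (intro conjI ballI)
      fix C assume C: "C \<in> \<C>"
      define T1 where "T1 = {j\<in>T. \<exists>W\<in>\<W> j. C \<inter> W \<noteq> {}}"
      \<comment> \<open>Deleting an element of \<open>C\<close> harms neither the groups left in
        \<open>T2\<close>, which \<open>C\<close> does not meet, nor the absence of cycles. So
        \<open>N S T2\<close> is decreasing along \<open>C\<close>, and only the groups of
        \<open>T1\<close> have to be paid for.\<close>
      define T2 where "T2 = T - T1"
      have T: "T = T2 \<union> T1" "finite T1" using finT by (auto simp: T1_def T2_def)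
      have "(1 - \<zeta>) ^ card T1 * P (N S T2) \<le> P (N S (T2 \<union> T1))"
      proof (rule add_groups)
        fix j T'' assume j: "j \<in> T1" "T'' \<subseteq> T1 - {j}"
        then have "j \<in> T" "j \<notin> T2 \<union> T''" "T2 \<union> T'' \<subseteq> T" "j \<in> J" using less.prems by (auto simp: T1_def T2_def)
        then have "T2 \<union> T'' \<noteq> T" "T2 \<union> T'' \<subseteq> T" "j \<in> J" by blast+
        then show "P (\<lambda>F. (\<exists>W\<in>\<W> j. F \<inter> W = {}) \<and> N S (T2 \<union> T'') F) \<le> \<zeta> * P (N S (T2 \<union> T''))"
          using IH[of S "T2 \<union> T''"] by auto
      qed (use T in auto)
      then have 1: "(1 - \<zeta>) ^ card T1 * P (N S T2) \<le> P (N S T)" using T by simp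
      have "P (\<lambda>F. C \<subseteq> F \<and> N S T F) \<le> P (\<lambda>F. C \<subseteq> F \<and> N S T2 F)"
        by (rule P_mono) (auto simp: N_def T2_def)
      also have "\<dots> \<le> p ^ card C * P (N S T2)"
        unfolding P_def
      proof (rule sub_weight_superset_le[OF E p \<C>(2)[OF C]])
        fix e F assume e: "e \<in> C" and N: "N S T2 (insert e F)"
        have "F \<inter> W \<noteq> {}" if "j \<in> T2" "W \<in> \<W> j" for j W
        proof -
          have "e \<notin> W" using that e by (auto simp: T2_def T1_def)
          moreover have "insert e F \<inter> W \<noteq> {}" using N that unfolding N_def by blast
          ultimately show ?thesis by blast
        qed
        then show "N S T2 F" using N unfolding N_def by blast
      qed
      also have "\<dots> \<le> (\<eta> * (1 - \<zeta>) ^ card T1) * (p ^ card C * P (N S T2))"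
      proof -
        have "card T1 \<le> card {j \<in> J. \<exists>W\<in>\<W> j. C \<inter> W \<noteq> {}}"
          by (rule card_mono) (use J less.prems in \<open>auto simp: T1_def\<close>)
        then have "(1 - \<zeta>) ^ card {j \<in> J. \<exists>W\<in>\<W> j. C \<inter> W \<noteq> {}} \<le> (1 - \<zeta>) ^ card T1"
          by (rule power_decreasing) (use \<zeta> in auto)
        then have "\<eta> * (1 - \<zeta>) ^ card {j \<in> J. \<exists>W\<in>\<W> j. C \<inter> W \<noteq> {}} \<le> \<eta> * (1 - \<zeta>) ^ card T1"
          using \<eta> by (rule mult_left_mono)
        then have "1 \<le> \<eta> * (1 - \<zeta>) ^ card T1" using touch[OF C] by linarith
        then show ?thesis using mult_right_mono[of 1 _ "p ^ card C * P (N S T2)"] P_nonneg p by simp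
      qed
      also have "\<dots> = y C * ((1 - \<zeta>) ^ card T1 * P (N S T2))" by (simp add: y_def)
      also have "\<dots> \<le> y C * P (N S T)" using 1 y0 by (rule mult_left_mono)
      finally show "P (\<lambda>F. C \<subseteq> F \<and> N S T F) \<le> y C * P (N S T)" .
    next
      fix j assume j: "j \<in> J"
      have W: "P (\<lambda>F. F \<inter> W = {} \<and> N S T F) \<le> exp (- \<mu> * card W) * P (N S T)" if W: "W \<in> \<W> j" for W
      proof -
        define S1 where "S1 = {C\<in>S. C \<inter> W \<noteq> {}}"
        \<comment> \<open>The mirror image: adding elements of \<open>W\<close> completes no cycle
          of \<open>S2\<close> and keeps all groups hit, so \<open>N S2 T\<close> is increasing
          along \<open>W\<close>.\<close>
        define S2 where "S2 = S - S1"
        have S: "S = S2 \<union> S1" "finite S1" "S1 \<subseteq> \<C>" using finS less.prems by (auto simp: S1_def S2_def)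
        have WE: "W \<subseteq> E" "finite W" using J(3)[OF j W] E finite_subset by auto
        have "(\<Prod>C\<in>S1. 1 - y C) * P (N S2 T) \<le> P (N (S2 \<union> S1) T)"
        proof (rule add_cycles)
          fix C S'' assume C: "C \<in> S1" "S'' \<subseteq> S1 - {C}"
          then have "C \<in> S" "C \<notin> S2 \<union> S''" "S2 \<union> S'' \<subseteq> S" "C \<in> \<C>" using less.prems by (auto simp: S1_def S2_def)
          then have "S2 \<union> S'' \<noteq> S" "S2 \<union> S'' \<subseteq> S" "C \<in> \<C>" by blast+
          then show "P (\<lambda>F. C \<subseteq> F \<and> N (S2 \<union> S'') T F) \<le> y C * P (N (S2 \<union> S'') T)"
            using IH[of "S2 \<union> S''" T] by auto
        qed (use S in auto)
        then have 1: "(\<Prod>C\<in>S1. 1 - y C) * P (N S2 T) \<le> P (N S T)" using S by simp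
        have prod: "exp (- (\<Sum>C\<in>S1. y C / (1 - y C))) \<le> (\<Prod>C\<in>S1. 1 - y C)"
        proof -
          have "exp (- (\<Sum>C\<in>S1. y C / (1 - y C))) = (\<Prod>C\<in>S1. exp (- (y C / (1 - y C))))"
            using S by (simp add: exp_sum flip: sum_negf)
          also have "\<dots> \<le> (\<Prod>C\<in>S1. 1 - y C)"
          proof (rule prod_mono, intro conjI)
            fix C assume "C \<in> S1"
            then have C: "y C < 1" using S y1 by blast
            have "1 + y C / (1 - y C) \<le> exp (y C / (1 - y C))" by (rule exp_ge_add_one_self)
            moreover have "1 + y C / (1 - y C) = 1 / (1 - y C)" using C by (simp add: field_simps)
            ultimately have "1 / (1 - y C) \<le> exp (y C / (1 - y C))" by simp
            then have "1 / exp (y C / (1 - y C)) \<le> 1 - y C" using C by (simp add: field_simps)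
            then show "exp (- (y C / (1 - y C))) \<le> 1 - y C" by (simp add: exp_minus field_simps)
          qed simp
          finally show ?thesis .
        qed
        \<comment> \<open>Each cycle meeting \<open>W\<close> is charged to an element of
          \<open>W\<close> that it contains; by \<open>loss\<close> every element carries at most
          \<open>p - \<mu>\<close>.\<close>
        have "(\<Sum>C\<in>S1. y C / (1 - y C)) \<le> (\<Sum>C\<in>(\<Union>e\<in>W. {C. C \<in> \<C> \<and> e \<in> C}). y C / (1 - y C))"
        proof (rule sum_mono2)
          show "finite (\<Union>e\<in>W. {C \<in> \<C>. e \<in> C})" using WE \<C> by auto
          show "S1 \<subseteq> (\<Union>e\<in>W. {C \<in> \<C>. e \<in> C})" using less.prems by (auto simp: S1_def)
          show "0 \<le> y C / (1 - y C)" if "C \<in> (\<Union>e\<in>W. {C \<in> \<C>. e \<in> C}) - S1" for C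
            using that y0[of C] y1[of C] by auto
        qed
        also have "\<dots> \<le> (\<Sum>e\<in>W. \<Sum>C | C \<in> \<C> \<and> e \<in> C. y C / (1 - y C))"
          by (rule sum_UN_le) (use WE \<C> y0 y1 in \<open>auto simp: less_imp_le\<close>)
        also have "\<dots> \<le> (\<Sum>e\<in>W. p - \<mu>)"
          by (rule sum_mono) (use WE loss in \<open>auto simp: y_def\<close>)
        finally have loss': "(\<Sum>C\<in>S1. y C / (1 - y C)) \<le> card W * (p - \<mu>)" by simp
        have "P (\<lambda>F. F \<inter> W = {} \<and> N S T F) \<le> P (\<lambda>F. F \<inter> W = {} \<and> N S2 T F)"
          by (rule P_mono) (auto simp: N_def S2_def)
        also have "\<dots> \<le> (1 - p) ^ card W * P (N S2 T)"
          unfolding P_def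
        proof (rule sub_weight_disjoint_le[OF E p WE(1)])
          fix e F assume e: "e \<in> W" and N: "N S2 T F"
          have "\<not> C \<subseteq> insert e F" if "C \<in> S2" for C
          proof -
            have "e \<notin> C" using that e by (auto simp: S2_def S1_def)
            then show ?thesis using N that unfolding N_def by blast
          qed
          then show "N S2 T (insert e F)" using N unfolding N_def by blast
        qed
        also have "\<dots> \<le> exp (- p * card W) * P (N S2 T)"
        proof (rule mult_right_mono)
          have "1 - p \<le> exp (- p)" using exp_ge_add_one_self[of "- p"] by simp
          then have "(1 - p) ^ card W \<le> exp (- p) ^ card W" using p by (intro power_mono) auto
          then show "(1 - p) ^ card W \<le> exp (- p * card W)" by (simp add: exp_of_nat_mult[symmetric] mult.commute)
        qed (rule P_nonneg)
        also have "\<dots> \<le> exp (- \<mu> * card W - (\<Sum>C\<in>S1. y C / (1 - y C))) * P (N S2 T)"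
          using loss' P_nonneg by (intro mult_right_mono) (auto simp: algebra_simps)
        also have "\<dots> = exp (- \<mu> * card W) * (exp (- (\<Sum>C\<in>S1. y C / (1 - y C))) * P (N S2 T))"
          by (simp add: mult_exp_exp flip: mult.assoc)
        also have "\<dots> \<le> exp (- \<mu> * card W) * ((\<Prod>C\<in>S1. 1 - y C) * P (N S2 T))"
          using prod P_nonneg by (intro mult_left_mono mult_right_mono) auto
        also have "\<dots> \<le> exp (- \<mu> * card W) * P (N S T)"
          using 1 by (intro mult_left_mono) auto
        finally show ?thesis .
      qed
      \<comment> \<open>A group is exponentially large, but its union bound is still at most
        \<zeta>. It therefore enters the dependency count of a cycle as a single event.\<close>
      have "P (\<lambda>F. (\<exists>W\<in>\<W> j. F \<inter> W = {}) \<and> N S T F) = P (\<lambda>F. \<exists>W\<in>\<W> j. F \<inter> W = {} \<and> N S T F)"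
        by (rule arg_cong[of _ _ P]) (auto simp: fun_eq_iff)
      also have "\<dots> \<le> (\<Sum>W\<in>\<W> j. P (\<lambda>F. F \<inter> W = {} \<and> N S T F))"
        unfolding P_def by (rule sub_weight_union_bound[OF E p J(2)[OF j]])
      also have "\<dots> \<le> (\<Sum>W\<in>\<W> j. exp (- \<mu> * card W) * P (N S T))"
        by (rule sum_mono) (rule W)
      also have "\<dots> = (\<Sum>W\<in>\<W> j. exp (- \<mu> * card W)) * P (N S T)" by (simp add: sum_distrib_right)
      also have "\<dots> \<le> \<zeta> * P (N S T)" using group[OF j] P_nonneg by (rule mult_right_mono)
      finally show "P (\<lambda>F. (\<exists>W\<in>\<W> j. F \<inter> W = {}) \<and> N S T F) \<le> \<zeta> * P (N S T)" .
    qed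
  qed

  have "(\<Prod>C\<in>\<C>. 1 - y C) * P (N {} {}) \<le> P (N ({} \<union> \<C>) {})"
  proof (rule add_cycles)
    fix C S'' assume "C \<in> \<C>" "S'' \<subseteq> \<C> - {C}"
    then show "P (\<lambda>F. C \<subseteq> F \<and> N ({} \<union> S'') {} F) \<le> y C * P (N ({} \<union> S'') {})"
      using main[of "S''" "{}"] by auto
  qed (use \<C> in auto)
  moreover have "(1 - \<zeta>) ^ card J * P (N \<C> {}) \<le> P (N \<C> ({} \<union> J))"
  proof (rule add_groups)
    fix j T'' assume "j \<in> J" "T'' \<subseteq> J - {j}"
    then show "P (\<lambda>F. (\<exists>W\<in>\<W> j. F \<inter> W = {}) \<and> N \<C> ({} \<union> T'') F) \<le> \<zeta> * P (N \<C> ({} \<union> T''))"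
      using main[of \<C> T''] by auto
  qed (use J in auto)
  moreover have "P (N {} {}) = 1"
  proof -
    have "N {} {} = (\<lambda>_. True)" by (simp add: N_def fun_eq_iff)
    then show ?thesis using sub_weight_True[OF E, of p] by (simp add: P_def)
  qed
  moreover have "0 < (\<Prod>C\<in>\<C>. 1 - y C)" using y1 by (intro prod_pos) auto
  moreover have "0 < (1 - \<zeta>) ^ card J" using \<zeta> by simp
  ultimately have "0 < P (N \<C> {})" "(1 - \<zeta>) ^ card J * P (N \<C> {}) \<le> P (N \<C> J)" by auto
  then have "0 < P (N \<C> J)"
    using \<open>0 < (1 - \<zeta>) ^ card J\<close> by (meson less_le_trans mult_pos_pos)
  then have "{F. F \<subseteq> E \<and> N \<C> J F} \<noteq> {}"
    unfolding P_def sub_weight_def by (metis (mono_tags, lifting) less_irrefl sum.empty)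
  then show ?thesis unfolding N_def by blast
qed

section \<open>Colour-critical graphs\<close>

lemma proper_colouring_mono:
  assumes "proper_colouring G k c" "k \<le> l"
  shows "proper_colouring G l c"
  using assms unfolding proper_colouring_def by fastforce

lemma chromatic_number_gt_iff:
  "chromatic_number G > enat x \<longleftrightarrow> (\<nexists>c. proper_colouring G x c)"
proof
  assume "chromatic_number G > enat x"
  then show "\<nexists>c. proper_colouring G x c"
    unfolding chromatic_number_def by (metis (mono_tags, lifting) INF_lower leD mem_Collect_eq)
next
  assume *: "\<nexists>c. proper_colouring G x c"
  have "enat (Suc x) \<le> chromatic_number G"
    unfolding chromatic_number_def
  proof (rule INF_greatest)
    fix k assume "k \<in> {k. \<exists>c. proper_colouring G k c}"
    then have "\<not> k \<le> x" using * proper_colouring_mono by blast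
    then show "enat (Suc x) \<le> enat k" by simp
  qed
  then show "chromatic_number G > enat x"
    by (meson enat_ord_simps(2) lessI less_le_trans)
qed

lemma girth_gt_iff:
  "girth G > enat g \<longleftrightarrow> (\<forall>p. is_cycle G p \<longrightarrow> g < length p)"
proof
  assume "girth G > enat g"
  then show "\<forall>p. is_cycle G p \<longrightarrow> g < length p"
    unfolding girth_def
    by (metis (mono_tags, lifting) INF_lower mem_Collect_eq enat_ord_simps(2) less_le_trans)
next
  assume *: "\<forall>p. is_cycle G p \<longrightarrow> g < length p"
  have "enat (Suc g) \<le> girth G"
    unfolding girth_def by (rule INF_greatest) (use * in \<open>auto simp: Suc_le_eq\<close>)
  then show "girth G > enat g"
    by (meson enat_ord_simps(2) lessI less_le_trans)
qed

definition induced :: "'a ugraph \<Rightarrow> 'a set \<Rightarrow> 'a ugraph" where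
  "induced G S = (S, {e \<in> edges G. e \<subseteq> S})"

text \<open>By Tychonoff the maps from the vertices to \<open>{..<x}\<close> form a compact space,
  and being proper on one edge is a closed condition. By the finite intersection property finitely
  many edges already exclude a colouring; \<open>S\<close> is the set of their ends.\<close>

lemma de_Bruijn_Erdos:
  assumes G: "simple_graph G" and x: "x > 0" and no: "\<nexists>c. proper_colouring G x c"
  obtains S where "finite S" "S \<subseteq> verts G" "\<nexists>c. proper_colouring (induced G S) x c"
proof -
  define X where "X = product_topology (\<lambda>_::'a. discrete_topology {..<x}) (verts G)"
  define K where "K u v = {c \<in> topspace X. c u \<noteq> c v}" for u v
  \<comment> \<open>With \<open>topspace X\<close> as a member, a point of the intersection is a
    genuine colouring with values below \<open>x\<close>.\<close>
  define \<U> where "\<U> = insert (topspace X) {K u v | u v. {u, v} \<in> edges G}"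
  have top: "topspace X = (\<Pi>\<^sub>E v\<in>verts G. {..<x})" by (simp add: X_def)
  have compact: "compact_space X"
    unfolding X_def compact_space_product_topology by (simp add: compact_space_discrete_topology)
  have edge: "u \<in> verts G \<and> v \<in> verts G" if "{u, v} \<in> edges G" for u v
    using G that by (auto simp: simple_graph_def)
  have cts: "closedin X {c \<in> topspace X. c v \<in> A}" if "v \<in> verts G" "A \<subseteq> {..<x}" for v A
    unfolding X_def
    by (rule closedin_continuous_map_preimage[OF continuous_map_product_coordinates]) (use that in auto)
  have closed: "closedin X (K u v)" if "{u, v} \<in> edges G" for u v
  proof -
    have eq: "K u v = (\<Union>i<x. {c \<in> topspace X. c u \<in> {i}} \<inter> {c \<in> topspace X. c v \<in> {..<x} - {i}})"
      using edge[OF that] by (auto simp: K_def top PiE_iff)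
    show ?thesis
      unfolding eq
    proof (rule closedin_Union)
      fix T assume "T \<in> (\<lambda>i. {c \<in> topspace X. c u \<in> {i}} \<inter> {c \<in> topspace X. c v \<in> {..<x} - {i}}) ` {..<x}"
      then obtain i where "i < x" and T: "T = {c \<in> topspace X. c u \<in> {i}} \<inter> {c \<in> topspace X. c v \<in> {..<x} - {i}}"
        by blast
      show "closedin X T"
        unfolding T by (rule closedin_Int; rule cts) (use edge[OF that] \<open>i < x\<close> in auto)
    qed simp
  qed
  have "\<Inter>\<U> = {}"
  proof (rule ccontr)
    assume "\<Inter>\<U> \<noteq> {}"
    then obtain c where c: "c \<in> \<Inter>\<U>" by blast
    then have "c \<in> topspace X" "\<And>u v. {u, v} \<in> edges G \<Longrightarrow> c u \<noteq> c v"
      by (auto simp: \<U>_def K_def)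
    then have "proper_colouring G x c" by (auto simp: proper_colouring_def top PiE_iff)
    then show False using no by blast
  qed
  moreover have "\<forall>C\<in>\<U>. closedin X C" using closed by (auto simp: \<U>_def)
  ultimately obtain \<F> where \<F>: "finite \<F>" "\<F> \<subseteq> \<U>" "\<Inter>\<F> = {}"
    using compact unfolding compact_space_fip by metis
  have "\<forall>C\<in>\<F> - {topspace X}. \<exists>u v. {u, v} \<in> edges G \<and> C = K u v"
    using \<F>(2) unfolding \<U>_def by blast
  then obtain u v where uv: "\<And>C. C \<in> \<F> - {topspace X} \<Longrightarrow> {u C, v C} \<in> edges G \<and> C = K (u C) (v C)"
    by metis
  define S where "S = u ` (\<F> - {topspace X}) \<union> v ` (\<F> - {topspace X})"
  have "finite S" using \<F>(1) by (simp add: S_def)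
  have "S \<subseteq> verts G" using uv edge unfolding S_def by blast
  have "\<nexists>c. proper_colouring (induced G S) x c"
  proof
    assume "\<exists>c. proper_colouring (induced G S) x c"
    then obtain c where c: "proper_colouring (induced G S) x c" by blast
    \<comment> \<open>Colour 0 exists because \<open>x > 0\<close>; the value
      \<open>undefined\<close> off the vertices is what the extensional product demands.\<close>
    define d where "d w = (if w \<in> S then c w else if w \<in> verts G then 0 else undefined)" for w
    have d: "d \<in> topspace X"
      using c x \<open>S \<subseteq> verts G\<close> by (auto simp: top d_def proper_colouring_def induced_def)
    have "d \<in> C" if "C \<in> \<F>" for C
    proof (cases "C = topspace X")
      case False
      then have C: "{u C, v C} \<in> edges G" "C = K (u C) (v C)" and S: "u C \<in> S" "v C \<in> S"
        using uv[of C] that unfolding S_def by blast+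
      have "c (u C) \<noteq> c (v C)"
        using c C(1) S by (auto simp: proper_colouring_def induced_def)
      then have "d (u C) \<noteq> d (v C)" using S by (simp add: d_def)
      then have "d \<in> K (u C) (v C)" using d by (simp add: K_def)
      then show ?thesis using C(2) by metis
    qed (use d in auto)
    then show False using \<F>(3) by blast
  qed
  then show ?thesis using that \<open>finite S\<close> \<open>S \<subseteq> verts G\<close> by metis
qed

text \<open>The finite (x+1)-vertex-critical graphs.\<close>

definition critical :: "nat \<Rightarrow> 'a ugraph \<Rightarrow> bool" where
  "critical x G \<longleftrightarrow> finite (verts G) \<and> simple_graph G \<and> (\<nexists>c. proper_colouring G x c) \<and>
     (\<forall>v\<in>verts G. \<exists>c. proper_colouring (induced G (verts G - {v})) x c)"

lemma simple_graph_induced: "simple_graph G \<Longrightarrow> simple_graph (induced G S)"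
  by (auto simp: simple_graph_def induced_def)

lemma induced_induced: "T \<subseteq> S \<Longrightarrow> induced (induced G S) T = induced G T"
  by (auto simp: induced_def)

lemma critical_subgraph:
  assumes G: "simple_graph G" and x: "x > 0" and no: "\<nexists>c. proper_colouring G x c"
  obtains S where "S \<subseteq> verts G" "critical x (induced G S)"
proof -
  define P where "P S \<longleftrightarrow> finite S \<and> S \<subseteq> verts G \<and> (\<nexists>c. proper_colouring (induced G S) x c)" for S
  obtain S0 where "P S0" using de_Bruijn_Erdos[OF assms] unfolding P_def by metis
  then obtain S where S: "P S" "\<And>T. P T \<Longrightarrow> card S \<le> card T"
    using ex_has_least_nat[of P S0 card] by blast
  have "\<exists>c. proper_colouring (induced (induced G S) (S - {v})) x c" if "v \<in> S" for v
  proof -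
    have "card (S - {v}) < card S" using S(1) that card_Diff1_less unfolding P_def by metis
    then have "\<not> P (S - {v})" using S(2) leD by blast
    then show ?thesis using S(1) by (subst induced_induced) (auto simp: P_def)
  qed
  moreover have "verts (induced G S) = S" by (simp add: induced_def)
  ultimately have "critical x (induced G S)"
    using S(1) simple_graph_induced[OF G] unfolding critical_def P_def by metis
  then show ?thesis using that S(1) P_def by blast
qed

lemma neighbours_induced_subset: "neighbours (induced G S) v \<subseteq> neighbours G v"
  by (auto simp: neighbours_def induced_def)

lemma card_neighbours_le:
  assumes "max_degree G \<le> enat \<Delta>" "v \<in> verts G"
  shows "finite (neighbours G v)" "card (neighbours G v) \<le> \<Delta>"
proof -
  have "vertex_degree G v \<le> enat \<Delta>"
    using assms unfolding max_degree_def by (meson SUP_upper order_trans)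
  then show "finite (neighbours G v)" "card (neighbours G v) \<le> \<Delta>"
    by (auto simp: vertex_degree_def split: if_splits)
qed

lemma neighbours_verts:
  assumes "simple_graph G" "w \<in> neighbours G v"
  shows "w \<in> verts G" "v \<in> verts G" "w \<noteq> v"
  using assms by (auto simp: neighbours_def simple_graph_def)

text \<open>With fewer than \<open>x\<close> neighbours, a colouring of the rest would leave a spare
  colour for \<open>v\<close>. This supplies the \<open>x\<close> neighbouring parts of the groups
  at a vertex, and also \<open>x \<le> \<Delta>\<close>.\<close>

lemma critical_degree:
  assumes G: "critical x G" and v: "v \<in> verts G" and fin: "finite (neighbours G v)"
  shows "x \<le> card (neighbours G v)"
proof (rule ccontr)
  assume less: "\<not> x \<le> card (neighbours G v)"
  obtain c where c: "proper_colouring (induced G (verts G - {v})) x c"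
    using G v by (auto simp: critical_def)
  have "card (c ` neighbours G v) < card {..<x}" using less card_image_le[OF fin, of c] by simp
  then have "\<not> {..<x} \<subseteq> c ` neighbours G v" using fin card_mono[of "c ` neighbours G v" "{..<x}"] by fastforce
  then obtain i where i: "i < x" "i \<notin> c ` neighbours G v" by blast
  have "proper_colouring G x (c(v := i))"
    unfolding proper_colouring_def
  proof (intro conjI ballI allI impI)
    fix u assume "u \<in> verts G"
    then show "(c(v := i)) u < x" using c i by (auto simp: proper_colouring_def induced_def)
  next
    fix u w assume uw: "{u, w} \<in> edges G"
    then have uw': "u \<noteq> w" "u \<in> verts G" "w \<in> verts G"
      using G by (auto simp: critical_def simple_graph_def)
    show "(c(v := i)) u \<noteq> (c(v := i)) w"
    proof (cases "u = v \<or> w = v")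
      case True
      then show ?thesis using uw uw' i by (auto simp: neighbours_def insert_commute)
    next
      case False
      then show ?thesis using uw uw' c by (auto simp: proper_colouring_def induced_def)
    qed
  qed
  then show False using G by (auto simp: critical_def)
qed

text \<open>Otherwise \<open>c\<close> could take the colour that \<open>a\<close> has in a
  colouring of the graph without \<open>c\<close>. Hence two distinct vertices never share all
  neighbours of one of them, which sharpens the counts of triangles and 4-cycles.\<close>

lemma critical_not_dominated:
  assumes G: "critical x G" and "a \<in> verts G" "c \<in> verts G" "a \<noteq> c"
  shows "\<not> neighbours G c \<subseteq> neighbours G a"
proof
  assume dom: "neighbours G c \<subseteq> neighbours G a"
  obtain f where f: "proper_colouring (induced G (verts G - {c})) x f"
    using G assms(3) by (auto simp: critical_def)
  have fe: "f u \<noteq> f w" if "{u, w} \<in> edges G" "u \<noteq> c" "w \<noteq> c" for u w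
  proof -
    have "{u, w} \<subseteq> verts G" using G that by (auto simp: critical_def simple_graph_def)
    then show ?thesis using f that by (auto simp: proper_colouring_def induced_def)
  qed
  have fa: "f a \<noteq> f w" if "{c, w} \<in> edges G" for w
  proof -
    have "{a, w} \<in> edges G" using that dom by (auto simp: neighbours_def)
    moreover have "w \<noteq> c" using that G by (auto simp: critical_def simple_graph_def)
    ultimately show ?thesis using fe assms by blast
  qed
  have "proper_colouring G x (f(c := f a))"
    unfolding proper_colouring_def
  proof (intro conjI ballI allI impI)
    fix u assume "u \<in> verts G"
    then show "(f(c := f a)) u < x" using f assms by (auto simp: proper_colouring_def induced_def)
  next
    fix u w assume uw: "{u, w} \<in> edges G"
    then have "u \<noteq> w" using G by (auto simp: critical_def simple_graph_def)
    then show "(f(c := f a)) u \<noteq> (f(c := f a)) w"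
      using fe[OF uw] fa[of w] fa[of u] uw by (auto simp: insert_commute)
  qed
  then show False using G by (auto simp: critical_def)
qed

lemma is_subgraph_trans: "is_subgraph A B \<Longrightarrow> is_subgraph B C \<Longrightarrow> is_subgraph A C"
  by (auto simp: is_subgraph_def)

lemma is_subgraph_blow_up_induced:
  assumes "simple_graph G" "S \<subseteq> verts G"
  shows "is_subgraph (blow_up (induced G S) m) (blow_up G m)"
  unfolding is_subgraph_def
proof (intro conjI)
  show "simple_graph (blow_up (induced G S) m)"
    by (intro simple_graph_blow_up simple_graph_induced assms)
  show "verts (blow_up (induced G S) m) \<subseteq> verts (blow_up G m)"
    using assms(2) by (auto simp: blow_up_def induced_def)
  have "edges (induced G S) \<subseteq> edges G" by (auto simp: induced_def)
  then show "edges (blow_up (induced G S) m) \<subseteq> edges (blow_up G m)"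
    unfolding blow_up_def by fastforce
qed

section \<open>Cycles and walks in blow-ups\<close>

fun path_edges :: "'a list \<Rightarrow> 'a set set" where
  "path_edges (a # b # r) = insert {a, b} (path_edges (b # r))"
| "path_edges _ = {}"

text \<open>Cycles are compared as edge sets: all rotations and reversals of a vertex list give the
  same set, and the local lemma speaks of random edge sets containing it.\<close>

definition cycle_edges :: "'a list \<Rightarrow> 'a set set" where
  "cycle_edges p = insert {last p, hd p} (path_edges p)"

lemma path_edges_append: "path_edges (xs @ y # ys) = path_edges (xs @ [y]) \<union> path_edges (y # ys)"
proof (induction xs)
  case (Cons a xs)
  then show ?case by (cases xs) auto
qed simp

lemma path_edges_rev: "path_edges (rev xs) = path_edges xs"
proof (induction xs rule: path_edges.induct)
  case (1 a b r)
  have "path_edges (rev (a # b # r)) = path_edges (rev r @ b # [a])" by simp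
  also have "\<dots> = path_edges (rev r @ [b]) \<union> path_edges [b, a]" by (rule path_edges_append)
  finally show ?case using 1 by (auto simp: insert_commute)
qed auto

lemma path_edges_conv_nth: "path_edges xs = {{xs ! i, xs ! Suc i} | i. Suc i < length xs}"
proof (induction xs rule: path_edges.induct)
  case (1 a b r)
  have "{{(a # b # r) ! i, (a # b # r) ! Suc i} | i. Suc i < length (a # b # r)} =
     insert {a, b} {{(b # r) ! i, (b # r) ! Suc i} | i. Suc i < length (b # r)}" (is "?L = ?R")
  proof (intro Set.set_eqI iffI)
    fix e assume "e \<in> ?L"
    then obtain i where "Suc i < length (a # b # r)" "e = {(a # b # r) ! i, (a # b # r) ! Suc i}" by blast
    then show "e \<in> ?R" by (cases i) auto
  next
    fix e assume "e \<in> ?R"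
    then consider "e = {a, b}" | i where "Suc i < length (b # r)" "e = {(b # r) ! i, (b # r) ! Suc i}" by blast
    then show "e \<in> ?L"
    proof cases
      case 1
      then show ?thesis by (auto intro!: exI[of _ 0])
    next
      case 2
      then show ?thesis by (auto intro!: exI[of _ "Suc i"])
    qed
  qed
  then show ?case using 1 by simp
qed auto

lemma cycle_edges_conv_nth:
  assumes "p \<noteq> []"
  shows "cycle_edges p = {{p ! i, p ! (Suc i mod length p)} | i. i < length p}"
proof (intro Set.set_eqI iffI)
  fix e assume "e \<in> cycle_edges p"
  then consider "e = {last p, hd p}" | i where "Suc i < length p" "e = {p ! i, p ! Suc i}"
    by (auto simp: cycle_edges_def path_edges_conv_nth)
  then show "e \<in> {{p ! i, p ! (Suc i mod length p)} | i. i < length p}"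
  proof cases
    case 1
    then show ?thesis using assms
      by (auto simp: last_conv_nth hd_conv_nth intro!: exI[of _ "length p - 1"])
  next
    case 2
    then show ?thesis by (auto intro!: exI[of _ i])
  qed
next
  fix e assume "e \<in> {{p ! i, p ! (Suc i mod length p)} | i. i < length p}"
  then obtain i where i: "i < length p" "e = {p ! i, p ! (Suc i mod length p)}" by blast
  show "e \<in> cycle_edges p"
  proof (cases "Suc i < length p")
    case True
    then show ?thesis using i by (auto simp: cycle_edges_def path_edges_conv_nth)
  next
    case False
    then have "Suc i = length p" using i by simp
    then have "i = length p - 1" "Suc i mod length p = 0" by auto
    then show ?thesis using i assms by (auto simp: cycle_edges_def last_conv_nth hd_conv_nth)
  qed
qed

lemma is_cycle_iff: "is_cycle G p \<longleftrightarrow> 3 \<le> length p \<and> distinct p \<and> cycle_edges p \<subseteq> edges G"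
proof (cases "p = []")
  case False
  then show ?thesis unfolding is_cycle_def cycle_edges_conv_nth[OF False] by blast
qed (simp add: is_cycle_def)

lemma finite_cycle_edges: "finite (cycle_edges p)"
  unfolding cycle_edges_def by (induction p rule: path_edges.induct) auto

text \<open>Two different positions with the same edge would be successors of each other, so the
  length would divide 2.\<close>

lemma card_cycle_edges:
  assumes "3 \<le> length p" "distinct p"
  shows "card (cycle_edges p) = length p"
proof -
  let ?n = "length p"
  have inj: "inj_on (\<lambda>i. {p ! i, p ! (Suc i mod ?n)}) {..<?n}"
  proof (rule inj_onI)
    fix i j assume ij: "i \<in> {..<?n}" "j \<in> {..<?n}" "{p ! i, p ! (Suc i mod ?n)} = {p ! j, p ! (Suc j mod ?n)}"
    have "0 < ?n" using assms by linarith
    then have lt: "Suc i mod ?n < ?n" "Suc j mod ?n < ?n" by simp_all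
    have eq: "a < ?n \<Longrightarrow> b < ?n \<Longrightarrow> p ! a = p ! b \<longleftrightarrow> a = b" for a b
      using assms by (simp add: nth_eq_iff_index_eq)
    have "i = j \<or> (i = Suc j mod ?n \<and> Suc i mod ?n = j)"
      using ij lt by (auto simp: doubleton_eq_iff eq)
    then show "i = j"
    proof
      assume *: "i = Suc j mod ?n \<and> Suc i mod ?n = j"
      have "Suc (Suc j mod ?n) mod ?n = (j + 2) mod ?n" by (simp add: mod_Suc_eq)
      then have 2: "(j + 2) mod ?n = j" using * by metis
      show ?thesis
      proof (cases "j + 2 < ?n")
        case False
        then have "(j + 2) mod ?n = j + 2 - ?n"
          using ij assms by (simp add: mod_if)
        then show ?thesis using 2 False assms by linarith
      qed (use 2 in simp)
    qed blast
  qed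
  have "cycle_edges p = (\<lambda>i. {p ! i, p ! (Suc i mod ?n)}) ` {..<?n}"
    using assms by (subst cycle_edges_conv_nth) auto
  then show ?thesis using card_image[OF inj] by simp
qed

lemma cycle_edges_rev: "cycle_edges (rev p) = cycle_edges p"
proof (cases "p = []")
  case False
  then show ?thesis by (simp add: cycle_edges_def path_edges_rev last_rev hd_rev insert_commute)
qed simp

lemma path_edges_split:
  assumes "e \<in> path_edges p"
  obtains xs a b ys where "p = xs @ a # b # ys" "e = {a, b}"
proof -
  obtain i where i: "Suc i < length p" "e = {p ! i, p ! Suc i}"
    using assms by (auto simp: path_edges_conv_nth)
  have "p = take i p @ p ! i # p ! Suc i # drop (Suc (Suc i)) p"
    using i by (simp add: Cons_nth_drop_Suc id_take_nth_drop)
  then show ?thesis using that i by blast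
qed

lemma cycle_edges_rotate:
  assumes "p = xs @ a # b # ys"
  shows "cycle_edges (b # ys @ xs @ [a]) = cycle_edges p"
proof -
  have "path_edges (b # ys @ xs @ [a]) \<union> {{a, b}} = insert {last p, hd p} (path_edges (xs @ [a]) \<union> path_edges [a, b] \<union> path_edges (b # ys))"
  proof (cases "xs = []")
    case True
    have "path_edges (b # ys @ [a]) = path_edges (b # ys) \<union> {{last (b # ys), a}}"
    proof -
      have "b # ys @ [a] = butlast (b # ys) @ last (b # ys) # [a]" 
        by (metis append_Cons append_butlast_last_id append.assoc append_Nil list.distinct(1))
      then have "path_edges (b # ys @ [a]) = path_edges (butlast (b # ys) @ [last (b # ys)]) \<union> path_edges [last (b # ys), a]"
        by (metis path_edges_append)
      then show ?thesis by simp
    qed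
    then show ?thesis using True assms by auto
  next
    case False
    then obtain z zs where xs: "xs = z # zs" by (cases xs) auto
    have "b # ys @ xs @ [a] = (b # ys) @ z # zs @ [a]" using xs by simp
    then have "path_edges (b # ys @ xs @ [a]) = path_edges ((b # ys) @ [z]) \<union> path_edges (xs @ [a])"
      using xs by (metis append_Cons path_edges_append)
    moreover have "path_edges ((b # ys) @ [z]) = path_edges (b # ys) \<union> {{last (b # ys), z}}"
    proof -
      have "(b # ys) @ [z] = butlast (b # ys) @ last (b # ys) # [z]" 
        by (metis append_Cons append_butlast_last_id append.assoc append_Nil list.distinct(1))
      then have "path_edges ((b # ys) @ [z]) = path_edges (butlast (b # ys) @ [last (b # ys)]) \<union> path_edges [last (b # ys), z]"
        by (metis path_edges_append)
      then show ?thesis by simp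
    qed
    ultimately show ?thesis using assms xs by auto
  qed
  moreover have "path_edges p = path_edges (xs @ [a]) \<union> (path_edges [a, b] \<union> path_edges (b # ys))"
    unfolding assms by (subst path_edges_append) simp
  ultimately show ?thesis by (auto simp: cycle_edges_def)
qed

text \<open>Rotation and reversal make the given edge the closing one. The list \<open>r\<close> of
  the \<open>length p - 2\<close> inner vertices then determines the edge set, so cycles through an
  edge are counted by walks.\<close>

lemma cycle_edges_through:
  assumes p: "3 \<le> length p" and e: "{u, v} \<in> cycle_edges p"
  obtains r where "length r = length p - 2" "cycle_edges p = insert {u, v} (path_edges (v # r @ [u]))"
proof -
  obtain q where q: "length q = length p" "cycle_edges q = cycle_edges p" "{last q, hd q} = {u, v}"
  proof (cases "{u, v} = {last p, hd p}")
    case True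
    then show ?thesis using that[of p] by simp
  next
    case False
    then have "{u, v} \<in> path_edges p" using e by (simp add: cycle_edges_def)
    then obtain xs a b ys where "p = xs @ a # b # ys" "{u, v} = {a, b}" by (rule path_edges_split)
    then show ?thesis using that[of "b # ys @ xs @ [a]"] cycle_edges_rotate by fastforce
  qed
  obtain q' where q': "length q' = length p" "cycle_edges q' = cycle_edges p" "last q' = u" "hd q' = v"
  proof (cases "last q = u \<and> hd q = v")
    case False
    then have "last q = v" "hd q = u" using q by (auto simp: doubleton_eq_iff)
    then show ?thesis using that[of "rev q"] q p cycle_edges_rev[of q] by (cases "q = []") (auto simp: last_rev hd_rev)
  qed (use that q in blast)
  define r where "r = butlast (tl q')"
  have "q' = v # r @ [u]"
    using q' p by (cases q'; cases "tl q' = []") (auto simp: r_def)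
  then show ?thesis using that[of r] q' by (auto simp: cycle_edges_def insert_commute)
qed

section \<open>Short cycles through an edge of a blow-up\<close>

lemma blow_up_edge_iff:
  "{(a, i), (b, j)} \<in> edges (blow_up G m) \<longleftrightarrow> {a, b} \<in> edges G \<and> i < m \<and> j < m"
  by (auto simp: blow_up_def doubleton_eq_iff insert_commute)

lemma blow_up_edgeE:
  assumes "e \<in> edges (blow_up G m)"
  obtains a i b j where "e = {(a, i), (b, j)}" "{a, b} \<in> edges G" "i < m" "j < m"
  using assms by (auto simp: blow_up_def)

lemma finite_edges_blow_up:
  assumes "finite (verts G)" "simple_graph G"
  shows "finite (edges (blow_up G m))"
proof (rule finite_subset)
  show "edges (blow_up G m) \<subseteq> Pow (verts (blow_up G m))"
    using simple_graph_blow_up[OF assms(2)] unfolding simple_graph_def by blast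
  show "finite (Pow (verts (blow_up G m)))" using assms by (simp add: blow_up_def)
qed

lemma neighbours_blow_up:
  "neighbours (blow_up G m) (b, j) = (if j < m then neighbours G b \<times> {..<m} else {})"
  by (auto simp: neighbours_def blow_up_edge_iff)

definition walks :: "'a ugraph \<Rightarrow> 'a \<Rightarrow> nat \<Rightarrow> 'a list set" where
  "walks G v l = {r. length r = l \<and> path_edges (v # r) \<subseteq> edges G}"

lemma walks_Suc: "walks G v (Suc l) = (\<Union>w\<in>neighbours G v. Cons w ` walks G w l)"
  by (auto simp: walks_def neighbours_def length_Suc_conv)

lemma walks_0: "walks G v 0 = {[]}"
  by (auto simp: walks_def)

lemma card_walks_le:
  assumes "\<And>v. finite (neighbours G v)" "\<And>v. card (neighbours G v) \<le> d"
  shows "finite (walks G v l) \<and> card (walks G v l) \<le> d ^ l"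
proof (induction l arbitrary: v)
  case 0
  then show ?case by (simp add: walks_0)
next
  case (Suc l)
  have "card (walks G v (Suc l)) \<le> (\<Sum>w\<in>neighbours G v. card (Cons w ` walks G w l))"
    unfolding walks_Suc by (rule card_UN_le) (use assms in auto)
  also have "\<dots> \<le> (\<Sum>w\<in>neighbours G v. d ^ l)"
    by (rule sum_mono) (use Suc in \<open>auto simp: card_image\<close>)
  also have "\<dots> \<le> d * d ^ l" using assms(2)[of v] by simp
  finally show ?case using Suc assms by (simp add: walks_Suc)
qed

text \<open>Inner vertices of the walks from \<open>v\<close> to \<open>u\<close> with
  \<open>l + 1\<close> edges. Vertices may repeat, since only upper bounds are drawn from the count;
  forgetting that the walk must end in \<open>u\<close> yields the crude bound through
  \<open>walks\<close>.\<close>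

definition closing_walks :: "'a ugraph \<Rightarrow> 'a \<Rightarrow> 'a \<Rightarrow> nat \<Rightarrow> 'a list set" where
  "closing_walks G u v l = {r. length r = l \<and> path_edges (v # r @ [u]) \<subseteq> edges G}"

lemma path_edges_snoc_subset: "path_edges (v # r) \<subseteq> path_edges (v # r @ [u])"
proof (induction r arbitrary: v)
  case (Cons a r)
  then show ?case by auto
qed simp

lemma closing_walks_subset: "closing_walks G u v l \<subseteq> walks G v l"
  using path_edges_snoc_subset by (force simp: closing_walks_def walks_def)

lemma closing_walks_1: "closing_walks G u v 1 = (\<lambda>w. [w]) ` (neighbours G v \<inter> neighbours G u)"
  by (auto simp: closing_walks_def neighbours_def length_Suc_conv insert_commute)

lemma closing_walks_2:
  "closing_walks G u v 2 = (\<Union>w\<in>neighbours G v. (\<lambda>z. [w, z]) ` (neighbours G w \<inter> neighbours G u))"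
proof (intro Set.set_eqI iffI)
  fix r assume "r \<in> closing_walks G u v 2"
  then obtain w z where "r = [w, z]" "{v, w} \<in> edges G" "{w, z} \<in> edges G" "{z, u} \<in> edges G"
    by (auto simp: closing_walks_def numeral_2_eq_2 length_Suc_conv)
  then show "r \<in> (\<Union>w\<in>neighbours G v. (\<lambda>z. [w, z]) ` (neighbours G w \<inter> neighbours G u))"
    by (auto simp: neighbours_def insert_commute intro!: bexI[of _ w])
qed (auto simp: closing_walks_def neighbours_def insert_commute)

text \<open>
  The refined values for triangles and 4-cycles use that in a critical graph two distinct vertices
  share at most \<open>\<Delta> - 1\<close> neighbours.
\<close>

definition cycle_count :: "nat \<Rightarrow> nat \<Rightarrow> nat \<Rightarrow> nat" where
  "cycle_count \<Delta> m k = (if k = 3 then (\<Delta> - 1) * m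
     else if k = 4 then (\<Delta> + (\<Delta> - 1) * (\<Delta> - 1)) * m ^ 2 else (\<Delta> * m) ^ (k - 2))"

lemma card_closing_walks:
  assumes G: "critical x G" and \<Delta>: "\<And>v. card (neighbours G v) \<le> \<Delta>"
    and e: "{u, v} \<in> edges (blow_up G m)" and k: "3 \<le> k"
  shows "finite (closing_walks (blow_up G m) u v (k - 2)) \<and>
    card (closing_walks (blow_up G m) u v (k - 2)) \<le> cycle_count \<Delta> m k"
proof -
  let ?B = "blow_up G m"
  have sg: "simple_graph G" using G by (simp add: critical_def)
  have finN: "finite (neighbours G b)" for b
    by (rule finite_subset[of _ "verts G"]) (use G neighbours_verts[OF sg] in \<open>auto simp: critical_def\<close>)
  have finB: "finite (neighbours ?B w)" and cardB: "card (neighbours ?B w) \<le> \<Delta> * m" for w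
    using finN \<Delta> by (cases w; simp add: neighbours_blow_up)+
  have fin: "finite (closing_walks ?B u v (k - 2))"
    and le: "card (closing_walks ?B u v (k - 2)) \<le> (\<Delta> * m) ^ (k - 2)"
    using card_walks_le[of ?B "\<Delta> * m" v "k - 2"] finB cardB closing_walks_subset[of ?B u v "k - 2"]
    by (auto intro: finite_subset order_trans[OF card_mono])
  obtain a i b j where uv: "u = (a, i)" "v = (b, j)" by (metis surj_pair)
  have ab: "{a, b} \<in> edges G" "i < m" "j < m" using e unfolding uv blow_up_edge_iff by auto
  have a: "a \<in> verts G" and b: "b \<in> verts G" "a \<noteq> b"
    using ab sg by (auto simp: simple_graph_def)
  have common: "card (neighbours G c \<inter> neighbours G a) \<le> \<Delta> - 1" if c: "c \<in> verts G" "c \<noteq> a" for c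
  proof -
    have "\<not> neighbours G c \<subseteq> neighbours G a"
      using critical_not_dominated[OF G a c(1)] c by auto
    then have "neighbours G c \<inter> neighbours G a \<subset> neighbours G c" by blast
    then have "card (neighbours G c \<inter> neighbours G a) < card (neighbours G c)"
      by (rule psubset_card_mono[OF finN])
    then show ?thesis using \<Delta>[of c] by linarith
  qed
  have common_B: "card (neighbours ?B (c, l) \<inter> neighbours ?B u) \<le> card (neighbours G c \<inter> neighbours G a) * m" for c l
  proof -
    have "neighbours ?B (c, l) \<inter> neighbours ?B u \<subseteq> (neighbours G c \<inter> neighbours G a) \<times> {..<m}"
      by (auto simp: uv neighbours_blow_up split: if_splits)
    then have "card (neighbours ?B (c, l) \<inter> neighbours ?B u) \<le> card ((neighbours G c \<inter> neighbours G a) \<times> {..<m})"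
      by (intro card_mono) (use finN in auto)
    also have "card ((neighbours G c \<inter> neighbours G a) \<times> {..<m}) = card (neighbours G c \<inter> neighbours G a) * m"
      by (simp add: card_cartesian_product)
    finally show ?thesis .
  qed
  consider "k = 3" | "k = 4" | "k \<ge> 5" using k by linarith
  then have "card (closing_walks ?B u v (k - 2)) \<le> cycle_count \<Delta> m k"
  proof cases
    case 1
    have "card (closing_walks ?B u v 1) = card (neighbours ?B v \<inter> neighbours ?B u)"
      unfolding closing_walks_1 by (rule card_image) (simp add: inj_on_def)
    also have "\<dots> \<le> card (neighbours G b \<inter> neighbours G a) * m" unfolding uv(2) by (rule common_B)
    also have "\<dots> \<le> (\<Delta> - 1) * m" using common[of b] b by (intro mult_right_mono) auto
    finally show ?thesis using 1 by (simp add: cycle_count_def)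
  next
    case 2
    have "card (closing_walks ?B u v 2) \<le> (\<Sum>w\<in>neighbours ?B v. card ((\<lambda>z. [w, z]) ` (neighbours ?B w \<inter> neighbours ?B u)))"
      unfolding closing_walks_2 by (rule card_UN_le[OF finB])
    also have "\<dots> = (\<Sum>w\<in>neighbours ?B v. card (neighbours ?B w \<inter> neighbours ?B u))"
      by (rule sum.cong[OF refl], rule card_image) (simp add: inj_on_def)
    also have "\<dots> = (\<Sum>c\<in>neighbours G b. \<Sum>l<m. card (neighbours ?B (c, l) \<inter> neighbours ?B u))"
    proof -
      have "neighbours ?B v = neighbours G b \<times> {..<m}" using ab by (simp add: uv(2) neighbours_blow_up)
      then show ?thesis by (simp only: sum.cartesian_product) (rule sum.cong, auto)
    qed
    also have "\<dots> \<le> (\<Sum>c\<in>neighbours G b. \<Sum>l<m. card (neighbours G c \<inter> neighbours G a) * m)"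
      by (intro sum_mono common_B)
    also have "\<dots> = (\<Sum>c\<in>neighbours G b. card (neighbours G c \<inter> neighbours G a)) * m ^ 2"
      by (simp add: sum_distrib_left power2_eq_square algebra_simps)
    \<comment> \<open>The term \<open>c = a\<close> is set apart: it contributes up to \<Delta>,
      each of the other at most \<open>\<Delta> - 1\<close> terms only \<open>\<Delta> - 1\<close>.
      This is the value of \<open>cycle_count\<close> for 4-cycles.\<close>
    also have "(\<Sum>c\<in>neighbours G b. card (neighbours G c \<inter> neighbours G a)) =
      card (neighbours G a) + (\<Sum>c\<in>neighbours G b - {a}. card (neighbours G c \<inter> neighbours G a))"
    proof -
      have "a \<in> neighbours G b" using ab by (simp add: neighbours_def insert_commute)
      then show ?thesis using finN[of b] by (subst sum.remove[of _ a]) auto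
    qed
    also have "\<dots> \<le> \<Delta> + (\<Sum>c\<in>neighbours G b - {a}. \<Delta> - 1)"
      by (intro add_mono \<Delta> sum_mono common) (use neighbours_verts[OF sg] in auto)
    also have "\<dots> \<le> \<Delta> + (\<Delta> - 1) * (\<Delta> - 1)"
    proof -
      have "a \<in> neighbours G b" using ab by (simp add: neighbours_def insert_commute)
      then have "card (neighbours G b - {a}) \<le> \<Delta> - 1" using \<Delta>[of b] finN[of b] by simp
      then show ?thesis by simp
    qed
    finally show ?thesis using 2 by (simp add: cycle_count_def mult_right_mono)
  next
    case 3
    then show ?thesis using le by (simp add: cycle_count_def)
  qed
  then show ?thesis using fin by blast
qed

definition short_cycles :: "'a ugraph \<Rightarrow> nat \<Rightarrow> 'a set set set" where
  "short_cycles G g = {cycle_edges p | p. is_cycle G p \<and> length p \<le> g}"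

lemma card_short_cycles_through:
  assumes G: "critical x G" and \<Delta>: "\<And>v. card (neighbours G v) \<le> \<Delta>"
    and e: "e \<in> edges (blow_up G m)" and k: "3 \<le> k"
  shows "card {C \<in> short_cycles (blow_up G m) g. e \<in> C \<and> card C = k} \<le> cycle_count \<Delta> m k"
proof -
  let ?B = "blow_up G m"
  obtain u v where uv: "e = {u, v}" using e by (metis blow_up_edgeE)
  note cw = card_closing_walks[OF G \<Delta> e[unfolded uv] k]
  have "{C \<in> short_cycles ?B g. e \<in> C \<and> card C = k} \<subseteq>
    (\<lambda>r. insert e (path_edges (v # r @ [u]))) ` closing_walks ?B u v (k - 2)"
  proof clarify
    fix C assume C: "C \<in> short_cycles ?B g" "e \<in> C" "k = card C"
    then obtain p where p: "is_cycle ?B p" "C = cycle_edges p" by (auto simp: short_cycles_def)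
    then have len: "3 \<le> length p" "length p = k" using card_cycle_edges[of p] C by (auto simp: is_cycle_iff)
    obtain r where r: "length r = length p - 2" "cycle_edges p = insert {u, v} (path_edges (v # r @ [u]))"
      using cycle_edges_through[OF len(1)] C(2) p(2) uv by metis
    have "r \<in> closing_walks ?B u v (k - 2)"
      using r p len by (auto simp: closing_walks_def is_cycle_iff)
    then show "C \<in> (\<lambda>r. insert e (path_edges (v # r @ [u]))) ` closing_walks ?B u v (card C - 2)"
      using r(2) p(2) uv C(3) by blast
  qed
  then have "card {C \<in> short_cycles ?B g. e \<in> C \<and> card C = k} \<le>
      card ((\<lambda>r. insert e (path_edges (v # r @ [u]))) ` closing_walks ?B u v (k - 2))"
    by (rule card_mono[rotated]) (use cw in blast)
  also have "\<dots> \<le> card (closing_walks ?B u v (k - 2))" by (rule card_image_le) (use cw in blast)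
  also have "\<dots> \<le> cycle_count \<Delta> m k" using cw by blast
  finally show ?thesis .
qed

lemma short_cycles_card:
  assumes "C \<in> short_cycles G g"
  shows "3 \<le> card C" "card C \<le> g" "C \<subseteq> edges G" "finite C"
proof -
  obtain p where "C = cycle_edges p" "3 \<le> length p" "distinct p" "cycle_edges p \<subseteq> edges G" "length p \<le> g"
    using assms by (auto simp: short_cycles_def is_cycle_iff)
  then show "3 \<le> card C" "card C \<le> g" "C \<subseteq> edges G" "finite C"
    using card_cycle_edges[of p] finite_cycle_edges[of p] by auto
qed

lemma sum_short_cycles_through:
  fixes f :: "nat \<Rightarrow> real"
  assumes G: "critical x G" and \<Delta>: "\<And>v. card (neighbours G v) \<le> \<Delta>"
    and e: "e \<in> edges (blow_up G m)" and f: "\<And>k. 3 \<le> k \<Longrightarrow> k \<le> g \<Longrightarrow> 0 \<le> f k"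
  shows "(\<Sum>C | C \<in> short_cycles (blow_up G m) g \<and> e \<in> C. f (card C)) \<le> (\<Sum>k=3..g. cycle_count \<Delta> m k * f k)"
proof -
  let ?S = "{C. C \<in> short_cycles (blow_up G m) g \<and> e \<in> C}"
  have "finite (edges (blow_up G m))"
    using G by (intro finite_edges_blow_up) (auto simp: critical_def)
  then have fin: "finite ?S"
    using short_cycles_card(3) by (intro finite_subset[of ?S "Pow (edges (blow_up G m))"]) blast+
  have "(\<Sum>C\<in>?S. f (card C)) = (\<Sum>k=3..g. \<Sum>C\<in>{C\<in>?S. card C = k}. f (card C))"
  proof (rule sum.group[symmetric])
    show "card ` ?S \<subseteq> {3..g}" using short_cycles_card(1,2) by fastforce
  qed (use fin in auto)
  also have "\<dots> = (\<Sum>k=3..g. card {C\<in>?S. card C = k} * f k)"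
    by (rule sum.cong) auto
  also have "\<dots> \<le> (\<Sum>k=3..g. cycle_count \<Delta> m k * f k)"
  proof (intro sum_mono mult_right_mono)
    fix k assume "k \<in> {3..g}"
    then show "real (card {C \<in> ?S. card C = k}) \<le> real (cycle_count \<Delta> m k)"
      using card_short_cycles_through[OF G \<Delta> e, of k g] by (simp add: conj_assoc)
  qed (use f in auto)
  finally show ?thesis .
qed

section \<open>Random subgraphs of the blow-up of a critical graph\<close>

abbreviation has_sparse_subgraph :: "'a ugraph \<Rightarrow> nat \<Rightarrow> nat \<Rightarrow> nat \<Rightarrow> bool" where
  "has_sparse_subgraph G m g x \<equiv>
     \<exists>H. is_subgraph H (blow_up G m) \<and> girth H > enat g \<and> (\<nexists>c. proper_colouring H x c)"

definition cross_edges :: "'a \<Rightarrow> nat set \<Rightarrow> 'a \<Rightarrow> nat set \<Rightarrow> ('a \<times> nat) set set" where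
  "cross_edges a A b B = (\<lambda>(i, j). {(a, i), (b, j)}) ` (A \<times> B)"

lemma card_cross_edges:
  assumes "a \<noteq> b"
  shows "card (cross_edges a A b B) = card A * card B"
  unfolding cross_edges_def
  by (subst card_image) (use assms in \<open>auto simp: inj_on_def doubleton_eq_iff card_cartesian_product\<close>)

definition mono_pairs :: "nat \<Rightarrow> (nat \<Rightarrow> nat) \<Rightarrow> 'a set \<Rightarrow> ('a \<times> nat \<Rightarrow> nat) \<Rightarrow> (nat \<times> 'a \<times> nat) set" where
  "mono_pairs m c U d = (SIGMA i:{..<m}. {w \<in> U \<times> {..<m}. c i = d w})"

definition mono_edges :: "'a \<Rightarrow> nat \<Rightarrow> (nat \<Rightarrow> nat) \<Rightarrow> 'a set \<Rightarrow> ('a \<times> nat \<Rightarrow> nat) \<Rightarrow> ('a \<times> nat) set set" where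
  "mono_edges a m c U d = (\<lambda>(i, w). {(a, i), w}) ` mono_pairs m c U d"

lemma card_mono_edges:
  assumes "finite U" "a \<notin> U"
  shows "card (mono_edges a m c U d) = (\<Sum>w\<in>U \<times> {..<m}. card {i \<in> {..<m}. c i = d w})"
proof -
  have "inj_on (\<lambda>(i, w). {(a, i), w}) (mono_pairs m c U d)"
    using assms(2) by (auto simp: inj_on_def mono_pairs_def doubleton_eq_iff)
  then have "card (mono_edges a m c U d) = card (mono_pairs m c U d)"
    unfolding mono_edges_def by (rule card_image)
  also have "\<dots> = (\<Sum>i<m. card {w \<in> U \<times> {..<m}. c i = d w})"
    unfolding mono_pairs_def by (rule card_SigmaI) (use assms in auto)
  also have "\<dots> = (\<Sum>i<m. \<Sum>w\<in>U \<times> {..<m}. if c i = d w then 1 else 0)"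
    using assms by (intro sum.cong) (auto simp: sum.If_cases Int_def)
  also have "\<dots> = (\<Sum>w\<in>U \<times> {..<m}. \<Sum>i<m. if c i = d w then 1 else 0)" by (rule sum.swap)
  also have "\<dots> = (\<Sum>w\<in>U \<times> {..<m}. card {i \<in> {..<m}. c i = d w})"
    by (intro sum.cong) (auto simp: sum.If_cases Int_def)
  finally show ?thesis .
qed

definition weak_colourings :: "nat \<Rightarrow> nat \<Rightarrow> nat \<Rightarrow> (nat \<Rightarrow> nat) set" where
  "weak_colourings x m N = {c \<in> {..<m} \<rightarrow>\<^sub>E {..<x}. \<forall>i<x. card {j \<in> {..<m}. c j = i} < N}"

text \<open>For fixed \<open>c\<close> the number of monochromatic edges is a sum over the outer
  vertices \<open>w\<close>, each contributing the size of the class with its colour. The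
  exponential therefore factorises, and the sum over all \<open>d\<close> is a power.\<close>

lemma sum_exp_mono_edges:
  fixes \<mu> :: real
  assumes U: "finite U" "a \<notin> U"
  shows "(\<Sum>d\<in>(U \<times> {..<m}) \<rightarrow>\<^sub>E {..<x}. exp (- \<mu> * card (mono_edges a m c U d)))
    = (\<Sum>i<x. exp (- \<mu> * card {j \<in> {..<m}. c j = i})) ^ (card U * m)"
proof -
  have "(\<Sum>i<x. exp (- \<mu> * card {j \<in> {..<m}. c j = i})) ^ (card U * m)
    = (\<Prod>w\<in>U \<times> {..<m}. \<Sum>i\<in>{..<x}. exp (- \<mu> * card {j \<in> {..<m}. c j = i}))"
    by (simp add: card_cartesian_product)
  also have "\<dots> = (\<Sum>d\<in>(U \<times> {..<m}) \<rightarrow>\<^sub>E {..<x}. \<Prod>w\<in>U \<times> {..<m}. exp (- \<mu> * card {j \<in> {..<m}. c j = d w}))"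
    by (rule prod_sum_PiE) (use U in auto)
  also have "\<dots> = (\<Sum>d\<in>(U \<times> {..<m}) \<rightarrow>\<^sub>E {..<x}. exp (- \<mu> * card (mono_edges a m c U d)))"
    using U by (intro sum.cong) (auto simp: card_mono_edges sum_distrib_left exp_sum)
  finally show ?thesis by simp
qed

lemma sum_image_le_nonneg:
  fixes f :: "'b \<Rightarrow> real"
  assumes "finite A" "\<And>x. x \<in> A \<Longrightarrow> 0 \<le> f (h x)"
  shows "sum f (h ` A) \<le> (\<Sum>x\<in>A. f (h x))"
  using sum_image_le[of A f h] assms by (auto simp: o_def)

text \<open>
  If every colour class in the part of \<open>a\<close> has fewer than \<open>N\<close> elements, a monochromatic edge is
  found at \<open>a\<close> whatever the colours of \<open>x\<close> neighbouring parts are; otherwise every part has a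
  colour of multiplicity \<open>N\<close>, and two adjacent parts share that colour.
\<close>

lemma sparse_uncolourable_subgraph:
  fixes p \<eta> \<zeta> \<mu> :: real
  assumes G: "critical x G" and \<Delta>: "\<And>v. card (neighbours G v) \<le> \<Delta>"
    and p: "0 \<le> p" "p \<le> 1" and \<zeta>: "0 \<le> \<zeta>" "\<zeta> < 1" and \<eta>: "0 \<le> \<eta>"
    and small: "\<And>k. 3 \<le> k \<Longrightarrow> k \<le> g \<Longrightarrow> \<eta> * p ^ k < 1"
    and touch: "1 \<le> \<eta> * (1 - \<zeta>) ^ (3 * g)"
    and loss: "(\<Sum>k=3..g. cycle_count \<Delta> m k * (\<eta> * p ^ k / (1 - \<eta> * p ^ k))) \<le> p - \<mu>"
    and strong: "(m choose N)\<^sup>2 * exp (- \<mu> * N\<^sup>2) \<le> \<zeta>"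
    and star: "(\<Sum>c\<in>weak_colourings x m N. (\<Sum>i<x. exp (- \<mu> * card {j \<in> {..<m}. c j = i})) ^ (x * m)) \<le> \<zeta>"
  shows "has_sparse_subgraph G m g x"
proof -
  let ?B = "blow_up G m"
  define V where "V = verts G"
  have V: "finite V" and sg: "simple_graph G" and no_col: "\<nexists>c. proper_colouring G x c"
    using G by (auto simp: critical_def V_def)
  define E where "E = edges ?B"
  have E: "finite E" using finite_edges_blow_up[of G] V sg by (simp add: E_def V_def)
  define \<C> where "\<C> = short_cycles ?B g"
  have \<C>E: "C \<subseteq> E" if "C \<in> \<C>" for C using short_cycles_card(3) that unfolding \<C>_def E_def .
  then have \<C>: "finite \<C>" using E by (intro finite_subset[of \<C> "Pow E"]) auto
  have "\<exists>U. U \<subseteq> neighbours G a \<and> card U = x \<and> finite U" if "a \<in> V" for a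
  proof -
    have "finite (neighbours G a)"
      by (rule finite_subset[OF _ V]) (use neighbours_verts[OF sg] in \<open>auto simp: V_def\<close>)
    then show ?thesis
      using critical_degree[OF G, of a] that obtain_subset_with_card_n[of x "neighbours G a"]
      by (metis V_def finite_subset)
  qed
  then obtain U where U: "\<And>a. a \<in> V \<Longrightarrow> U a \<subseteq> neighbours G a \<and> card (U a) = x \<and> finite (U a)"
    by metis
  have aU: "a \<notin> U a" if "a \<in> V" for a using U[OF that] neighbours_verts[OF sg] by blast
  have "\<exists>a b. e = {a, b} \<and> a \<noteq> b \<and> {a, b} \<in> edges G" if "e \<in> edges G" for e
    using that sg unfolding simple_graph_def card_2_iff by metis
  \<comment> \<open>An orientation of every edge, so that the two sides of a hole are
    ordered.\<close>
  then obtain s t where st: "\<And>e. e \<in> edges G \<Longrightarrow> e = {s e, t e} \<and> s e \<noteq> t e" by metis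
  define \<S> where "\<S> = {A. A \<subseteq> {..<m} \<and> card A = N}"
  have \<S>: "finite \<S>" "card \<S> = m choose N" unfolding \<S>_def by (auto simp: n_subsets)
  define D where "D a = weak_colourings x m N \<times> (U a \<times> {..<m} \<rightarrow>\<^sub>E {..<x})" for a
  have weak_fin: "finite (weak_colourings x m N)"
    by (rule finite_subset[of _ "{..<m} \<rightarrow>\<^sub>E {..<x}"]) (auto simp: weak_colourings_def finite_PiE)
  have D: "finite (D a)" if "a \<in> V" for a using U[OF that] weak_fin by (auto simp: D_def intro!: finite_PiE)
  \<comment> \<open>\<open>Inl e\<close> indexes the holes over an edge of \<open>G\<close>,
    \<open>Inr a\<close> the colour conflicts at a vertex.\<close>
  define \<W> where "\<W> j = (case j of Inl e \<Rightarrow> (\<lambda>(A, B). cross_edges (s e) A (t e) B) ` (\<S> \<times> \<S>)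
    | Inr a \<Rightarrow> (\<lambda>(c, d). mono_edges a m c (U a) d) ` D a)" for j
  define J where "J = (Inl ` edges G \<union> Inr ` V :: ('a set + 'a) set)"
  have "edges G \<subseteq> Pow V" using sg by (auto simp: simple_graph_def V_def)
  then have "finite (edges G)" by (rule finite_subset) (use V in simp)
  then have J: "finite J" using V by (simp add: J_def)
  have \<W>fin: "finite (\<W> j)" if "j \<in> J" for j using that \<S> D by (auto simp: J_def \<W>_def)
  have cross: "cross_edges (s e) A (t e) B \<subseteq> E" if "e \<in> edges G" "A \<subseteq> {..<m}" "B \<subseteq> {..<m}" for e A B
  proof -
    have "{s e, t e} \<in> edges G" using st[OF that(1)] that(1) by metis
    then show ?thesis using that(2,3) unfolding E_def cross_edges_def
      by (clarsimp simp: blow_up_edge_iff) blast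
  qed
  have mono: "mono_edges a m c (U a) d \<subseteq> E" if "a \<in> V" for a c d
    using U[OF that] by (auto simp: mono_edges_def mono_pairs_def E_def blow_up_edge_iff neighbours_def)
  have \<W>E: "W \<subseteq> E" if jW: "j \<in> J" "W \<in> \<W> j" for j W
  proof (cases j)
    case (Inl e)
    then obtain A B where "A \<in> \<S>" "B \<in> \<S>" "W = cross_edges (s e) A (t e) B"
      using jW(2) by (auto simp: \<W>_def)
    then show ?thesis using cross[of e A B] jW(1) Inl by (auto simp: J_def \<S>_def)
  next
    case (Inr a)
    then obtain c d where "W = mono_edges a m c (U a) d"
      using jW(2) by (auto simp: \<W>_def)
    then show ?thesis using mono[of a c d] jW(1) Inr by (auto simp: J_def)
  qed
  have touched: "card {j \<in> J. \<exists>W\<in>\<W> j. C \<inter> W \<noteq> {}} \<le> 3 * g" if C: "C \<in> \<C>" for C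
  proof -
    \<comment> \<open>An edge of the blow-up lies only in members of the group of the edge below it
      and of the groups of its two ends. With at most \<open>g\<close> edges a short cycle touches
      at most \<open>3 * g\<close> groups.\<close>
    let ?T = "\<lambda>e::('a \<times> nat) set. insert (Inl (fst ` e)) (Inr ` fst ` e) :: ('a set + 'a) set"
    have T: "j \<in> ?T e" if "j \<in> J" "W \<in> \<W> j" "e \<in> W" for j W e
    proof (cases j)
      case (Inl e')
      then have "e' \<in> edges G" using that by (auto simp: J_def)
      moreover have "fst ` e = {s e', t e'}" using that Inl by (auto simp: \<W>_def cross_edges_def)
      ultimately have "fst ` e = e'" using st[of e'] by metis
      then show ?thesis using Inl by simp
    next
      case (Inr a)
      then have "a \<in> fst ` e" using that by (auto simp: \<W>_def mono_edges_def)
      then show ?thesis using Inr by auto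
    qed
    have T3: "finite (?T e) \<and> card (?T e) \<le> 3" if "e \<in> C" for e
    proof -
      have "e \<in> edges ?B" using \<C>E[OF C] that unfolding E_def by blast
      then obtain u v where e: "e = {u, v}" by (rule blow_up_edgeE)
      have "?T e = {Inl (fst ` e), Inr (fst u), Inr (fst v)}" by (simp add: e)
      moreover have "card {Inl (fst ` e), Inr (fst u), Inr (fst v)} \<le> 3"
        using card_length[of "[Inl (fst ` e), Inr (fst u), Inr (fst v)]"] by simp
      ultimately show ?thesis by simp
    qed
    have C': "finite C" "card C \<le> g" using short_cycles_card[of C ?B g] C by (auto simp: \<C>_def)
    have "card (\<Union>e\<in>C. ?T e) \<le> (\<Sum>e\<in>C. card (?T e))" by (rule card_UN_le[OF C'(1)])
    also have "\<dots> \<le> (\<Sum>e\<in>C. 3)" by (intro sum_mono conjunct2[OF T3])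
    also have "\<dots> \<le> 3 * g" using C'(2) by simp
    finally have "card (\<Union>e\<in>C. ?T e) \<le> 3 * g" .
    moreover have "{j \<in> J. \<exists>W\<in>\<W> j. C \<inter> W \<noteq> {}} \<subseteq> (\<Union>e\<in>C. ?T e)"
    proof
      fix j assume "j \<in> {j \<in> J. \<exists>W\<in>\<W> j. C \<inter> W \<noteq> {}}"
      then obtain W e where "j \<in> J" "W \<in> \<W> j" "e \<in> W" "e \<in> C" by blast
      then show "j \<in> (\<Union>e\<in>C. ?T e)" by (intro UN_I[of e] T)
    qed
    moreover have "finite (\<Union>e\<in>C. ?T e)" by (rule finite_UN_I[OF C'(1) conjunct1[OF T3]])
    ultimately show ?thesis by (meson card_mono le_trans)
  qed
  have "\<exists>F\<subseteq>E. (\<forall>C\<in>\<C>. \<not> C \<subseteq> F) \<and> (\<forall>j\<in>J. \<forall>W\<in>\<W> j. F \<inter> W \<noteq> {})"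
  proof (rule lopsided_local_lemma[OF E \<C> \<C>E J \<W>fin \<W>E p \<zeta> \<eta>])
    fix C assume C: "C \<in> \<C>"
    then have k: "3 \<le> card C" "card C \<le> g" using short_cycles_card[of C ?B g] by (auto simp: \<C>_def)
    then show "\<eta> * p ^ card C < 1" by (rule small)
    have "(1 - \<zeta>) ^ (3 * g) \<le> (1 - \<zeta>) ^ card {j \<in> J. \<exists>W\<in>\<W> j. C \<inter> W \<noteq> {}}"
      by (rule power_decreasing[OF touched[OF C]]) (use \<zeta> in auto)
    then show "1 \<le> \<eta> * (1 - \<zeta>) ^ card {j \<in> J. \<exists>W\<in>\<W> j. C \<inter> W \<noteq> {}}"
      using touch \<eta> by (meson mult_left_mono order_trans)
  next
    fix e assume "e \<in> E"
    then show "(\<Sum>C | C \<in> \<C> \<and> e \<in> C. \<eta> * p ^ card C / (1 - \<eta> * p ^ card C)) \<le> p - \<mu>"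
      unfolding \<C>_def E_def
      using sum_short_cycles_through[OF G \<Delta>, of e m g "\<lambda>k. \<eta> * p ^ k / (1 - \<eta> * p ^ k)"] loss small \<eta> p
      by (fastforce intro: divide_nonneg_pos)
  next
    fix j assume j: "j \<in> J"
    show "(\<Sum>W\<in>\<W> j. exp (- \<mu> * card W)) \<le> \<zeta>"
    proof (cases j)
      case (Inl e)
      then have e: "s e \<noteq> t e" using j st by (auto simp: J_def)
      have "(\<Sum>W\<in>\<W> j. exp (- \<mu> * card W)) \<le> (\<Sum>(A, B)\<in>\<S> \<times> \<S>. exp (- \<mu> * card (cross_edges (s e) A (t e) B)))"
        unfolding \<W>_def Inl sum.case
        by (rule order_trans[OF sum_image_le_nonneg]) (use \<S> in \<open>auto simp: case_prod_beta\<close>)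
      also have "\<dots> = (\<Sum>(A, B)\<in>\<S> \<times> \<S>. exp (- \<mu> * N\<^sup>2))"
        by (intro sum.cong) (auto simp: card_cross_edges[OF e] \<S>_def power2_eq_square)
      also have "\<dots> = (m choose N)\<^sup>2 * exp (- \<mu> * N\<^sup>2)"
        by (simp add: case_prod_beta \<S> card_cartesian_product power2_eq_square)
      finally show ?thesis using strong by simp
    next
      case (Inr a)
      then have a: "a \<in> V" using j by (auto simp: J_def)
      have "(\<Sum>W\<in>\<W> j. exp (- \<mu> * card W)) \<le> (\<Sum>(c, d)\<in>D a. exp (- \<mu> * card (mono_edges a m c (U a) d)))"
        unfolding \<W>_def Inr sum.case
        by (rule order_trans[OF sum_image_le_nonneg]) (use D[OF a] in \<open>auto simp: case_prod_beta\<close>)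
      also have "\<dots> = (\<Sum>c\<in>weak_colourings x m N. \<Sum>d\<in>(U a \<times> {..<m}) \<rightarrow>\<^sub>E {..<x}. exp (- \<mu> * card (mono_edges a m c (U a) d)))"
        unfolding D_def by (rule sum.cartesian_product[symmetric])
      also have "\<dots> = (\<Sum>c\<in>weak_colourings x m N. (\<Sum>i<x. exp (- \<mu> * card {j \<in> {..<m}. c j = i})) ^ (x * m))"
        using U[OF a] sum_exp_mono_edges[of "U a" a \<mu> m _ x] aU[OF a] by (intro sum.cong) auto
      finally show ?thesis using star by simp
    qed
  qed
  then obtain F where FE: "F \<subseteq> E" and F\<C>: "\<forall>C\<in>\<C>. \<not> C \<subseteq> F" and F\<W>: "\<forall>j\<in>J. \<forall>W\<in>\<W> j. F \<inter> W \<noteq> {}"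
    by (elim exE conjE)
  note F = FE F\<C>[rule_format] F\<W>[rule_format]
  define H where "H = (verts ?B, F)"
  have "is_subgraph H ?B"
    using F(1) simple_graph_blow_up[OF sg] by (auto simp: is_subgraph_def H_def simple_graph_def E_def)
  moreover have "girth H > enat g"
    unfolding girth_gt_iff
  proof (intro allI impI)
    fix p assume p: "is_cycle H p"
    then have "cycle_edges p \<subseteq> F" "is_cycle ?B p" using F(1) by (auto simp: is_cycle_iff H_def E_def)
    then show "g < length p" using F(2)[of "cycle_edges p"] by (auto simp: \<C>_def short_cycles_def not_le[symmetric])
  qed
  moreover have "\<nexists>c. proper_colouring H x c"
  proof
    assume "\<exists>c. proper_colouring H x c"
    then obtain c where c: "proper_colouring H x c" by blast
    have c_lt: "c (a, i) < x" if "a \<in> V" "i < m" for a i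
      using c that by (auto simp: proper_colouring_def H_def blow_up_def V_def)
    have c_ne: "c u \<noteq> c v" if "{u, v} \<in> F" for u v
      using c that unfolding proper_colouring_def H_def snd_conv by blast
    define cls where "cls a i = {j \<in> {..<m}. c (a, j) = i}" for a i
    have "\<exists>i<x. N \<le> card (cls a i)" if a: "a \<in> V" for a
    proof (rule ccontr)
      assume weak: "\<not> (\<exists>i<x. N \<le> card (cls a i))"
      \<comment> \<open>The colouring is restricted because the groups range over extensional
        functions.\<close>
      define ca where "ca = restrict (\<lambda>i. c (a, i)) {..<m}"
      define d where "d = restrict c (U a \<times> {..<m})"
      have "{j \<in> {..<m}. ca j = i} = cls a i" for i by (auto simp: ca_def cls_def)
      then have "ca \<in> weak_colourings x m N"
        using weak c_lt[OF a] by (auto simp: weak_colourings_def ca_def not_le)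
      moreover have "U a \<subseteq> V" using U[OF a] neighbours_verts[OF sg] by (auto simp: V_def)
      then have "d \<in> U a \<times> {..<m} \<rightarrow>\<^sub>E {..<x}" using c_lt by (auto simp: d_def)
      ultimately have "mono_edges a m ca (U a) d \<in> \<W> (Inr a)" by (auto simp: \<W>_def D_def)
      then have "F \<inter> mono_edges a m ca (U a) d \<noteq> {}" using F(3)[of "Inr a"] a by (auto simp: J_def)
      then obtain i b j where "{(a, i), (b, j)} \<in> F" "c (a, i) = c (b, j)"
        by (auto simp: mono_edges_def mono_pairs_def ca_def d_def)
      then show False using c_ne by blast
    qed
    then obtain f where f: "\<And>a. a \<in> V \<Longrightarrow> f a < x \<and> N \<le> card (cls a (f a))" by metis
    have "\<not> proper_colouring G x f" using no_col by blast
    then obtain a b where ab: "{a, b} \<in> edges G" "f a = f b"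
      using f by (auto simp: proper_colouring_def V_def)
    define e where "e = {a, b}"
    have e: "e \<in> edges G" "e = {s e, t e}" using ab st[of e] by (simp_all only: e_def)
    have "e \<subseteq> V" using e(1) sg by (auto simp: simple_graph_def V_def)
    then have se: "s e \<in> V" "t e \<in> V" using e(2) by blast+
    have fe: "f (s e) = f (t e)" using e(2) ab(2) by (metis e_def doubleton_eq_iff)
    obtain A where A: "A \<subseteq> cls (s e) (f (s e))" "card A = N"
      using f[OF se(1)] by (meson obtain_subset_with_card_n)
    obtain B where B: "B \<subseteq> cls (t e) (f (t e))" "card B = N"
      using f[OF se(2)] by (meson obtain_subset_with_card_n)
    have "A \<in> \<S>" "B \<in> \<S>" using A B by (auto simp: \<S>_def cls_def)
    then have "cross_edges (s e) A (t e) B \<in> \<W> (Inl e)" by (auto simp: \<W>_def)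
    then have "F \<inter> cross_edges (s e) A (t e) B \<noteq> {}" using F(3)[of "Inl e"] e by (auto simp: J_def)
    then obtain i j where "i \<in> A" "j \<in> B" "{(s e, i), (t e, j)} \<in> F"
      by (auto simp: cross_edges_def)
    moreover have "c (s e, i) = f (s e)" "c (t e, j) = f (t e)"
      using A(1) B(1) \<open>i \<in> A\<close> \<open>j \<in> B\<close> unfolding cls_def by blast+
    ultimately show False using c_ne fe by metis
  qed
  ultimately show ?thesis by blast
qed

section \<open>Choice of the parameters\<close>

lemma exp_ge_taylor:
  fixes y :: real
  assumes "0 \<le> y"
  shows "(\<Sum>k<n. y ^ k / fact k) \<le> exp y"
proof -
  have "(\<Sum>k<n. y ^ k /\<^sub>R fact k) \<le> (\<Sum>k. y ^ k /\<^sub>R fact k)"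
    by (rule sum_le_suminf[OF summable_exp_generic]) (use assms in auto)
  then show ?thesis by (simp add: exp_def divide_inverse mult.commute)
qed

text \<open>Turns a numerical bound on a logarithm into an inequality between rationals, which
  simplification decides.\<close>

lemma ln_le_of_taylor:
  fixes y :: real
  assumes "0 \<le> y" "0 < z" "z \<le> (\<Sum>k<n. y ^ k / fact k)"
  shows "ln z \<le> y"
proof -
  have "z \<le> exp y" using exp_ge_taylor[OF assms(1), of n] assms(3) by linarith
  then show ?thesis using assms(2) by (metis exp_gt_zero ln_exp ln_le_cancel_iff)
qed

lemma exp_minus_le_of_taylor:
  fixes y :: real
  assumes "0 \<le> y" "0 < z" "1 / z \<le> (\<Sum>k<n. y ^ k / fact k)"
  shows "exp (- y) \<le> z"
proof -
  have "1 / z \<le> exp y" using exp_ge_taylor[OF assms(1), of n] assms(3) by linarith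
  then show ?thesis using assms(2) by (simp add: exp_minus field_simps)
qed

lemma choose_mult_le_1:
  fixes s :: real
  assumes "0 \<le> s" "s \<le> 1" "N \<le> m"
  shows "(m choose N) * s ^ N * (1 - s) ^ (m - N) \<le> 1"
proof -
  have "(m choose N) * s ^ N * (1 - s) ^ (m - N) \<le> (\<Sum>k\<le>m. (m choose k) * s ^ k * (1 - s) ^ (m - k))"
    by (rule member_le_sum[of N "{..m}" "\<lambda>k. (m choose k) * s ^ k * (1 - s) ^ (m - k)"]) (use assms in auto)
  also have "\<dots> = (s + (1 - s)) ^ m" by (rule binomial_ring[symmetric])
  finally show ?thesis by simp
qed

text \<open>One term of the binomial expansion of \<open>(s + (1 - s)) ^ m\<close> is at most 1;
  with \<open>N\<close> close to \<open>s * m\<close> this is the entropy bound.\<close>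

lemma choose_le_entropy:
  fixes s h :: real
  assumes s: "0 < s" "s \<le> 1/2" and N: "N \<le> m" "real N \<le> s * m + 1"
    and h: "s * ln (1 / s) + (1 - s) * ln (1 / (1 - s)) \<le> h"
  shows "real (m choose N) \<le> (1 - s) / s * exp (h * m)"
proof -
  have pos: "0 < s ^ N" "0 < (1 - s) ^ (m - N)" using s by auto
  have "real (m choose N) \<le> 1 / (s ^ N * (1 - s) ^ (m - N))"
    using choose_mult_le_1[of s N m] s N pos by (simp add: field_simps)
  also have "\<dots> = exp (- (N * ln s + (m - N) * ln (1 - s)))"
  proof -
    have "s ^ N = exp (N * ln s)" "(1 - s) ^ (m - N) = exp ((m - N) * ln (1 - s))"
      using s by (simp_all add: exp_of_nat_mult)
    then show ?thesis by (simp only: exp_add[symmetric] exp_minus divide_inverse mult_1)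
  qed
  also have "\<dots> \<le> exp (h * m + ln ((1 - s) / s))"
  proof -
    have l: "ln (1 / s) = - ln s" "ln (1 / (1 - s)) = - ln (1 - s)" "ln ((1 - s) / s) = ln (1 - s) - ln s"
      using s by (simp_all add: ln_div)
    \<comment> \<open>As \<open>s \<le> 1/2\<close>, each unit of \<open>N\<close> above
      \<open>s * m\<close> costs a factor \<open>(1 - s) / s\<close>. Rounding up costs at most one
      unit, hence the factor in front.\<close>
    have "ln s \<le> ln (1 - s)" using s by simp
    then have "real N * (ln (1 - s) - ln s) \<le> (s * m + 1) * (ln (1 - s) - ln s)"
      using N by (intro mult_right_mono) auto
    moreover have "(s * ln (1 / s) + (1 - s) * ln (1 / (1 - s))) * m \<le> h * m"
      using h by (intro mult_right_mono) auto
    moreover have "real (m - N) = real m - real N" using N by (simp add: of_nat_diff)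
    ultimately show ?thesis by (simp add: l algebra_simps)
  qed
  also have "\<dots> = (1 - s) / s * exp (h * m)" using s by (simp add: exp_add)
  finally show ?thesis .
qed

text \<open>
  On a weak colouring all class densities are at most \<open>\<sigma>\<close>, hence at least
  \<open>1 - (x - 1) * \<sigma>\<close>, and on this interval \<open>exp\<close> lies below its chord.
\<close>

lemma exp_chord:
  fixes D :: real
  assumes "a \<le> s" "s \<le> b" "a < b"
  shows "exp (- D * s) \<le> ((b - s) * exp (- D * a) + (s - a) * exp (- D * b)) / (b - a)"
proof -
  define t where "t = (s - a) / (b - a)"
  have t: "0 \<le> t" "t \<le> 1" using assms by (auto simp: t_def divide_le_eq_1)
  have "t * (b - a) = s - a" using assms by (simp add: t_def)
  then have s: "s = (1 - t) * a + t * b" by (simp add: algebra_simps)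
  have "exp (- D * s) = exp ((1 - t) * (- D * a) + t * (- D * b))" unfolding s by (simp add: algebra_simps)
  also have "\<dots> \<le> (1 - t) * exp (- D * a) + t * exp (- D * b)"
    using convex_onD[OF exp_convex, of t "- D * a" "- D * b"] t by simp
  also have "1 - t = (b - s) / (b - a)" using assms by (simp add: t_def field_simps)
  also have "(b - s) / (b - a) * exp (- D * a) + t * exp (- D * b)
      = ((b - s) * exp (- D * a) + (s - a) * exp (- D * b)) / (b - a)"
    by (simp add: t_def add_divide_distrib)
  finally show ?thesis .
qed

lemma weak_sum_le:
  fixes E \<sigma> \<delta> :: real
  assumes x: "2 \<le> x" and m: "0 < m" and \<delta>: "\<delta> = 1 - (real x - 1) * \<sigma>" "\<delta> < \<sigma>"
    and N: "real N < \<sigma> * m + 1"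
  shows "(\<Sum>c\<in>weak_colourings x m N. (\<Sum>i<x. exp (- (E / m) * card {j \<in> {..<m}. c j = i})) ^ (x * m))
    \<le> (x * ((real x - 1) * exp (- E * \<sigma>) + exp (- E * \<delta>)) ^ x) ^ m"
proof -
  let ?R = "(real x - 1) * exp (- E * \<sigma>) + exp (- E * \<delta>)"
  have R: "(\<Sum>i<x. exp (- (E / m) * card {j \<in> {..<m}. c j = i})) \<le> ?R" if c: "c \<in> weak_colourings x m N" for c
  proof -
    define s where "s i = card {j \<in> {..<m}. c j = i} / real m" for i
    have le: "s i \<le> \<sigma>" if "i < x" for i
    proof -
      have "card {j \<in> {..<m}. c j = i} < N" using c that by (auto simp: weak_colourings_def)
      then have "real (card {j \<in> {..<m}. c j = i}) + 1 \<le> N" by linarith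
      then have "real (card {j \<in> {..<m}. c j = i}) \<le> \<sigma> * m" using N by linarith
      then show ?thesis using m by (simp add: s_def divide_le_eq)
    qed
    have cm: "c ` {..<m} \<subseteq> {..<x}" using c by (auto simp: weak_colourings_def PiE_iff)
    have "card {..<m} = (\<Sum>i<x. card {j \<in> {..<m}. c j = i})"
      using sum.group[of "{..<m}" "{..<x}" c "\<lambda>_. 1::nat"] cm by simp
    then have "real m = (\<Sum>i<x. real (card {j \<in> {..<m}. c j = i}))" by (simp flip: of_nat_sum)
    then have sum1: "(\<Sum>i<x. s i) = 1" using m by (simp add: s_def flip: sum_divide_distrib)
    \<comment> \<open>The other \<open>x - 1\<close> densities are at most \<sigma> and all of them
      sum to 1.\<close>
    have ge: "\<delta> \<le> s i" if "i < x" for i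
    proof -
      have "1 = s i + (\<Sum>j\<in>{..<x} - {i}. s j)" using sum1 that by (subst sum.remove[symmetric]) auto
      also have "\<dots> \<le> s i + (\<Sum>j\<in>{..<x} - {i}. \<sigma>)" by (intro add_mono sum_mono) (use le in auto)
      also have "\<dots> = s i + (real x - 1) * \<sigma>" using that x by (simp add: of_nat_diff)
      finally show ?thesis using \<delta> by simp
    qed
    have "(\<Sum>i<x. exp (- (E / m) * card {j \<in> {..<m}. c j = i})) = (\<Sum>i<x. exp (- E * s i))"
      by (simp add: s_def)
    also have "\<dots> \<le> (\<Sum>i<x. ((\<sigma> - s i) * exp (- E * \<delta>) + (s i - \<delta>) * exp (- E * \<sigma>)) / (\<sigma> - \<delta>))"
      by (intro sum_mono exp_chord) (use ge le \<delta> in auto)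
    \<comment> \<open>The chords are affine, so only the sum of the densities matters. The result is
      the value at the extreme point with \<open>x - 1\<close> densities equal to \<sigma> and one
      equal to \<delta>.\<close>
    also have "\<dots> = ((x * \<sigma> - (\<Sum>i<x. s i)) * exp (- E * \<delta>) + ((\<Sum>i<x. s i) - x * \<delta>) * exp (- E * \<sigma>)) / (\<sigma> - \<delta>)"
      by (simp add: sum.distrib sum_subtractf flip: sum_divide_distrib sum_distrib_right)
    also have "\<dots> = ?R"
    proof -
      have 1: "x * \<sigma> - (\<Sum>i<x. s i) = \<sigma> - \<delta>" "(\<Sum>i<x. s i) - x * \<delta> = (real x - 1) * (\<sigma> - \<delta>)"
        unfolding sum1 \<delta>(1) by (simp_all add: algebra_simps)
      show ?thesis unfolding 1 using \<delta>(2) by (simp add: field_simps)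
    qed
    finally show ?thesis .
  qed
  have R0: "0 \<le> ?R" using x by simp
  have "(\<Sum>c\<in>weak_colourings x m N. (\<Sum>i<x. exp (- (E / m) * card {j \<in> {..<m}. c j = i})) ^ (x * m))
    \<le> (\<Sum>c\<in>weak_colourings x m N. ?R ^ (x * m))"
    by (intro sum_mono power_mono R sum_nonneg) auto
  also have "\<dots> = card (weak_colourings x m N) * ?R ^ (x * m)" by simp
  also have "\<dots> \<le> real (x ^ m) * ?R ^ (x * m)"
  proof (rule mult_right_mono)
    have "card (weak_colourings x m N) \<le> card ({..<m} \<rightarrow>\<^sub>E {..<x})"
      by (rule card_mono) (auto simp: weak_colourings_def finite_PiE)
    also have "\<dots> = x ^ m" by (simp add: card_PiE)
    finally show "real (card (weak_colourings x m N)) \<le> real (x ^ m)" by simp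
  qed (use R0 in simp)
  also have "real (x ^ m) * r ^ (x * m) = (x * r ^ x) ^ m" for r :: real
    by (simp add: power_mult power_mult_distrib)
  finally show ?thesis .
qed

text \<open>
  Edges are kept with probability \<open>D / m\<close>.  The short cycles through an edge cost \<open>L / m\<close>, and
  \<open>E / m\<close> is what remains in the exponent per avoided edge.
\<close>

lemma sparse_uncolourable_subgraph_density:
  fixes D E L :: real
  assumes G: "critical x G" and \<Delta>: "\<And>v. card (neighbours G v) \<le> \<Delta>" and g: "3 \<le> g" and m: "0 < m"
    and D: "0 < D" "D / m \<le> 9 / 100"
    and L: "(\<Sum>k=3..g. cycle_count \<Delta> m k * (D / m) ^ k) \<le> L / m" and E: "E \<le> D - 503/500 * L"
    and strong: "(m choose N)\<^sup>2 * exp (- (E / m) * N\<^sup>2) \<le> 1 / (700 * g)"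
    and star: "(\<Sum>c\<in>weak_colourings x m N. (\<Sum>i<x. exp (- (E / m) * card {j \<in> {..<m}. c j = i})) ^ (x * m)) \<le> 1 / (700 * g)"
  shows "has_sparse_subgraph G m g x"
proof (rule sparse_uncolourable_subgraph[OF G \<Delta>])
  \<comment> \<open>With \<zeta> = 1 / (700 g) the \<open>3 * g\<close> touched groups cost at most
    a factor 1 - 3/700, which \<eta> = 201/200 outweighs.\<close>
  let ?p = "D / m" and ?\<eta> = "201/200 :: real"
  show p: "0 \<le> ?p" "?p \<le> 1" using D(1) order_trans[OF D(2), of 1] by simp_all
  show "0 \<le> 1 / (700 * real g)" "1 / (700 * real g) < 1" using g by auto
  show "(0::real) \<le> ?\<eta>" by simp
  have pk: "?p ^ k \<le> 9 / 10000" if "3 \<le> k" for k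
  proof -
    have "?p ^ k \<le> ?p ^ 3" using that p by (intro power_decreasing) auto
    also have "\<dots> \<le> (9 / 100) ^ 3" using D p by (intro power_mono) auto
    also have "\<dots> \<le> (9 / 10000 :: real)" by (simp add: power3_eq_cube)
    finally show ?thesis .
  qed
  show "?\<eta> * ?p ^ k < 1" if "3 \<le> k" "k \<le> g" for k using pk[OF that(1)] by linarith
  have "1 + real (3 * g) * (- (1 / (700 * g))) \<le> (1 + - (1 / (700 * g))) ^ (3 * g)"
    by (rule Bernoulli_inequality) (use g in auto)
  moreover have "real (3 * g) * (- (1 / (700 * g))) = - 3 / 700" using g by simp
  ultimately have "1 - 3 / 700 \<le> (1 - 1 / (700 * real g)) ^ (3 * g)" by simp
  then show "1 \<le> ?\<eta> * (1 - 1 / (700 * real g)) ^ (3 * g)" by simp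
  \<comment> \<open>The constant 503/500 covers \<eta> together with the denominator, since
    \<open>?p ^ k\<close> is below 1/1000 for all cycle lengths.\<close>
  have "?\<eta> * ?p ^ k / (1 - ?\<eta> * ?p ^ k) \<le> 503/500 * ?p ^ k" if "3 \<le> k" for k
  proof -
    have "?\<eta> \<le> 503/500 * (1 - ?\<eta> * ?p ^ k)" using pk[OF that] by simp
    then have "?\<eta> * ?p ^ k \<le> 503/500 * (1 - ?\<eta> * ?p ^ k) * ?p ^ k" using p by (intro mult_right_mono) auto
    then show ?thesis using pk[OF that] by (simp add: divide_le_eq algebra_simps)
  qed
  then have "(\<Sum>k=3..g. cycle_count \<Delta> m k * (?\<eta> * ?p ^ k / (1 - ?\<eta> * ?p ^ k)))
      \<le> (\<Sum>k=3..g. cycle_count \<Delta> m k * (503/500 * ?p ^ k))"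
    by (intro sum_mono mult_left_mono) auto
  also have "\<dots> = 503/500 * (\<Sum>k=3..g. cycle_count \<Delta> m k * ?p ^ k)"
    by (simp add: sum_distrib_left algebra_simps)
  also have "\<dots> \<le> 503/500 * (L / m)" using L by (intro mult_left_mono) auto
  also have "\<dots> \<le> D / m - E / m" using E m by (simp add: field_simps)
  finally show "(\<Sum>k=3..g. cycle_count \<Delta> m k * (?\<eta> * ?p ^ k / (1 - ?\<eta> * ?p ^ k))) \<le> ?p - E / m" .
qed (use strong star in auto)

section \<open>The cost of the short cycles\<close>

lemma geometric_sum_le:
  fixes q \<kappa> :: real
  assumes "1 \<le> \<kappa>" "0 \<le> q" "q \<le> \<kappa> * (q - 1)" "3 \<le> g"
  shows "(\<Sum>k=3..g. q ^ (k - 2)) \<le> \<kappa> * q ^ (g - 2)"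
  using assms(4)
proof (induction g rule: nat_induct_at_least)
  case base
  then show ?case using assms mult_right_mono[of 1 \<kappa> q] by simp
next
  case (Suc g)
  have "{3..Suc g} = insert (Suc g) {3..g}" using Suc.hyps by auto
  then have "(\<Sum>k=3..Suc g. q ^ (k - 2)) \<le> q ^ (Suc g - 2) + \<kappa> * q ^ (g - 2)" using Suc.IH by simp
  also have e: "Suc g - 2 = Suc (g - 2)" using Suc.hyps by simp
  also have "q ^ Suc (g - 2) + \<kappa> * q ^ (g - 2) = (q + \<kappa>) * q ^ (g - 2)" by (simp add: algebra_simps)
  \<comment> \<open>\<kappa> is an upper bound for \<open>q / (q - 1)\<close>, the ratio of an
    infinite geometric sum to its leading term; exactly then
    \<open>q + \<kappa> \<le> \<kappa> * q\<close>.\<close>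
  also have "\<dots> \<le> (\<kappa> * q) * q ^ (g - 2)" using assms by (intro mult_right_mono) (auto simp: algebra_simps)
  also have "\<dots> = \<kappa> * q ^ (Suc g - 2)" unfolding e by simp
  finally show ?case .
qed

lemma cycle_count_le:
  assumes "1 \<le> \<Delta>" "3 \<le> k"
  shows "cycle_count \<Delta> m k \<le> (\<Delta> * m) ^ (k - 2)"
proof -
  have "\<Delta> + (\<Delta> - 1) * (\<Delta> - 1) \<le> \<Delta> ^ 2"
    using assms(1) by (cases \<Delta>) (auto simp: power2_eq_square)
  then have "(\<Delta> + (\<Delta> - 1) * (\<Delta> - 1)) * m ^ 2 \<le> \<Delta> ^ 2 * m ^ 2" by (rule mult_right_mono) simp
  then show ?thesis by (auto simp: cycle_count_def power_mult_distrib)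
qed

text \<open>Cycles of length k contribute (D/m)^2 * (\<Delta> D)^(k-2), a geometric sequence
  dominated by k = g. One of the two factors \<open>m\<close> in the denominator stays; the other is
  replaced by its lower bound, which turns \<Delta> D into D / (x^2 \<Delta>) and leaves the factor
  1 / x.\<close>

lemma crude_loss:
  fixes D \<kappa> :: real
  assumes \<Delta>: "1 \<le> \<Delta>" and g: "3 \<le> g" and m: "real m > real x * (real x * real \<Delta>) ^ (2 * g - 4)" and x: "0 < x"
    and D: "0 < D" and \<kappa>: "1 \<le> \<kappa>" "\<Delta> * D \<le> \<kappa> * (\<Delta> * D - 1)"
  shows "(\<Sum>k=3..g. cycle_count \<Delta> m k * (D / m) ^ k) \<le> (\<kappa> * (D\<^sup>2 / x) * (D / (real x ^ 2 * \<Delta>)) ^ (g - 2)) / m"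
proof -
  have m0: "0 < real m" using m x \<Delta> by (smt (verit) of_nat_0_le_iff zero_le_power mult_nonneg_nonneg)
  have "(\<Sum>k=3..g. cycle_count \<Delta> m k * (D / m) ^ k) \<le> (\<Sum>k=3..g. D\<^sup>2 / (real m)\<^sup>2 * (\<Delta> * D) ^ (k - 2))"
  proof (rule sum_mono)
    fix k assume k: "k \<in> {3..g}"
    have "real (cycle_count \<Delta> m k) \<le> real ((\<Delta> * m) ^ (k - 2))"
      using cycle_count_le[OF \<Delta>, of k m] k by (simp only: of_nat_le_iff atLeastAtMost_iff)
    then have "real (cycle_count \<Delta> m k) \<le> (real \<Delta> * m) ^ (k - 2)" by (simp only: of_nat_power of_nat_mult)
    then have "cycle_count \<Delta> m k * (D / m) ^ k \<le> (real \<Delta> * m) ^ (k - 2) * (D / m) ^ k"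
      using D m0 by (intro mult_right_mono) auto
    also have "\<dots> = D\<^sup>2 / (real m)\<^sup>2 * (real \<Delta> * m * (D / m)) ^ (k - 2)"
    proof -
      have "k = 2 + (k - 2)" using k by auto
      then have "(D / m) ^ k = (D / m) ^ 2 * (D / m) ^ (k - 2)" by (metis power_add)
      then show ?thesis by (simp add: power_mult_distrib power_divide)
    qed
    also have "real \<Delta> * m * (D / m) = \<Delta> * D" using m0 by simp
    finally show "cycle_count \<Delta> m k * (D / m) ^ k \<le> D\<^sup>2 / (real m)\<^sup>2 * (\<Delta> * D) ^ (k - 2)" .
  qed
  also have "\<dots> \<le> D\<^sup>2 / (real m)\<^sup>2 * (\<kappa> * (\<Delta> * D) ^ (g - 2))"
    unfolding sum_distrib_left[symmetric]
    by (intro mult_left_mono geometric_sum_le) (use \<kappa> D g in auto)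
  also have "\<dots> = (\<kappa> * D\<^sup>2 * (\<Delta> * D) ^ (g - 2)) / m / m" by (simp add: power2_eq_square)
  also have "\<dots> \<le> (\<kappa> * D\<^sup>2 * (\<Delta> * D) ^ (g - 2)) / (real x * (real x * real \<Delta>) ^ (2 * g - 4)) / m"
    using m m0 x \<Delta> \<kappa> D by (intro divide_right_mono divide_left_mono mult_pos_pos) auto
  also have "(real x * real \<Delta>) ^ (2 * g - 4) = ((real x)\<^sup>2 * \<Delta>) ^ (g - 2) * \<Delta> ^ (g - 2)"
  proof -
    have "2 * g - 4 = 2 * (g - 2)" by simp
    then have "(real x * real \<Delta>) ^ (2 * g - 4) = ((real x * real \<Delta>)\<^sup>2) ^ (g - 2)" by (simp only: power_mult)
    also have "(real x * real \<Delta>)\<^sup>2 = (real x)\<^sup>2 * \<Delta> * \<Delta>" by (simp add: power2_eq_square)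
    finally show ?thesis by (simp add: power_mult_distrib)
  qed
  also have "\<kappa> * D\<^sup>2 * (\<Delta> * D) ^ (g - 2) / (real x * (((real x)\<^sup>2 * \<Delta>) ^ (g - 2) * \<Delta> ^ (g - 2)))
     = \<kappa> * (D\<^sup>2 / x) * (D / (real x ^ 2 * \<Delta>)) ^ (g - 2)"
    using \<Delta> x by (simp add: power_mult_distrib power_divide)
  finally show ?thesis by simp
qed

text \<open>Meant for g = 4 with \<Delta> = x equal to 3 or 4, where the crude estimate exceeds the
  cost that the chosen density allows.\<close>

lemma refined_loss:
  fixes D :: real
  assumes "1 \<le> \<Delta>" "0 < m"
  shows "(\<Sum>k=3..4. cycle_count \<Delta> m k * (D / m) ^ k)
    = (((real \<Delta> - 1) * D ^ 3 + (\<Delta> + (real \<Delta> - 1) * (real \<Delta> - 1)) * D ^ 4) / m) / m"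
proof -
  have "(\<Sum>k=3..4. cycle_count \<Delta> m k * (D / m) ^ k) = cycle_count \<Delta> m 3 * (D / m) ^ 3 + cycle_count \<Delta> m 4 * (D / m) ^ 4"
    by (simp add: numeral_eq_Suc)
  also have "\<dots> = (real \<Delta> - 1) * m * (D / m) ^ 3 + (\<Delta> + (real \<Delta> - 1) * (real \<Delta> - 1)) * m ^ 2 * (D / m) ^ 4"
    using assms by (simp add: cycle_count_def of_nat_diff)
  also have "\<dots> = (((real \<Delta> - 1) * D ^ 3 + (\<Delta> + (real \<Delta> - 1) * (real \<Delta> - 1)) * D ^ 4) / m) / m"
    using assms by (simp add: field_simps power_divide) (simp add: power_numeral_reduce algebra_simps add_divide_distrib)?
  finally show ?thesis .
qed

lemma exp_minus_le_inverse:
  fixes B y :: real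
  assumes "0 \<le> y" "1400 * B * g \<le> y\<^sup>2" "0 < g"
  shows "B * exp (- y) \<le> 1 / (700 * real g)"
proof -
  have "(\<Sum>k<3. y ^ k / fact k) \<le> exp y" by (rule exp_ge_taylor[OF assms(1)])
  then have "y\<^sup>2 / 2 \<le> exp y" using assms(1) by (simp add: eval_nat_numeral)
  then have "700 * B * g \<le> exp y" using assms(2) by simp
  then show ?thesis using assms(3) by (simp add: exp_minus field_simps)
qed

lemma nat_ceiling_bounds:
  fixes s :: real and m :: nat
  assumes "0 < s" "s \<le> 1"
  shows "s * real m \<le> real (nat \<lceil>s * real m\<rceil>)" "real (nat \<lceil>s * real m\<rceil>) < s * real m + 1" "nat \<lceil>s * real m\<rceil> \<le> m"
proof -
  have c: "real (nat \<lceil>s * real m\<rceil>) = of_int \<lceil>s * real m\<rceil>" using assms by simp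
  show "s * real m \<le> real (nat \<lceil>s * real m\<rceil>)" unfolding c by simp
  show "real (nat \<lceil>s * real m\<rceil>) < s * real m + 1" unfolding c by linarith
  have "s * real m \<le> real m" using assms mult_right_mono[of s 1 "real m"] by simp
  then have "\<lceil>s * real m\<rceil> \<le> int m" by (simp add: ceiling_le_iff)
  then show "nat \<lceil>s * real m\<rceil> \<le> m" by linarith
qed

text \<open>
  Holes have side \<open>N = \<lceil>\<sigma> * m\<rceil>\<close>; the slack \<open>c\<close> makes both kinds of hole exponentially rare in \<open>m\<close>.
\<close>

lemma sparse_subgraph_entropy:
  fixes D E L \<sigma> \<delta> h c B :: real
  assumes G: "critical x G" and \<Delta>: "\<And>v. card (neighbours G v) \<le> \<Delta>" and g: "3 \<le> g" and m: "0 < m" and x: "2 \<le> x"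
    and D: "0 < D" "D / m \<le> 9 / 100"
    and L: "(\<Sum>k=3..g. cycle_count \<Delta> m k * (D / m) ^ k) \<le> L / m" and E: "0 \<le> E" "E \<le> D - 503/500 * L"
    and \<sigma>: "0 < \<sigma>" "\<sigma> \<le> 1/2" "\<delta> = 1 - (real x - 1) * \<sigma>" "\<delta> < \<sigma>"
    and h: "\<sigma> * ln (1 / \<sigma>) + (1 - \<sigma>) * ln (1 / (1 - \<sigma>)) \<le> h" and c: "0 \<le> c" "2 * h + c \<le> E * \<sigma>\<^sup>2"
    and star: "x * ((real x - 1) * exp (- E * \<sigma>) + exp (- E * \<delta>)) ^ x \<le> 1 - c"
    and B: "((1 - \<sigma>) / \<sigma>)\<^sup>2 \<le> B" "1 \<le> B" "1400 * B * g \<le> (c * m)\<^sup>2"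
  shows "has_sparse_subgraph G m g x"
proof -
  let ?N = "nat \<lceil>\<sigma> * real m\<rceil>"
  have N: "\<sigma> * m \<le> ?N" "?N < \<sigma> * m + 1" "?N \<le> m" using nat_ceiling_bounds[of \<sigma> m] \<sigma> by auto
  have small: "B * exp (- (c * m)) \<le> 1 / (700 * real g)" using exp_minus_le_inverse B g c by simp
  have "(\<sigma> * m)\<^sup>2 \<le> (real ?N)\<^sup>2" using N \<sigma> by (intro power_mono) auto
  then have "E / m * (\<sigma> * m)\<^sup>2 \<le> E / m * (real ?N)\<^sup>2" using E m by (intro mult_left_mono) auto
  then have N2: "E * \<sigma>\<^sup>2 * m \<le> E / m * (real ?N)\<^sup>2" using m by (simp add: power_mult_distrib power2_eq_square)
  \<comment> \<open>There are about exp (2 h m) holes over an edge, and each is missed with weight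
    at most exp (- E \<sigma>^2 m). By the choice of \<open>c\<close> the product is about exp (- c
    m).\<close>
  have "(2 * h + c) * m \<le> E * \<sigma>\<^sup>2 * m" using c by (intro mult_right_mono) auto
  then have ex: "2 * (h * m) - E / m * (real ?N)\<^sup>2 \<le> - (c * m)" using N2 by (simp add: algebra_simps)
  have "real (m choose ?N) \<le> (1 - \<sigma>) / \<sigma> * exp (h * m)"
    using N by (intro choose_le_entropy) (use \<sigma> h in auto)
  then have "(real (m choose ?N))\<^sup>2 \<le> ((1 - \<sigma>) / \<sigma> * exp (h * m))\<^sup>2" by (rule power_mono) simp
  also have "\<dots> = ((1 - \<sigma>) / \<sigma>)\<^sup>2 * exp (2 * (h * m))"
    by (simp only: power_mult_distrib exp_double)
  also have "\<dots> \<le> B * exp (2 * (h * m))" using B by (intro mult_right_mono) auto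
  finally have "(real (m choose ?N))\<^sup>2 * exp (- (E / m) * (real ?N)\<^sup>2) \<le> B * exp (2 * (h * m)) * exp (- (E / m) * (real ?N)\<^sup>2)"
    by (rule mult_right_mono) simp
  also have "\<dots> = B * exp (2 * (h * m) - E / m * (real ?N)\<^sup>2)" by (simp add: exp_diff exp_minus divide_inverse)
  also have "\<dots> \<le> B * exp (- (c * m))" using ex B by (intro mult_left_mono) auto
  finally have strong: "real ((m choose ?N)\<^sup>2) * exp (- (E / m) * (real ?N)\<^sup>2) \<le> 1 / (700 * real g)"
    using small by simp
  have "(\<Sum>c\<in>weak_colourings x m ?N. (\<Sum>i<x. exp (- (E / m) * card {j \<in> {..<m}. c j = i})) ^ (x * m))
      \<le> (x * ((real x - 1) * exp (- E * \<sigma>) + exp (- E * \<delta>)) ^ x) ^ m"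
    by (rule weak_sum_le) (use x m \<sigma> N in auto)
  also have "\<dots> \<le> (1 - c) ^ m" using star x by (intro power_mono) auto
  also have "\<dots> \<le> exp (- c) ^ m"
  proof (rule power_mono)
    show "1 - c \<le> exp (- c)" using exp_ge_add_one_self[of "- c"] by simp
    have "0 \<le> x * ((real x - 1) * exp (- E * \<sigma>) + exp (- E * \<delta>)) ^ x" using x by simp
    then show "0 \<le> 1 - c" using star by linarith
  qed
  also have "\<dots> = exp (- (c * m))" by (simp add: mult.commute flip: exp_of_nat_mult)
  also have "\<dots> \<le> B * exp (- (c * m))" using B mult_right_mono[of 1 B "exp (- (c * m))"] by simp
  also have "\<dots> \<le> 1 / (700 * real g)" by (rule small)
  finally have star': "(\<Sum>c\<in>weak_colourings x m ?N. (\<Sum>i<x. exp (- (E / m) * card {j \<in> {..<m}. c j = i})) ^ (x * m)) \<le> 1 / (700 * real g)" .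
  show ?thesis by (rule sparse_uncolourable_subgraph_density[OF G \<Delta> g m D L E(2) strong star'])
qed

text \<open>The bound (e x)^N: the binomial term at s = 1/x is at most 1, and its factor
  \<open>(1 - 1/x) ^ (m - N)\<close> is at least exp (- N) because \<open>m - N\<close> is at most
  \<open>(x - 1) * N\<close>.\<close>

lemma choose_le_plain:
  fixes x :: nat
  assumes "2 \<le> x" "N \<le> m" "m \<le> x * N"
  shows "real (m choose N) \<le> exp (N * (1 + ln x))"
proof -
  have x: "1 < real x" using assms by simp
  have "(m choose N) * (1 / x) ^ N * (1 - 1 / real x) ^ (m - N) \<le> 1"
    by (rule choose_mult_le_1) (use assms in auto)
  moreover have "exp (- real N) \<le> (1 - 1 / real x) ^ (m - N)"
  proof -
    have "1 + 1 / (real x - 1) \<le> exp (1 / (real x - 1))" by (rule exp_ge_add_one_self)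
    moreover have "1 + 1 / (real x - 1) = 1 / (1 - 1 / real x)" using x by (simp add: field_simps)
    ultimately have "1 / (1 - 1 / real x) \<le> exp (1 / (real x - 1))" by simp
    then have "1 / exp (1 / (real x - 1)) \<le> 1 - 1 / real x" using x by (simp add: field_simps)
    then have 1: "exp (- (1 / (real x - 1))) \<le> 1 - 1 / real x" by (simp only: exp_minus inverse_eq_divide)
    have "real (m - N) \<le> (real x - 1) * N"
      using assms by (simp add: of_nat_diff algebra_simps flip: of_nat_mult)
    then have "real (m - N) * (1 / (real x - 1)) \<le> N" using x by (simp add: divide_le_eq mult.commute)
    then have "exp (- real N) \<le> exp (real (m - N) * (- (1 / (real x - 1))))" by simp
    also have "\<dots> = exp (- (1 / (real x - 1))) ^ (m - N)" by (rule exp_of_nat_mult)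
    also have "\<dots> \<le> (1 - 1 / real x) ^ (m - N)" using 1 by (intro power_mono) auto
    finally show ?thesis .
  qed
  ultimately have "(m choose N) * (1 / x) ^ N * exp (- real N) \<le> 1"
    by (smt (verit) mult_left_mono of_nat_0_le_iff zero_le_divide_1_iff zero_le_power mult_nonneg_nonneg)
  moreover have "exp (N * (1 + ln x)) = exp (real N) * x ^ N"
    using x by (simp add: algebra_simps exp_add exp_of_nat_mult)
  ultimately show ?thesis using x by (simp add: exp_minus field_simps)
qed

text \<open>
  With \<open>\<sigma> = 1 / x\<close> some class always has \<open>N\<close> elements, so there are no weak colourings.
\<close>

lemma sparse_subgraph_plain:
  fixes D E L c :: real
  assumes G: "critical x G" and \<Delta>: "\<And>v. card (neighbours G v) \<le> \<Delta>" and g: "3 \<le> g" and m: "0 < m" and x: "2 \<le> x"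
    and D: "0 < D" "D / m \<le> 9 / 100"
    and L: "(\<Sum>k=3..g. cycle_count \<Delta> m k * (D / m) ^ k) \<le> L / m" and E: "0 \<le> E" "E \<le> D - 503/500 * L"
    and c: "0 \<le> c" "2 * (1 + ln x) + c \<le> E / x" "1400 * g \<le> (c * (m / x))\<^sup>2"
  shows "has_sparse_subgraph G m g x"
proof -
  define N where "N = nat \<lceil>1 / real x * real m\<rceil>"
  have N: "1 / real x * m \<le> N" "N < 1 / real x * m + 1" "N \<le> m" using nat_ceiling_bounds[of "1 / real x" m] x unfolding N_def by auto
  have xN: "real m \<le> real x * real N"
    using mult_left_mono[OF N(1), of "real x"] x by simp
  have "1400 * real g \<le> (c * N)\<^sup>2"
  proof -
    have "(c * (m / x))\<^sup>2 \<le> (c * N)\<^sup>2" using N(1) c x by (intro power_mono mult_left_mono) auto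
    then show ?thesis using c(3) by linarith
  qed
  then have small: "exp (- (c * N)) \<le> 1 / (700 * real g)"
    using exp_minus_le_inverse[of "c * N" 1 g] g c by simp
  have "real (m choose N) \<le> exp (N * (1 + ln x))"
    using xN by (intro choose_le_plain x N(3)) (simp flip: of_nat_mult)
  then have "(real (m choose N))\<^sup>2 \<le> (exp (N * (1 + ln x)))\<^sup>2" by (rule power_mono) simp
  also have "\<dots> = exp (N * (2 * (1 + ln x)))" by (simp add: power2_eq_square flip: exp_add)
  finally have "(real (m choose N))\<^sup>2 * exp (- (E / m) * (real N)\<^sup>2) \<le> exp (N * (2 * (1 + ln x))) * exp (- (E / m) * (real N)\<^sup>2)"
    by (rule mult_right_mono) simp
  also have "\<dots> = exp (N * (2 * (1 + ln x)) - E / m * (real N)\<^sup>2)" by (simp add: exp_diff exp_minus divide_inverse)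
  also have "\<dots> \<le> exp (- (c * N))"
  proof -
    \<comment> \<open>Since \<open>x * N\<close> is at least \<open>m\<close>, the exponent per
      element of a side, at most 2 (1 + ln x) - E N / m, is bounded by its value for N = m /
      x.\<close>
    have "E / x \<le> E / m * N" using xN m x E by (simp add: field_simps mult_left_mono)
    then have "2 * (1 + ln x) - E / m * N \<le> - c" using c by linarith
    then have "N * (2 * (1 + ln x) - E / m * N) \<le> N * (- c)" by (rule mult_left_mono) simp
    then show ?thesis by (simp add: algebra_simps power2_eq_square)
  qed
  finally have strong: "real ((m choose N)\<^sup>2) * exp (- (E / m) * (real N)\<^sup>2) \<le> 1 / (700 * real g)"
    using small by simp
  have "weak_colourings x m N = {}"
  proof (rule equals0I)
    fix c assume c: "c \<in> weak_colourings x m N"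
    have cm: "c ` {..<m} \<subseteq> {..<x}" using c by (auto simp: weak_colourings_def PiE_iff)
    have "m = (\<Sum>i<x. card {j \<in> {..<m}. c j = i})"
      using sum.group[of "{..<m}" "{..<x}" c "\<lambda>_. 1::nat"] cm by simp
    also have "\<dots> \<le> (\<Sum>i<x. N - 1)" using c by (intro sum_mono) (fastforce simp: weak_colourings_def)
    also have "\<dots> = x * (N - 1)" by simp
    finally have "real m \<le> real x * real (N - 1)" by (metis of_nat_le_iff of_nat_mult)
    moreover have "real x * real (N - 1) < m"
    proof (cases "N = 0")
      case False
      then have "real (N - 1) = real N - 1" by (simp add: of_nat_diff)
      then show ?thesis using N(2) x by (simp add: field_simps)
    qed (use m in simp)
    ultimately show False by linarith
  qed
  then have star: "(\<Sum>c\<in>weak_colourings x m N. (\<Sum>i<x. exp (- (E / m) * card {j \<in> {..<m}. c j = i})) ^ (x * m)) \<le> 1 / (700 * real g)"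
    by simp
  show ?thesis by (rule sparse_uncolourable_subgraph_density[OF G \<Delta> g m D L E(2) strong star])
qed

text \<open>Shows that \<open>m\<close> also grows at least linearly in \<open>g\<close>, so that an
  exponentially small quantity in \<open>m\<close> beats the target 1 / (700 g).\<close>

lemma degree_product_ge:
  assumes x: "3 \<le> x" and \<Delta>: "x \<le> \<Delta>" and g: "4 \<le> g"
    and m: "real m > real x * (real x * real \<Delta>) ^ (2 * g - 4)"
  shows "real x ^ 9 * g \<le> 4 * real m"
proof -
  have x4: "1 \<le> real x ^ 4" using x by (intro one_le_power) simp
  have e: "2 * g - 4 = 4 + 2 * (g - 4)" using g by simp
  have "real x ^ 2 \<le> real x * \<Delta>" using x \<Delta> by (simp add: power2_eq_square)
  then have "(real x ^ 2) ^ (2 * g - 4) \<le> (real x * \<Delta>) ^ (2 * g - 4)" by (intro power_mono) auto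
  then have "real x * (real x ^ 2) ^ (2 * g - 4) \<le> real x * (real x * \<Delta>) ^ (2 * g - 4)"
    by (rule mult_left_mono) simp
  then have 1: "real x * (real x ^ 2) ^ (2 * g - 4) \<le> real m" using m by linarith
  have "1 + real (g - 4) * (real x ^ 4 - 1) \<le> (1 + (real x ^ 4 - 1)) ^ (g - 4)"
    by (rule Bernoulli_inequality) (use x4 in simp)
  moreover have "(3::real) ^ 4 \<le> real x ^ 4" using x by (intro power_mono) auto
  then have "real (g - 4) * 1 \<le> real (g - 4) * (real x ^ 4 - 1)" by (intro mult_left_mono) auto
  ultimately have "real g \<le> 4 * (real x ^ 4) ^ (g - 4)" using g by (simp add: of_nat_diff)
  then have "real x ^ 9 * g \<le> real x ^ 9 * (4 * (real x ^ 4) ^ (g - 4))" by (rule mult_left_mono) simp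
  also have "\<dots> = 4 * (real x * (real x ^ 2) ^ (2 * g - 4))"
  proof -
    have "(y ^ 2) ^ (4 + 2 * n) = y ^ 8 * (y ^ 4) ^ n" for y :: real and n
      by (simp add: power_add flip: power_mult)
    moreover have "real x ^ 9 = real x * real x ^ 8" by (simp flip: power_Suc)
    ultimately show ?thesis unfolding e by simp
  qed
  finally show ?thesis using 1 by simp
qed

lemma crude_loss_le:
  fixes D \<kappa> r :: real
  assumes "1 \<le> \<Delta>" "3 \<le> g" "real m > real x * (real x * real \<Delta>) ^ (2 * g - 4)" "0 < x"
    and "0 < D" "1 \<le> \<kappa>" "\<Delta> * D \<le> \<kappa> * (\<Delta> * D - 1)"
    and r: "D / (real x ^ 2 * \<Delta>) \<le> r" "r \<le> 1" "n \<le> g - 2"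
  shows "(\<Sum>k=3..g. cycle_count \<Delta> m k * (D / m) ^ k) \<le> (\<kappa> * (D\<^sup>2 / x) * r ^ n) / m"
proof -
  have "(D / (real x ^ 2 * \<Delta>)) ^ (g - 2) \<le> r ^ (g - 2)" using assms by (intro power_mono) auto
  also have "\<dots> \<le> r ^ n"
    using r order_trans[OF _ r(1), of 0] assms by (intro power_decreasing) auto
  finally have "(\<kappa> * (D\<^sup>2 / x) * (D / (real x ^ 2 * \<Delta>)) ^ (g - 2)) / m \<le> (\<kappa> * (D\<^sup>2 / x) * r ^ n) / m"
    using assms by (intro divide_right_mono mult_left_mono) auto
  with crude_loss[OF assms(1-7)] show ?thesis by linarith
qed

text \<open>All analytic conditions become rational ones: \<open>l1\<close>, \<open>l2\<close> bound
  the logarithms in the entropy and \<open>e1\<close>, \<open>e2\<close> the exponentials at the two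
  extreme densities. The constant 22400 is 1400 * 16, from \<open>m \<ge> x ^ 9 * g / 4\<close>
  squared.\<close>

lemma sparse_subgraph_entropy_rational:
  fixes D E L \<sigma> h c B l1 l2 e1 e2 M :: real
  assumes G: "critical x G" and \<Delta>: "\<And>v. card (neighbours G v) \<le> \<Delta>" "x \<le> \<Delta>" and g: "4 \<le> g" and x: "3 \<le> x"
    and m: "real m > real x * (real x * real \<Delta>) ^ (2 * g - 4)"
    and D: "0 < D" "D \<le> 100"
    and L: "(\<Sum>k=3..g. cycle_count \<Delta> m k * (D / m) ^ k) \<le> L / m" and E: "0 \<le> E" "E \<le> D - 503/500 * L"
    and \<sigma>: "0 < \<sigma>" "\<sigma> \<le> 1/2" "(real x - 1) * \<sigma> \<le> 1" "1 < x * \<sigma>"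
    and l: "0 \<le> l1" "1 / \<sigma> \<le> (\<Sum>k<14. l1 ^ k / fact k)" "0 \<le> l2" "1 / (1 - \<sigma>) \<le> (\<Sum>k<14. l2 ^ k / fact k)"
    and c: "0 \<le> c" "2 * (\<sigma> * l1 + (1 - \<sigma>) * l2) + c \<le> E * \<sigma>\<^sup>2"
    and e: "0 < e1" "1 / e1 \<le> (\<Sum>k<14. (E * \<sigma>) ^ k / fact k)"
      "0 < e2" "1 / e2 \<le> (\<Sum>k<14. (E * (1 - (real x - 1) * \<sigma>)) ^ k / fact k)"
    and star: "x * ((real x - 1) * e1 + e2) ^ x \<le> 1 - c"
    and B: "((1 - \<sigma>) / \<sigma>)\<^sup>2 \<le> B" "1 \<le> B" "22400 * B \<le> c\<^sup>2 * (real x ^ 9)\<^sup>2"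
  shows "has_sparse_subgraph G m g x"
proof (rule sparse_subgraph_entropy[OF G \<Delta>(1) _ _ _ D(1) _ L E \<sigma>(1,2) refl])
  note mg = degree_product_ge[OF x \<Delta>(2) g m]
  have x9: "(3::real) ^ 9 \<le> real x ^ 9" using x by (intro power_mono) auto
  have "real x ^ 9 * 4 \<le> real x ^ 9 * g" using g by (intro mult_left_mono) auto
  then have xm: "real x ^ 9 \<le> m" using mg by linarith
  then have "19683 \<le> real m" using order_trans[OF x9 xm] by simp
  then show "0 < m" "D / m \<le> 9 / 100" using D by (auto simp: divide_le_eq)
  show "3 \<le> g" "2 \<le> x" using g x by auto
  show "1 - (real x - 1) * \<sigma> < \<sigma>" using \<sigma> by (simp add: algebra_simps)
  have "ln (1 / \<sigma>) \<le> l1" using l \<sigma> by (intro ln_le_of_taylor[where n = 14]) auto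
  then have "\<sigma> * ln (1 / \<sigma>) \<le> \<sigma> * l1" using \<sigma> by (intro mult_left_mono) auto
  moreover have "ln (1 / (1 - \<sigma>)) \<le> l2" using l \<sigma> by (intro ln_le_of_taylor[where n = 14]) auto
  then have "(1 - \<sigma>) * ln (1 / (1 - \<sigma>)) \<le> (1 - \<sigma>) * l2" using \<sigma> by (intro mult_left_mono) auto
  ultimately show "\<sigma> * ln (1 / \<sigma>) + (1 - \<sigma>) * ln (1 / (1 - \<sigma>)) \<le> \<sigma> * l1 + (1 - \<sigma>) * l2" by linarith
  show "0 \<le> c" "2 * (\<sigma> * l1 + (1 - \<sigma>) * l2) + c \<le> E * \<sigma>\<^sup>2" by fact+
  have "exp (- (E * \<sigma>)) \<le> e1" using e E \<sigma> by (intro exp_minus_le_of_taylor[where n = 14]) auto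
  then have "(real x - 1) * exp (- E * \<sigma>) \<le> (real x - 1) * e1" using x by (intro mult_left_mono) auto
  moreover have "exp (- (E * (1 - (real x - 1) * \<sigma>))) \<le> e2" using e E \<sigma> by (intro exp_minus_le_of_taylor[where n = 14]) auto
  ultimately have "(real x - 1) * exp (- E * \<sigma>) + exp (- E * (1 - (real x - 1) * \<sigma>)) \<le> (real x - 1) * e1 + e2" by simp
  then have "((real x - 1) * exp (- E * \<sigma>) + exp (- E * (1 - (real x - 1) * \<sigma>))) ^ x \<le> ((real x - 1) * e1 + e2) ^ x"
    using x by (intro power_mono) auto
  then have "x * ((real x - 1) * exp (- E * \<sigma>) + exp (- E * (1 - (real x - 1) * \<sigma>))) ^ x \<le> x * ((real x - 1) * e1 + e2) ^ x"
    by (rule mult_left_mono) simp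
  then show "x * ((real x - 1) * exp (- E * \<sigma>) + exp (- E * (1 - (real x - 1) * \<sigma>))) ^ x \<le> 1 - c"
    using star by linarith
  show "((1 - \<sigma>) / \<sigma>)\<^sup>2 \<le> B" "1 \<le> B" by fact+
  have "(c * (real x ^ 9 * g / 4))\<^sup>2 \<le> (c * m)\<^sup>2"
    using mg c by (intro power_mono mult_left_mono) auto
  moreover have "(c * (real x ^ 9 * g / 4))\<^sup>2 = c\<^sup>2 * (real x ^ 9)\<^sup>2 * ((real g)\<^sup>2 / 16)" by (simp add: power_mult_distrib power_divide)
  moreover have "22400 * B * ((real g)\<^sup>2 / 16) \<le> c\<^sup>2 * (real x ^ 9)\<^sup>2 * ((real g)\<^sup>2 / 16)" using B by (intro mult_right_mono) auto
  moreover have "1400 * B * g \<le> 22400 * B * ((real g)\<^sup>2 / 16)" using B g by (simp add: power2_eq_square mult_left_mono)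
  ultimately show "1400 * B * g \<le> (c * m)\<^sup>2" by linarith
qed

section \<open>Numerical verification, case by case in x\<close>

lemmas taylor_simps = lessThan_nat_numeral fact_numeral power_divide power2_eq_square

lemma sparse_subgraph_3:
  assumes G: "critical 3 G" and \<Delta>: "\<And>v. card (neighbours G v) \<le> \<Delta>" "3 \<le> \<Delta>" and g: "4 \<le> g"
    and m: "real m > real 3 * (real 3 * real \<Delta>) ^ (2 * g - 4)"
  shows "has_sparse_subgraph G m g 3"
proof -
  \<comment> \<open>A case with almost no room. This \<open>D\<close> nearly maximises density minus
    cost for \<Delta> = 3 and g = 4. Below, \<open>E\<close> is the remainder rounded down, \<sigma>
    balances the two kinds of missed sets, and \<open>c\<close> is the margin left over.\<close>
  let ?D = "177/20 :: real" and ?L = "22521/10000 :: real"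
  have L: "(\<Sum>k=3..g. cycle_count \<Delta> m k * (?D / m) ^ k) \<le> ?L / m"
  proof -
    have q: "\<Delta> * ?D \<le> 104/100 * (\<Delta> * ?D - 1)" using \<Delta> by simp
    \<comment> \<open>Only the smallest pair needs the refined count; a larger \<Delta> or
      \<open>g\<close> makes the geometric factor of the crude estimate small enough.\<close>
    consider "\<Delta> = 3" "g = 4" | "4 \<le> \<Delta>" | "\<Delta> = 3" "5 \<le> g" using \<Delta> g by linarith
    then show ?thesis
    proof cases
      case 1
      then have m': "19683 < real m" using m by simp
      then have "0 < m" by simp
      have "(\<Sum>k=3..g. cycle_count \<Delta> m k * (?D / m) ^ k) = ((2 * ?D ^ 3 + 7 * ?D ^ 4) / m) / m"
        using refined_loss[of 3 m ?D] 1 \<open>0 < m\<close> by simp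
      also have "\<dots> \<le> ((2 * ?D ^ 3 + 7 * ?D ^ 4) / 19683) / m"
        using m' by (intro divide_right_mono divide_left_mono) auto
      also have "\<dots> \<le> ?L / m" by (intro divide_right_mono) (auto simp: power_divide)
      finally show ?thesis .
    next
      case 2
      have "(\<Sum>k=3..g. cycle_count \<Delta> m k * (?D / m) ^ k) \<le> (104/100 * (?D\<^sup>2 / real 3) * (?D / 36) ^ 2) / m"
        by (rule crude_loss_le) (use 2 g m q in \<open>auto simp: field_simps\<close>)
      also have "\<dots> \<le> ?L / m" by (intro divide_right_mono) (auto simp: power_divide)
      finally show ?thesis .
    next
      case 3
      have "(\<Sum>k=3..g. cycle_count \<Delta> m k * (?D / m) ^ k) \<le> (104/100 * (?D\<^sup>2 / real 3) * (?D / 27) ^ 3) / m"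
        by (rule crude_loss_le) (use 3 g m q in \<open>auto simp: field_simps\<close>)
      also have "\<dots> \<le> ?L / m" by (intro divide_right_mono) (auto simp: power_divide)
      finally show ?thesis .
    qed
  qed
  show ?thesis
    by (rule sparse_subgraph_entropy_rational[OF G \<Delta> g _ m _ _ L,
          where E = "329/50" and \<sigma> = "23/50" and ?l1.0 = "7766/10000" and ?l2.0 = "6162/10000" and c = "12/1000"
            and ?e1.0 = "485/10000" and ?e2.0 = "5908/10000" and B = "14/10"])
      (simp_all add: taylor_simps)
qed

lemma sparse_subgraph_4:
  assumes G: "critical 4 G" and \<Delta>: "\<And>v. card (neighbours G v) \<le> \<Delta>" "4 \<le> \<Delta>" and g: "4 \<le> g"
    and m: "real m > real 4 * (real 4 * real \<Delta>) ^ (2 * g - 4)"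
  shows "has_sparse_subgraph G m g 4"
proof -
  let ?D = "17 :: real" and ?L = "42/10 :: real"
  have L: "(\<Sum>k=3..g. cycle_count \<Delta> m k * (?D / m) ^ k) \<le> ?L / m"
  proof -
    have q: "\<Delta> * ?D \<le> 102/100 * (\<Delta> * ?D - 1)" using \<Delta> by simp
    consider "\<Delta> = 4" "g = 4" | "5 \<le> \<Delta>" | "\<Delta> = 4" "5 \<le> g" using \<Delta> g by linarith
    then show ?thesis
    proof cases
      case 1
      then have m': "262144 < real m" using m by simp
      then have "0 < m" by simp
      have "(\<Sum>k=3..g. cycle_count \<Delta> m k * (?D / m) ^ k) = ((3 * ?D ^ 3 + 13 * ?D ^ 4) / m) / m"
        using refined_loss[of 4 m ?D] 1 \<open>0 < m\<close> by simp
      also have "\<dots> \<le> ((3 * ?D ^ 3 + 13 * ?D ^ 4) / 262144) / m"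
        using m' by (intro divide_right_mono divide_left_mono) auto
      also have "\<dots> \<le> ?L / m" by (intro divide_right_mono) (auto simp: power_divide)
      finally show ?thesis .
    next
      case 2
      have "(\<Sum>k=3..g. cycle_count \<Delta> m k * (?D / m) ^ k) \<le> (102/100 * (?D\<^sup>2 / real 4) * (?D / 80) ^ 2) / m"
        by (rule crude_loss_le) (use 2 g m q in \<open>auto simp: field_simps\<close>)
      also have "\<dots> \<le> ?L / m" by (intro divide_right_mono) (auto simp: power_divide)
      finally show ?thesis .
    next
      case 3
      have "(\<Sum>k=3..g. cycle_count \<Delta> m k * (?D / m) ^ k) \<le> (102/100 * (?D\<^sup>2 / real 4) * (?D / 64) ^ 3) / m"
        by (rule crude_loss_le) (use 3 g m q in \<open>auto simp: field_simps\<close>)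
      also have "\<dots> \<le> ?L / m" by (intro divide_right_mono) (auto simp: power_divide)
      finally show ?thesis .
    qed
  qed
  show ?thesis
    by (rule sparse_subgraph_entropy_rational[OF G \<Delta> g _ m _ _ L,
          where E = "127/10" and \<sigma> = "8/25" and ?l1.0 = "11395/10000" and ?l2.0 = "3858/10000" and c = "4/100"
            and ?e1.0 = "172/10000" and ?e2.0 = "6018/10000" and B = 5])
      (simp_all add: taylor_simps)
qed

lemma sparse_subgraph_5:
  assumes G: "critical 5 G" and \<Delta>: "\<And>v. card (neighbours G v) \<le> \<Delta>" "5 \<le> \<Delta>" and g: "4 \<le> g"
    and m: "real m > real 5 * (real 5 * real \<Delta>) ^ (2 * g - 4)"
  shows "has_sparse_subgraph G m g 5"
proof -
  have L: "(\<Sum>k=3..g. cycle_count \<Delta> m k * (26 / real m) ^ k) \<le> (101/100 * (26\<^sup>2 / real 5) * (26 / 125) ^ 2) / m"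
    by (rule crude_loss_le) (use \<Delta> g m in \<open>auto simp: field_simps\<close>)
  show ?thesis
    by (rule sparse_subgraph_entropy_rational[OF G \<Delta> g _ m _ _ L,
          where E = 20 and \<sigma> = "6/25" and ?l1.0 = "14272/10000" and ?l2.0 = "2745/10000" and c = "4/100"
            and ?e1.0 = "83/10000" and ?e2.0 = "4494/10000" and B = 11])
      (simp_all add: taylor_simps)
qed

lemma sparse_subgraph_6:
  assumes G: "critical 6 G" and \<Delta>: "\<And>v. card (neighbours G v) \<le> \<Delta>" "6 \<le> \<Delta>" and g: "4 \<le> g"
    and m: "real m > real 6 * (real 6 * real \<Delta>) ^ (2 * g - 4)"
  shows "has_sparse_subgraph G m g 6"
proof -
  have L: "(\<Sum>k=3..g. cycle_count \<Delta> m k * (40 / real m) ^ k) \<le> (101/100 * (40\<^sup>2 / real 6) * (40 / 216) ^ 2) / m"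
    by (rule crude_loss_le) (use \<Delta> g m in \<open>auto simp: field_simps\<close>)
  show ?thesis
    by (rule sparse_subgraph_entropy_rational[OF G \<Delta> g _ m _ _ L,
          where E = 30 and \<sigma> = "19/100" and ?l1.0 = "16610/10000" and ?l2.0 = "2108/10000" and c = "4/100"
            and ?e1.0 = "35/10000" and ?e2.0 = "2232/10000" and B = 19])
      (simp_all add: taylor_simps)
qed

lemma ln_le_tangent:
  fixes a y :: real
  assumes "0 < a" "0 < y"
  shows "ln y \<le> ln a + (y - a) / a"
proof -
  have "ln (y / a) \<le> y / a - 1" using assms by (intro ln_le_minus_one) simp
  moreover have "ln (y / a) = ln y - ln a" using assms by (simp add: ln_div)
  moreover have "(y - a) / a = y / a - 1" using assms by (simp add: diff_divide_distrib)
  ultimately show ?thesis by linarith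
qed

lemma sparse_subgraph_ge_7:
  assumes G: "critical x G" and \<Delta>: "\<And>v. card (neighbours G v) \<le> \<Delta>" "x \<le> \<Delta>" and g: "4 \<le> g" and x: "7 \<le> x"
    and m: "real m > real x * (real x * real \<Delta>) ^ (2 * g - 4)"
  shows "has_sparse_subgraph G m g x"
proof -
  define y where "y = real x"
  have y: "7 \<le> y" "y \<le> \<Delta>" using x \<Delta>(2) by (auto simp: y_def)
  \<comment> \<open>For g >= 4 the cost is linear in x while D is quadratic, so from x = 7 on E =
    87/100 * x^2 remains.\<close>
  let ?D = "9/8 * y\<^sup>2"
  have y2: "7 * y \<le> y\<^sup>2" using y by (simp add: power2_eq_square)
  have mg: "y ^ 9 * g \<le> 4 * real m" using degree_product_ge[OF _ \<Delta>(2) g m] x by (simp add: y_def)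
  have "y ^ 9 * 4 \<le> y ^ 9 * g" using g y by (intro mult_left_mono) auto
  then have ym: "y ^ 9 \<le> m" using mg by linarith
  have "7 ^ 7 * y\<^sup>2 \<le> y ^ 7 * y\<^sup>2" using y by (intro mult_right_mono power_mono) auto
  also have "y ^ 7 * y\<^sup>2 = y ^ 9" by (simp flip: power_add)
  finally have ym2: "7 ^ 7 * y\<^sup>2 \<le> m" using ym by linarith
  have L: "(\<Sum>k=3..g. cycle_count \<Delta> m k * (?D / m) ^ k) \<le> (101/100 * (?D\<^sup>2 / real x) * (9 / (8 * y)) ^ 2) / m"
  proof (rule crude_loss_le)
    have "7 * (9/8 * (7 * 7)) \<le> \<Delta> * ?D"
      using y y2 by (intro mult_mono) auto
    then show "\<Delta> * ?D \<le> 101/100 * (\<Delta> * ?D - 1)" by simp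
    show "?D / (real x ^ 2 * \<Delta>) \<le> 9 / (8 * y)"
      using y unfolding y_def[symmetric] by (simp add: field_simps power2_eq_square)
    show "9 / (8 * y) \<le> 1" using y by (simp add: field_simps)
  qed (use y x g m in auto)
  have Leq: "101/100 * (?D\<^sup>2 / real x) * (9 / (8 * y)) ^ 2 = 101/100 * (6561/4096) * y"
    using y unfolding y_def[symmetric] by (simp add: field_simps power2_eq_square)
  have "0 < y ^ 9" using y by simp
  then have m0: "0 < real m" using ym by linarith
  show ?thesis
  proof (rule sparse_subgraph_plain[OF G \<Delta>(1) _ _ _ _ _ L[unfolded Leq]])
    show "0 < ?D" using y by simp
    have "9/8 * y\<^sup>2 \<le> 9/100 * (7 ^ 7 * y\<^sup>2)" using y by simp
    also have "\<dots> \<le> 9/100 * m" using ym2 by simp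
    finally show "?D / m \<le> 9 / 100" using m0 by (simp add: divide_le_eq)
    show "0 \<le> 87/100 * y\<^sup>2" by simp
    show "87/100 * y\<^sup>2 \<le> ?D - 503/500 * (101/100 * (6561/4096) * y)" using y y2 by simp
    \<comment> \<open>The logarithm lies below its tangent at 7, so one numerical value of ln
      settles all larger x.\<close>
    have "ln y \<le> ln 7 + (y - 7) / 7" using y by (intro ln_le_tangent) auto
    moreover have "ln 7 \<le> (1946/1000 :: real)" by (rule ln_le_of_taylor[where n = 14]) (simp_all add: taylor_simps)
    ultimately have "2 * (1 + ln y) + 4/100 \<le> 87/100 * y" using y(1) by argo
    moreover have "87/100 * y\<^sup>2 / y = 87/100 * y" using y by (simp add: power2_eq_square)
    ultimately show "2 * (1 + ln (real x)) + 4/100 \<le> 87/100 * y\<^sup>2 / real x" by (simp add: y_def)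
    have "y ^ 8 * g / 4 \<le> m / y" using mg y by (simp add: field_simps power_numeral_reduce)
    moreover have "7 ^ 8 * real g / 4 \<le> y ^ 8 * g / 4"
      by (rule divide_right_mono[OF mult_right_mono[OF power_mono]]) (use y in auto)
    ultimately have "7 ^ 8 * real g / 4 \<le> m / y" by linarith
    then have "(4/100 * (7 ^ 8 * real g / 4))\<^sup>2 \<le> (4/100 * (m / y))\<^sup>2" by (intro power_mono mult_left_mono) auto
    moreover have "1400 * real g \<le> (4/100 * (7 ^ 8 * real g / 4))\<^sup>2" using g by (simp add: power2_eq_square)
    ultimately show "1400 * real g \<le> (4/100 * (m / real x))\<^sup>2" unfolding y_def by linarith
  qed (use x g m0 in auto)
qed

lemma sparse_subgraph_ge_23:
  assumes G: "critical x G" and \<Delta>: "\<And>v. card (neighbours G v) \<le> \<Delta>" "x \<le> \<Delta>" and x: "23 \<le> x"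
    and m: "real m > real x * (real x * real \<Delta>) ^ 2"
  shows "has_sparse_subgraph G m 3 x"
proof -
  define y where "y = real x"
  have y: "23 \<le> y" "y \<le> \<Delta>" using x \<Delta>(2) by (auto simp: y_def)
  \<comment> \<open>For D = c x^2 what remains is about (c - c^3) x^2, largest at c = 1 / sqrt 3;
    4/7 is a rational value nearby and leaves 38/100.\<close>
  let ?D = "4/7 * y\<^sup>2"
  have y2: "23 * y \<le> y\<^sup>2" using y by (simp add: power2_eq_square)
  have "y\<^sup>2 \<le> y * \<Delta>" using y by (simp add: power2_eq_square)
  then have "y * (y\<^sup>2)\<^sup>2 \<le> y * (y * \<Delta>)\<^sup>2" using y by (intro mult_left_mono power_mono) auto
  then have ym: "y * (y\<^sup>2)\<^sup>2 \<le> m" using m by (simp add: y_def)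
  have y22: "(23\<^sup>2)\<^sup>2 \<le> (y\<^sup>2)\<^sup>2" using y by (intro power_mono) auto
  have "23 ^ 3 * y\<^sup>2 \<le> y ^ 3 * y\<^sup>2" using y by (intro mult_right_mono power_mono) auto
  also have "y ^ 3 * y\<^sup>2 = y * (y\<^sup>2)\<^sup>2" by (simp add: power2_eq_square power3_eq_cube)
  finally have ym2: "23 ^ 3 * y\<^sup>2 \<le> m" using ym by linarith
  have "0 < y * (y\<^sup>2)\<^sup>2" using y by simp
  then have m0: "0 < real m" using ym by linarith
  have L: "(\<Sum>k=3..3. cycle_count \<Delta> m k * (?D / m) ^ k) \<le> (101/100 * (?D\<^sup>2 / real x) * (4 / (7 * y)) ^ 1) / m"
  proof (rule crude_loss_le)
    have "23 * (4/7 * (23 * 23)) \<le> \<Delta> * ?D"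
      using y y2 by (intro mult_mono) auto
    then show "\<Delta> * ?D \<le> 101/100 * (\<Delta> * ?D - 1)" by simp
    show "?D / (real x ^ 2 * \<Delta>) \<le> 4 / (7 * y)"
      using y unfolding y_def[symmetric] by (simp add: field_simps power2_eq_square)
    show "4 / (7 * y) \<le> 1" using y by (simp add: field_simps)
  qed (use y x m in auto)
  have Leq: "101/100 * (?D\<^sup>2 / real x) * (4 / (7 * y)) ^ 1 = 101/100 * (64/343) * y\<^sup>2"
    using y unfolding y_def[symmetric] by (simp add: field_simps power2_eq_square)
  show ?thesis
  proof (rule sparse_subgraph_plain[OF G \<Delta>(1) _ _ _ _ _ L[unfolded Leq]])
    show "0 < ?D" using y by simp
    have "4/7 * y\<^sup>2 \<le> 9/100 * (23 ^ 3 * y\<^sup>2)" using y by simp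
    also have "\<dots> \<le> 9/100 * m" using ym2 by simp
    finally show "?D / m \<le> 9 / 100" using m0 by (simp add: divide_le_eq)
    show "0 \<le> 38/100 * y\<^sup>2" by simp
    show "38/100 * y\<^sup>2 \<le> ?D - 503/500 * (101/100 * (64/343) * y\<^sup>2)" by simp
    have "ln y \<le> ln 23 + (y - 23) / 23" using y by (intro ln_le_tangent) auto
    moreover have "ln 23 \<le> (3137/1000 :: real)" by (rule ln_le_of_taylor[where n = 14]) (simp_all add: taylor_simps)
    ultimately have "2 * (1 + ln y) + 4/10 \<le> 38/100 * y" using y(1) by argo
    moreover have "38/100 * y\<^sup>2 / y = 38/100 * y" using y by (simp add: power2_eq_square)
    ultimately show "2 * (1 + ln (real x)) + 4/10 \<le> 38/100 * y\<^sup>2 / real x" by (simp add: y_def)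
    have "(y\<^sup>2)\<^sup>2 \<le> m / y" using ym y by (simp add: field_simps)
    then have "279841 \<le> m / y" using y22 by simp
    then have "(4/10 * 279841)\<^sup>2 \<le> (4/10 * (m / y))\<^sup>2" by (intro power_mono mult_left_mono) auto
    moreover have "1400 * real 3 \<le> (4/10 * 279841)\<^sup>2" by (simp add: power2_eq_square)
    ultimately show "1400 * real 3 \<le> (4/10 * (m / real x))\<^sup>2" unfolding y_def by linarith
  qed (use x m0 in auto)
qed

lemma sparse_subgraph_large_girth:
  assumes G: "critical x G" and \<Delta>: "\<And>v. card (neighbours G v) \<le> \<Delta>" "x \<le> \<Delta>" and g: "4 \<le> g" and x: "3 \<le> x"
    and m: "real m > real x * (real x * real \<Delta>) ^ (2 * g - 4)"
  shows "has_sparse_subgraph G m g x"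
proof -
  consider "x = 3" | "x = 4" | "x = 5" | "x = 6" | "7 \<le> x" using x by linarith
  then show ?thesis
  proof cases
    case 1 then show ?thesis using sparse_subgraph_3[of G] assms by blast
  next
    case 2 then show ?thesis using sparse_subgraph_4[of G] assms by blast
  next
    case 3 then show ?thesis using sparse_subgraph_5[of G] assms by blast
  next
    case 4 then show ?thesis using sparse_subgraph_6[of G] assms by blast
  next
    case 5 then show ?thesis using sparse_subgraph_ge_7[OF G \<Delta> g] m by blast
  qed
qed

section \<open>Parsons' graphs\<close>

definition nonresidue :: "nat \<Rightarrow> int \<Rightarrow> bool" where
  "nonresidue p r \<longleftrightarrow> (\<nexists>w. [w\<^sup>2 = r] (mod int p))"

lemma cong_replace: "[a = r] (mod m) \<Longrightarrow> [b = r] (mod m) \<longleftrightarrow> [b = a] (mod m)"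
  for a b r m :: int
  by (simp add: cong_def)

lemma nonresidue_cong: "[r = s] (mod int p) \<Longrightarrow> nonresidue p r \<longleftrightarrow> nonresidue p s"
  unfolding nonresidue_def by (simp add: cong_def)

lemma nonresidue_not_0: "nonresidue p r \<Longrightarrow> \<not> [r = 0] (mod int p)"
  unfolding nonresidue_def by (metis cong_sym power_zero_numeral)

section \<open>Residues modulo an odd prime\<close>

context
  fixes p :: nat
  assumes p: "prime p" "2 < p"
begin

lemma prime_int_dvd_mult: "int p dvd a * b \<longleftrightarrow> int p dvd a \<or> int p dvd b"
  using p(1) by (simp add: prime_dvd_mult_iff)

lemma odd_prime_not_dvd_2: "\<not> int p dvd 2"
proof
  assume "int p dvd 2"
  then have "int p \<le> 2" by (rule zdvd_imp_le) simp
  then show False using p by simp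
qed

text \<open>The affine map permutes the residues; every substitution in a character-free counting
  argument below goes through this.\<close>

lemma sum_periodic_affine:
  fixes h :: "int \<Rightarrow> 'b::comm_monoid_add"
  assumes h: "\<And>z. h (z mod int p) = h z" and a: "\<not> int p dvd a"
  shows "(\<Sum>z\<in>{0..<int p}. h (a * z + b)) = (\<Sum>z\<in>{0..<int p}. h z)"
proof -
  let ?F = "{0..<int p}"
  let ?s = "\<lambda>z. (a * z + b) mod int p"
  have inj: "inj_on ?s ?F"
  proof (rule inj_onI)
    fix z w assume zw: "z \<in> ?F" "w \<in> ?F" "?s z = ?s w"
    then have "int p dvd (a * z + b) - (a * w + b)" by (simp add: mod_eq_dvd_iff)
    then have "int p dvd a * (z - w)" by (simp add: algebra_simps)
    then have "int p dvd z - w" using a prime_int_dvd_mult by blast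
    then show "z = w" using zw by (metis atLeastLessThan_iff mod_eq_dvd_iff mod_pos_pos_trivial)
  qed
  have "?s ` ?F \<subseteq> ?F" using p by auto
  then have "?s ` ?F = ?F" using inj by (simp add: endo_inj_surj)
  then have "bij_betw ?s ?F ?F" using inj by (simp add: bij_betw_def)
  then have "(\<Sum>z\<in>?F. h (?s z)) = (\<Sum>z\<in>?F. h z)" by (rule sum.reindex_bij_betw)
  then show ?thesis by (simp add: h)
qed

lemma roots_card:
  "card {w \<in> {0..<int p}. [w\<^sup>2 = r] (mod int p)} = (if [r = 0] (mod int p) then 1 else if nonresidue p r then 0 else 2)"
proof -
  let ?R = "{w \<in> {0..<int p}. [w\<^sup>2 = r] (mod int p)}"
  have p0: "0 < int p" using p by simp
  consider "[r = 0] (mod int p)" | "nonresidue p r" | w where "\<not> [r = 0] (mod int p)" "[w\<^sup>2 = r] (mod int p)"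
    unfolding nonresidue_def by blast
  then show ?thesis
  proof cases
    case 1
    have "[w\<^sup>2 = r] (mod int p) \<longleftrightarrow> int p dvd w" for w
    proof -
      have "[w\<^sup>2 = r] (mod int p) \<longleftrightarrow> [w\<^sup>2 = 0] (mod int p)" by (rule cong_replace[OF 1, symmetric])
      then show ?thesis by (simp add: cong_0_iff prime_int_dvd_mult power2_eq_square)
    qed
    then have R: "?R = {0}" using p0 by (auto dest: zdvd_imp_le)
    show ?thesis unfolding R using 1 by simp
  next
    case 2
    then have R: "?R = {}" by (auto simp: nonresidue_def)
    show ?thesis unfolding R using 2 nonresidue_not_0[OF 2] by simp
  next
    case 3
    let ?w = "w mod int p" and ?v = "(- w) mod int p"
    have nw: "\<not> int p dvd w"
    proof
      assume "int p dvd w"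
      then have "[0 = w\<^sup>2] (mod int p)" by (simp add: cong_sym_eq[of 0] cong_0_iff power2_eq_square)
      then show False using cong_trans[OF _ 3(2), of 0] 3(1) by (simp add: cong_sym_eq)
    qed
    have sq: "[v\<^sup>2 = r] (mod int p) \<longleftrightarrow> int p dvd v - w \<or> int p dvd v + w" for v
    proof -
      have "[v\<^sup>2 = r] (mod int p) \<longleftrightarrow> [v\<^sup>2 = w\<^sup>2] (mod int p)" by (rule cong_replace[OF 3(2)])
      also have "\<dots> \<longleftrightarrow> int p dvd (v - w) * (v + w)"
        by (simp add: cong_iff_dvd_diff power2_eq_square algebra_simps)
      finally show ?thesis by (simp add: prime_int_dvd_mult)
    qed
    have u: "int p dvd v - u \<longleftrightarrow> v = u mod int p" if "v \<in> {0..<int p}" for v u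
    proof -
      have "v mod int p = v" using that by simp
      then show ?thesis by (metis mod_eq_dvd_iff)
    qed
    have "v \<in> ?R \<longleftrightarrow> v = ?w \<or> v = ?v" for v
    proof (cases "v \<in> {0..<int p}")
      case True
      then show ?thesis using sq[of v] u[OF True, of w] u[OF True, of "- w"] by simp
    next
      case False
      then have "v \<noteq> ?w" "v \<noteq> ?v" "v \<notin> ?R" using p0 by auto
      then show ?thesis by blast
    qed
    then have R: "?R = {?w, ?v}" by (simp add: set_eq_iff)
    have ne: "?w \<noteq> ?v"
    proof
      assume "?w = ?v"
      then have "int p dvd 2 * w" by (simp add: mod_eq_dvd_iff)
      then show False using nw odd_prime_not_dvd_2 prime_int_dvd_mult by blast
    qed
    have "\<not> nonresidue p r" using 3 by (auto simp: nonresidue_def)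
    moreover have "card ?R = 2" unfolding card_2_iff using R ne by metis
    ultimately show ?thesis using 3(1) by (simp only: if_False)
  qed
qed

text \<open>Squaring has one preimage over 0 and two over every other square, so p = 1 + 2 * (number
  of nonzero squares).\<close>

lemma nonresidue_count: "2 * card {r \<in> {0..<int p}. nonresidue p r} = p - 1"
proof -
  let ?F = "{0..<int p}"
  have "card ?F = (\<Sum>r\<in>?F. card {w \<in> ?F. w\<^sup>2 mod int p = r})"
  proof -
    have "(\<lambda>w. w\<^sup>2 mod int p) ` ?F \<subseteq> ?F" using p by auto
    from sum.group[OF _ _ this, of "\<lambda>_. 1::nat"] show ?thesis by simp
  qed
  also have "\<dots> = (\<Sum>r\<in>?F. card {w \<in> ?F. [w\<^sup>2 = r] (mod int p)})"
    by (intro sum.cong refl arg_cong[of _ _ card]) (auto simp: cong_def)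
  also have "\<dots> = (\<Sum>r\<in>?F. if [r = 0] (mod int p) then 1 else if nonresidue p r then 0 else 2)"
    by (simp only: roots_card)
  also have "\<dots> = 1 + (\<Sum>r\<in>?F - {0}. if [r = 0] (mod int p) then 1 else if nonresidue p r then 0 else 2)"
    using p by (subst sum.remove[of _ 0]) auto
  also have "(\<Sum>r\<in>?F - {0}. if [r = 0] (mod int p) then 1 else if nonresidue p r then 0 else 2)
      = (\<Sum>r\<in>?F - {0}. if nonresidue p r then 0 else 2 :: nat)"
  proof (rule sum.cong[OF refl])
    fix r assume "r \<in> ?F - {0}"
    then have "\<not> [r = 0] (mod int p)" by (auto simp: cong_0_iff dest: zdvd_imp_le)
    then show "(if [r = 0] (mod int p) then 1 else if nonresidue p r then 0 else 2) = (if nonresidue p r then 0 else 2 :: nat)" by simp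
  qed
  also have "\<dots> = 2 * card {r \<in> ?F - {0}. \<not> nonresidue p r}"
    by (simp add: sum.If_cases Int_def)
  finally have 1: "p = 1 + 2 * card {r \<in> ?F - {0}. \<not> nonresidue p r}" by simp
  have "?F - {0} = {r \<in> ?F. nonresidue p r} \<union> {r \<in> ?F - {0}. \<not> nonresidue p r}"
    using nonresidue_not_0[of p 0] by auto
  then have "card (?F - {0}) = card ({r \<in> ?F. nonresidue p r} \<union> {r \<in> ?F - {0}. \<not> nonresidue p r})" by (rule arg_cong)
  also have "\<dots> = card {r \<in> ?F. nonresidue p r} + card {r \<in> ?F - {0}. \<not> nonresidue p r}"
    by (rule card_Un_disjoint) (auto intro: finite_subset[of _ ?F])
  finally have "p - 1 = card {r \<in> ?F. nonresidue p r} + card {r \<in> ?F - {0}. \<not> nonresidue p r}" using p by simp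
  then show ?thesis using 1 by linarith
qed

end

lemma nonresidue_mod: "nonresidue p (z mod int p) \<longleftrightarrow> nonresidue p z"
  by (rule nonresidue_cong) simp

lemma sum_rotate: "(\<Sum>a\<in>A. \<Sum>b\<in>B. \<Sum>c\<in>C. h a b c) = (\<Sum>b\<in>B. \<Sum>c\<in>C. \<Sum>a\<in>A. h a b c)"
  by (rule trans[OF sum.swap]) (rule sum.cong[OF refl sum.swap])

section \<open>Parsons' graph over a prime congruent to 1 modulo 4\<close>

context
  fixes p :: nat
  assumes p: "prime p" "p mod 4 = 1"
begin

lemma p_gt_2: "2 < p"
  using p prime_ge_2_nat[of p] by (cases "p = 2") auto

lemma half_even: "even ((p - 1) div 2)"
  using p(2) p_gt_2 by presburger

lemma sqrt_minus_1:
  obtains i :: int where "[i\<^sup>2 = -1] (mod int p)"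
proof -
  have "[Legendre (-1) (int p) = (-1) ^ ((p - 1) div 2)] (mod int p)"
    by (rule euler_criterion[OF p(1) p_gt_2])
  then have "[Legendre (-1) (int p) = 1] (mod int p)" using half_even by simp
  moreover have "\<not> [0 = 1] (mod int p)" "\<not> [-1 = 1] (mod int p)"
    using odd_prime_not_dvd_2[OF p(1) p_gt_2] p_gt_2 by (auto simp: cong_iff_dvd_diff)
  ultimately have "QuadRes (int p) (-1)" unfolding Legendre_def by (auto split: if_splits)
  then show ?thesis using that by (auto simp: QuadRes_def)
qed

lemma nonresidue_power:
  assumes "nonresidue p r"
  shows "[r ^ ((p - 1) div 2) = -1] (mod int p)"
proof -
  have "Legendre r (int p) = -1"
    using assms nonresidue_not_0[OF assms] by (auto simp: Legendre_def QuadRes_def nonresidue_def)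
  then show ?thesis using euler_criterion[OF p(1) p_gt_2, of r] by (simp add: cong_sym)
qed

text \<open>By Euler's criterion the product has symbol (-1)^3, while a square has symbol 0 or
  1.\<close>

lemma nonresidue_mult3:
  assumes "nonresidue p a" "nonresidue p b" "nonresidue p c"
  shows "\<not> [a * b * c = w\<^sup>2] (mod int p)"
proof
  let ?k = "(p - 1) div 2"
  assume "[a * b * c = w\<^sup>2] (mod int p)"
  then have "[(a * b * c) ^ ?k = (w\<^sup>2) ^ ?k] (mod int p)" by (rule cong_pow)
  moreover have "[(a * b * c) ^ ?k = (-1) * (-1) * (-1)] (mod int p)"
    unfolding power_mult_distrib by (intro cong_mult nonresidue_power assms)
  ultimately have *: "[(w\<^sup>2) ^ ?k = -1] (mod int p)" by (simp add: cong_def)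
  have "[Legendre (w\<^sup>2) (int p) = -1] (mod int p)"
    using cong_trans[OF euler_criterion[OF p(1) p_gt_2] *] .
  moreover have "Legendre (w\<^sup>2) (int p) \<in> {0, 1}"
  proof -
    have "QuadRes (int p) (w\<^sup>2)" unfolding QuadRes_def by (rule exI) (rule cong_refl)
    then show ?thesis by (simp add: Legendre_def)
  qed
  ultimately show False
    using odd_prime_not_dvd_2[OF p(1) p_gt_2] p_gt_2 by (auto simp: cong_iff_dvd_diff)
qed


lemma nonresidue_not_minus_square: "nonresidue p r \<Longrightarrow> \<not> [r + w\<^sup>2 = 0] (mod int p)"
proof
  assume r: "nonresidue p r" "[r + w\<^sup>2 = 0] (mod int p)"
  obtain i :: int where "[i\<^sup>2 = -1] (mod int p)" by (rule sqrt_minus_1)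
  then have "[i\<^sup>2 * w\<^sup>2 + (r + w\<^sup>2) = (-1) * w\<^sup>2 + (r + w\<^sup>2)] (mod int p)"
    by (intro cong_add cong_mult cong_refl)
  moreover have "[i\<^sup>2 * w\<^sup>2 + (r + w\<^sup>2) = i\<^sup>2 * w\<^sup>2 + 0] (mod int p)"
    using r(2) by (intro cong_add cong_refl)
  ultimately have "[(i * w)\<^sup>2 = r] (mod int p)"
    by (simp add: cong_def power_mult_distrib)
  then show False using r(1) by (auto simp: nonresidue_def)
qed

text \<open>The points with \<open>2 * z = y\<^sup>2\<close> are those adjacent to themselves and
  form a parabola. The vertices are one of the two classes of points off it, so there are no
  loops.\<close>

definition parsons_verts :: "(int \<times> int) set" where
  "parsons_verts = {(y, z). y \<in> {0..<int p} \<and> z \<in> {0..<int p} \<and> nonresidue p (2 * z - y\<^sup>2)}"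

text \<open>Polarity with respect to that parabola: \<open>u\<close> lies on the polar line of
  \<open>v\<close>.\<close>

definition parsons_adj :: "int \<times> int \<Rightarrow> int \<times> int \<Rightarrow> bool" where
  "parsons_adj u v \<longleftrightarrow> [snd u + snd v = fst u * fst v] (mod int p)"

lemma parsons_adj_sym: "parsons_adj u v \<longleftrightarrow> parsons_adj v u"
  by (simp add: parsons_adj_def add.commute mult.commute)

lemma finite_parsons_verts: "finite parsons_verts"
  by (rule finite_subset[of _ "{0..<int p} \<times> {0..<int p}"]) (auto simp: parsons_verts_def)

text \<open>In a triangle the value \<open>2 * z - y\<^sup>2\<close> at a vertex is minus the
  product of the differences of its first coordinate to the other two. The three values multiply to
  a square, which three nonresidues cannot do.\<close>

lemma parsons_triangle_free:
  assumes "u \<in> parsons_verts" "v \<in> parsons_verts" "w \<in> parsons_verts"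
    and "parsons_adj u v" "parsons_adj v w" "parsons_adj w u"
  shows False
proof -
  obtain y1 z1 y2 z2 y3 z3 where uvw: "u = (y1, z1)" "v = (y2, z2)" "w = (y3, z3)" by fastforce
  have Q: "[2 * c - s\<^sup>2 = - ((s - t) * (s - r))] (mod int p)"
    if "[c + d = s * t] (mod int p)" "[d + e = t * r] (mod int p)" "[e + c = r * s] (mod int p)" for c d e r s t
  proof -
    have "[(c + d) + (e + c) - (d + e) - s\<^sup>2 = s * t + r * s - t * r - s\<^sup>2] (mod int p)"
      by (intro cong_add cong_diff cong_refl that)
    then show ?thesis by (simp add: algebra_simps power2_eq_square)
  qed
  have a: "[z1 + z2 = y1 * y2] (mod int p)" "[z2 + z3 = y2 * y3] (mod int p)" "[z3 + z1 = y3 * y1] (mod int p)"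
    using assms by (simp_all add: parsons_adj_def uvw)
  have "[(2 * z1 - y1\<^sup>2) * (2 * z2 - y2\<^sup>2) * (2 * z3 - y3\<^sup>2) =
      - ((y1 - y2) * (y1 - y3)) * - ((y2 - y3) * (y2 - y1)) * - ((y3 - y1) * (y3 - y2))] (mod int p)"
    by (intro cong_mult Q[OF a(1,2,3)] Q[OF a(2,3,1)] Q[OF a(3,1,2)])
  also have "- ((y1 - y2) * (y1 - y3)) * - ((y2 - y3) * (y2 - y1)) * - ((y3 - y1) * (y3 - y2))
      = ((y1 - y2) * (y1 - y3) * (y2 - y3))\<^sup>2"
    by (simp add: algebra_simps power2_eq_square)
  finally show False
    using nonresidue_mult3 assms(1-3) unfolding parsons_verts_def uvw by blast
qed

lemma card_eq_sum_fibres: "finite A \<Longrightarrow> finite B \<Longrightarrow> card {(y, z). y \<in> A \<and> z \<in> B \<and> P y z} = (\<Sum>y\<in>A. card {z \<in> B. P y z})"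
proof -
  assume fin: "finite A" "finite B"
  have "{(y, z). y \<in> A \<and> z \<in> B \<and> P y z} = (SIGMA y:A. {z \<in> B. P y z})" by auto
  then show ?thesis using fin by simp
qed

lemma card_parsons_verts: "2 * card parsons_verts = p * (p - 1)"
proof -
  let ?F = "{0..<int p}"
  have "card parsons_verts = (\<Sum>y\<in>?F. card {z \<in> ?F. nonresidue p (2 * z - y\<^sup>2)})"
    unfolding parsons_verts_def by (rule card_eq_sum_fibres) auto
  also have "\<dots> = (\<Sum>y\<in>?F. card {z \<in> ?F. nonresidue p z})"
  proof (rule sum.cong[OF refl])
    fix y assume "y \<in> ?F"
    let ?h = "\<lambda>z. if nonresidue p z then 1 else 0 :: nat"
    have "(\<Sum>z\<in>?F. ?h (2 * z + (- y\<^sup>2))) = (\<Sum>z\<in>?F. ?h z)"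
      by (rule sum_periodic_affine[OF p(1) p_gt_2])
        (simp_all add: odd_prime_not_dvd_2[OF p(1) p_gt_2] nonresidue_mod)
    then show "card {z \<in> ?F. nonresidue p (2 * z - y\<^sup>2)} = card {z \<in> ?F. nonresidue p z}"
      by (simp add: sum.If_cases Int_def)
  qed
  also have "\<dots> = p * card {z \<in> ?F. nonresidue p z}" by simp
  finally show ?thesis using nonresidue_count[OF p(1) p_gt_2] by (simp add: mult.left_commute)
qed

text \<open>
  With \<open>i\<^sup>2 = -1\<close> and \<open>a = w + i * (Y - y)\<close> the equation becomes \<open>a\<^sup>2 - 2 * i * a * (Y - y) = N\<close>,
  which is linear in \<open>Y\<close> for each \<open>a \<noteq> 0\<close>.
\<close>

lemma sum_squares_count:
  assumes N: "\<not> [N = 0] (mod int p)"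
  shows "(\<Sum>Y\<in>{0..<int p}. card {w \<in> {0..<int p}. [w\<^sup>2 = N - (Y - y)\<^sup>2] (mod int p)}) = p - 1"
proof -
  let ?F = "{0..<int p}"
  have p2: "2 < p" "\<not> int p dvd 2" using p_gt_2 odd_prime_not_dvd_2[OF p(1) p_gt_2] by auto
  obtain i :: int where i: "[i\<^sup>2 = -1] (mod int p)" by (rule sqrt_minus_1)
  have i0: "\<not> int p dvd i"
  proof
    assume "int p dvd i"
    then have "int p dvd i\<^sup>2" by (simp add: power2_eq_square)
    then have "int p dvd -1" using i cong_dvd_iff by blast
    then show False using p2 by simp
  qed
  let ?q = "\<lambda>a Y. a\<^sup>2 - 2 * i * a * (Y - y) - N"
  have "(\<Sum>Y\<in>?F. card {w \<in> ?F. [w\<^sup>2 = N - (Y - y)\<^sup>2] (mod int p)})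
      = (\<Sum>Y\<in>?F. \<Sum>a\<in>?F. if int p dvd ?q a Y then 1 else 0)"
  proof (rule sum.cong[OF refl])
    fix Y assume "Y \<in> ?F"
    let ?h = "\<lambda>a. if int p dvd ?q a Y then 1 else 0 :: nat"
    have per: "?h (a mod int p) = ?h a" for a
    proof -
      have "[?q (a mod int p) Y = ?q a Y] (mod int p)"
        by (intro cong_diff cong_mult cong_pow cong_refl) (simp_all add: cong_def)
      then show ?thesis by (simp add: cong_dvd_iff)
    qed
    \<comment> \<open>After the substitution the two sides differ by
      \<open>(i\<^sup>2 + 1) * (Y - y)\<^sup>2\<close>, a multiple of \<open>p\<close>.\<close>
    have w: "[w\<^sup>2 = N - (Y - y)\<^sup>2] (mod int p) \<longleftrightarrow> int p dvd ?q (1 * w + i * (Y - y)) Y" for w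
    proof -
      have "[w\<^sup>2 - (N - (Y - y)\<^sup>2) = ?q (1 * w + i * (Y - y)) Y + (i\<^sup>2 + 1) * (Y - y)\<^sup>2] (mod int p)"
        by (simp add: algebra_simps power2_eq_square)
      moreover have "[?q (1 * w + i * (Y - y)) Y + (i\<^sup>2 + 1) * (Y - y)\<^sup>2 = ?q (1 * w + i * (Y - y)) Y + 0] (mod int p)"
        using i by (intro cong_add cong_refl) (simp add: cong_0_iff cong_iff_dvd_diff)
      ultimately have "[w\<^sup>2 - (N - (Y - y)\<^sup>2) = ?q (1 * w + i * (Y - y)) Y] (mod int p)"
        using cong_trans by fastforce
      then show ?thesis by (metis cong_dvd_iff cong_iff_dvd_diff)
    qed
    have "card {w \<in> ?F. [w\<^sup>2 = N - (Y - y)\<^sup>2] (mod int p)} = (\<Sum>w\<in>?F. ?h (1 * w + i * (Y - y)))"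
      unfolding w by (simp add: sum.If_cases Int_def)
    also have "\<dots> = (\<Sum>a\<in>?F. ?h a)"
      by (rule sum_periodic_affine[where h = ?h, OF p(1) p2(1)]) (use p2 in \<open>auto simp only: per\<close>)
    finally show "card {w \<in> ?F. [w\<^sup>2 = N - (Y - y)\<^sup>2] (mod int p)} = (\<Sum>a\<in>?F. ?h a)" .
  qed
  also have "\<dots> = (\<Sum>a\<in>?F. \<Sum>Y\<in>?F. if int p dvd ?q a Y then 1 else 0)" by (rule sum.swap)
  \<comment> \<open>For \<open>a = 0\<close> the equation would read N = 0; every other
    \<open>a\<close> has exactly one solution \<open>Y\<close>.\<close>
  also have "\<dots> = (\<Sum>a\<in>?F. if a = 0 then 0 else 1)"
  proof (rule sum.cong[OF refl])
    fix a assume a: "a \<in> ?F"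
    show "(\<Sum>Y\<in>?F. if int p dvd ?q a Y then 1 else 0) = (if a = 0 then 0 else 1 :: nat)"
    proof (cases "a = 0")
      case True
      then show ?thesis using N by (simp add: cong_0_iff)
    next
      case False
      then have "\<not> int p dvd a" using a by (auto dest: zdvd_imp_le)
      then have na: "\<not> int p dvd - (2 * i * a)" using i0 p2 by (simp add: prime_int_dvd_mult[OF p(1) p2(1)])
      let ?h = "\<lambda>u. if int p dvd u then 1 else 0 :: nat"
      have "(\<Sum>Y\<in>?F. ?h (?q a Y)) = (\<Sum>Y\<in>?F. ?h (- (2 * i * a) * Y + (a\<^sup>2 + 2 * i * a * y - N)))"
        by (simp add: algebra_simps)
      also have "\<dots> = (\<Sum>Y\<in>?F. ?h Y)"
        by (rule sum_periodic_affine[OF p(1) p2(1) _ na]) (simp add: dvd_mod_iff)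
      also have "\<dots> = (\<Sum>Y\<in>?F. if Y = 0 then 1 else 0)"
        by (rule sum.cong) (auto dest: zdvd_imp_le)
      also have "\<dots> = 1" using p2 by simp
      finally show ?thesis using False by simp
    qed
  qed
  also have "\<dots> = card (?F - {0})"
    by (simp add: sum.If_cases Int_def set_diff_eq)
  also have "\<dots> = p - 1" using p2 by simp
  finally show ?thesis .
qed


lemma card_parsons_neighbours:
  "card {v \<in> parsons_verts. parsons_adj u v} = card {Y \<in> {0..<int p}. nonresidue p (2 * (fst u * Y - snd u) - Y\<^sup>2)}"
    (is "_ = card ?R")
proof -
  let ?f = "\<lambda>Y. (Y, (fst u * Y - snd u) mod int p)"
  have nr: "nonresidue p (2 * (a mod int p) - b) \<longleftrightarrow> nonresidue p (2 * a - b)" for a b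
    by (rule nonresidue_cong) (intro cong_diff cong_mult cong_refl cong_mod_left, simp)
  have "{v \<in> parsons_verts. parsons_adj u v} = ?f ` ?R"
  proof (rule subset_antisym; rule subsetI)
    fix v assume v: "v \<in> {v \<in> parsons_verts. parsons_adj u v}"
    obtain Y Z where YZ: "v = (Y, Z)" by fastforce
    have "[snd u + Z - snd u = fst u * Y - snd u] (mod int p)"
      using v by (intro cong_diff cong_refl) (simp add: YZ parsons_adj_def)
    then have Z: "Z = (fst u * Y - snd u) mod int p"
      using v by (simp add: YZ parsons_verts_def cong_def)
    then have "Y \<in> ?R" using v nr by (simp add: YZ parsons_verts_def)
    then show "v \<in> ?f ` ?R" using Z by (simp add: YZ)
  next
    fix v assume "v \<in> ?f ` ?R"
    then obtain Y where Y: "Y \<in> ?R" "v = ?f Y" by blast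
    have "parsons_adj u v"
      unfolding parsons_adj_def Y(2) by (simp add: cong_def mod_simps)
    then show "v \<in> {v \<in> parsons_verts. parsons_adj u v}"
      using Y p_gt_2 by (simp add: parsons_verts_def nr)
  qed
  moreover have "inj_on ?f ?R" by (rule inj_onI) simp
  ultimately show ?thesis by (simp add: card_image)
qed

text \<open>A neighbour is given by a \<open>Y\<close> for which \<open>?r Y\<close> is a
  nonresidue. As -1 is a square, \<open>?r\<close> never vanishes, so the p - 1 solutions of
  \<open>w\<^sup>2 = ?r Y\<close> come in pairs: (p - 1) / 2 values of \<open>Y\<close> give squares
  and the remaining (p + 1) / 2 give neighbours.\<close>

lemma parsons_degree:
  assumes u: "u \<in> parsons_verts"
  shows "2 * card {v \<in> parsons_verts. parsons_adj u v} = p + 1"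
proof -
  let ?F = "{0..<int p}"
  obtain y z where yz: "u = (y, z)" by fastforce
  let ?r = "\<lambda>Y. 2 * (y * Y - z) - Y\<^sup>2"
  have Q: "nonresidue p (2 * z - y\<^sup>2)" using u by (simp add: yz parsons_verts_def)
  have r: "?r Y = - (2 * z - y\<^sup>2) - (Y - y)\<^sup>2" for Y by (simp add: algebra_simps power2_eq_square)
  have r0: "\<not> [?r Y = 0] (mod int p)" for Y
    using nonresidue_not_minus_square[OF Q, of "Y - y"] unfolding r
    by (metis add.commute cong_0_iff dvd_minus_iff minus_add_distrib uminus_add_conv_diff)
  have N: "\<not> [- (2 * z - y\<^sup>2) = 0] (mod int p)"
    using nonresidue_not_0[OF Q] unfolding cong_0_iff dvd_minus_iff .
  have "p - 1 = (\<Sum>Y\<in>?F. card {w \<in> ?F. [w\<^sup>2 = ?r Y] (mod int p)})"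
    unfolding r using sum_squares_count[OF N, of y] by simp
  also have "\<dots> = (\<Sum>Y\<in>?F. if nonresidue p (?r Y) then 0 else 2)"
    by (simp only: roots_card[OF p(1) p_gt_2] r0 if_False)
  also have "\<dots> = 2 * card {Y \<in> ?F. \<not> nonresidue p (?r Y)}"
    by (simp add: sum.If_cases Int_def)
  finally have 1: "p - 1 = 2 * card {Y \<in> ?F. \<not> nonresidue p (?r Y)}" .
  have "card ?F = card ({Y \<in> ?F. nonresidue p (?r Y)} \<union> {Y \<in> ?F. \<not> nonresidue p (?r Y)})"
    by (rule arg_cong[of _ _ card]) blast
  also have "\<dots> = card {Y \<in> ?F. nonresidue p (?r Y)} + card {Y \<in> ?F. \<not> nonresidue p (?r Y)}"
    by (rule card_Un_disjoint) (auto intro: finite_subset[of _ ?F])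
  finally have "p = card {Y \<in> ?F. nonresidue p (?r Y)} + card {Y \<in> ?F. \<not> nonresidue p (?r Y)}" by simp
  then show ?thesis using 1 p_gt_2 unfolding card_parsons_neighbours yz by simp
qed

text \<open>
  The pair \<open>(Y, Z)\<close> stands for the line \<open>z = y * Y - Z\<close>.  Two points with different first coordinates
  lie on exactly one such line, so the off-diagonal terms of the square only see the column sums of \<open>f\<close>.
\<close>

lemma codegree_form_le:
  fixes f :: "int \<Rightarrow> int \<Rightarrow> real"
  assumes f: "\<And>y z. f y (z mod int p) = f y z" and 0: "(\<Sum>y\<in>{0..<int p}. \<Sum>z\<in>{0..<int p}. f y z) = 0"
  shows "(\<Sum>Y\<in>{0..<int p}. \<Sum>Z\<in>{0..<int p}. (\<Sum>y\<in>{0..<int p}. f y (y * Y - Z))\<^sup>2)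
    \<le> p * (\<Sum>y\<in>{0..<int p}. \<Sum>z\<in>{0..<int p}. (f y z)\<^sup>2)"
proof -
  let ?F = "{0..<int p}"
  define s where "s y = (\<Sum>z\<in>?F. f y z)" for y
  define q where "q y = (\<Sum>z\<in>?F. (f y z)\<^sup>2)" for y
  have p2: "2 < p" by (rule p_gt_2)
  have m1: "\<not> int p dvd -1" using p2 by simp
  have fm: "f y (a mod int p + b) = f y (a + b)" "f y (b + a mod int p) = f y (b + a)" for y a b
    using f[of y "a + b"] f[of y "a mod int p + b"] f[of y "b + a"] f[of y "b + a mod int p"]
    by (simp_all add: mod_simps)
  \<comment> \<open>After shifting \<open>Z\<close>, the second argument is
    \<open>u + (y' - y) * Y\<close>: it is constantly \<open>u\<close> on the diagonal, and off it
    runs through all residues as \<open>Y\<close> does.\<close>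
  have S: "(\<Sum>Y\<in>?F. \<Sum>Z\<in>?F. f y (y * Y - Z) * f y' (y' * Y - Z)) = (if y = y' then p * q y else s y * s y')"
    if y: "y \<in> ?F" "y' \<in> ?F" for y y'
  proof -
    have "(\<Sum>Y\<in>?F. \<Sum>Z\<in>?F. f y (y * Y - Z) * f y' (y' * Y - Z)) = (\<Sum>Y\<in>?F. \<Sum>u\<in>?F. f y u * f y' (u + (y' - y) * Y))"
    proof (rule sum.cong[OF refl])
      fix Y assume "Y \<in> ?F"
      let ?h = "\<lambda>u. f y u * f y' (u + (y' - y) * Y)"
      have "(\<Sum>Z\<in>?F. f y (y * Y - Z) * f y' (y' * Y - Z)) = (\<Sum>Z\<in>?F. ?h (-1 * Z + y * Y))"
        by (intro sum.cong refl) (simp add: algebra_simps)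
      also have "\<dots> = (\<Sum>u\<in>?F. ?h u)"
        by (rule sum_periodic_affine[where h = ?h, OF p(1) p2 _ m1]) (simp add: f fm)
      finally show "(\<Sum>Z\<in>?F. f y (y * Y - Z) * f y' (y' * Y - Z)) = (\<Sum>u\<in>?F. ?h u)" .
    qed
    also have "\<dots> = (\<Sum>u\<in>?F. f y u * (\<Sum>Y\<in>?F. f y' (u + (y' - y) * Y)))"
      unfolding sum_distrib_left by (rule sum.swap)
    also have "\<dots> = (if y = y' then p * q y else s y * s y')"
    proof (cases "y = y'")
      case True
      then show ?thesis by (simp add: q_def sum_distrib_left power2_eq_square mult_ac)
    next
      case False
      have d: "\<not> int p dvd y' - y"
      proof
        assume "int p dvd y' - y"
        then have "y' mod int p = y mod int p" by (simp add: mod_eq_dvd_iff)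
        then show False using False y by simp
      qed
      have "(\<Sum>Y\<in>?F. f y' (u + (y' - y) * Y)) = s y'" for u
        unfolding s_def using sum_periodic_affine[OF p(1) p2 _ d, of "f y'" u] f by (simp add: add.commute)
      then show ?thesis using False by (simp add: s_def sum_distrib_right)
    qed
    finally show ?thesis .
  qed
  have "(\<Sum>Y\<in>?F. \<Sum>Z\<in>?F. (\<Sum>y\<in>?F. f y (y * Y - Z))\<^sup>2)
      = (\<Sum>Y\<in>?F. \<Sum>Z\<in>?F. \<Sum>y\<in>?F. \<Sum>y'\<in>?F. f y (y * Y - Z) * f y' (y' * Y - Z))"
    unfolding power2_eq_square sum_product ..
  also have "\<dots> = (\<Sum>Y\<in>?F. \<Sum>y\<in>?F. \<Sum>y'\<in>?F. \<Sum>Z\<in>?F. f y (y * Y - Z) * f y' (y' * Y - Z))"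
    by (rule sum.cong[OF refl]) (rule sum_rotate)
  also have "\<dots> = (\<Sum>y\<in>?F. \<Sum>y'\<in>?F. \<Sum>Y\<in>?F. \<Sum>Z\<in>?F. f y (y * Y - Z) * f y' (y' * Y - Z))"
    by (rule sum_rotate)
  also have "\<dots> = (\<Sum>y\<in>?F. \<Sum>y'\<in>?F. if y = y' then p * q y else s y * s y')"
    by (intro sum.cong refl S)
  \<comment> \<open>The missing squares \<open>s y * s y\<close> on the diagonal are added, so that
    the off-diagonal part becomes the square of the total sum of \<open>f\<close>, which is
    0.\<close>
  also have "\<dots> \<le> (\<Sum>y\<in>?F. \<Sum>y'\<in>?F. (if y = y' then p * q y else 0) + s y * s y')"
    by (intro sum_mono) simp
  also have "\<dots> = p * (\<Sum>y\<in>?F. q y) + (\<Sum>y\<in>?F. s y)\<^sup>2"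
  proof -
    have "(\<Sum>y\<in>?F. \<Sum>y'\<in>?F. s y * s y') = (\<Sum>y\<in>?F. s y)\<^sup>2"
      unfolding power2_eq_square sum_product ..
    then show ?thesis by (simp only: sum.distrib sum_distrib_left) simp
  qed
  also have "(\<Sum>y\<in>?F. s y) = 0" using 0 by (simp add: s_def)
  finally show ?thesis by (simp add: q_def)
qed


text \<open>
  The expander mixing lemma, from the bound \<open>sqrt p\<close> for the nontrivial eigenvalues.
\<close>

lemma parsons_expander:
  assumes AB: "A \<subseteq> parsons_verts" "B \<subseteq> parsons_verts"
    and card: "card parsons_verts \<le> x * card A" "card parsons_verts \<le> x * card B" and x: "0 < x"
    and big: "4 * (x - 1)\<^sup>2 * p < (p + 1)\<^sup>2"
  shows "\<exists>a\<in>A. \<exists>b\<in>B. parsons_adj a b"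
proof (rule ccontr)
  assume "\<not> ?thesis"
  then have no: "\<not> parsons_adj a b" if "a \<in> A" "b \<in> B" for a b using that by blast
  let ?F = "{0..<int p}" and ?V = parsons_verts
  let ?n = "real (card ?V)"
  have p2: "2 < p" by (rule p_gt_2)
  have fin: "finite ?V" "finite A" "finite B"
    using finite_parsons_verts AB finite_subset by blast+
  have sub: "?V \<subseteq> ?F \<times> ?F" by (auto simp: parsons_verts_def)
  have n0: "0 < ?n" using card_parsons_verts p2 by (metis bot_nat_0.not_eq_extremum mult_eq_0_iff not_less_zero of_nat_0_less_iff p2 zero_less_diff less_trans one_less_numeral_iff semiring_norm(76))
  define \<alpha> where "\<alpha> = card A / ?n"
  define \<beta> where "\<beta> = card B / ?n"
  define d where "d = real (p + 1) / 2"
  have \<alpha>\<beta>: "1 / x \<le> \<alpha>" "1 / x \<le> \<beta>" "\<alpha> \<le> 1" "\<beta> \<le> 1" "card A = \<alpha> * ?n" "card B = \<beta> * ?n"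
  proof -
    show "1 / x \<le> \<alpha>" "1 / x \<le> \<beta>"
      using card n0 x unfolding \<alpha>_def \<beta>_def by (simp_all add: field_simps flip: of_nat_mult)
    show "\<alpha> \<le> 1" "\<beta> \<le> 1"
      using card_mono[OF fin(1)] AB n0 unfolding \<alpha>_def \<beta>_def by simp_all
  qed (use n0 in \<open>simp_all add: \<alpha>_def \<beta>_def\<close>)
  let ?ind = "\<lambda>S v. if v \<in> S then 1 else 0 :: real"
  \<comment> \<open>The indicator of \<open>A\<close> minus its mean on the vertex set, made
    periodic in \<open>z\<close> and extended by 0 to the rest of the plane.\<close>
  define f where "f y z = ?ind A (y, z mod int p) - \<alpha> * ?ind ?V (y, z mod int p)" for y z
  define h where "h v = ?ind B v - \<beta> * ?ind ?V v" for v
  \<comment> \<open>The adjacency operator applied to \<open>f\<close>, evaluated on the whole plane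
    and not just on the vertices.\<close>
  define t where "t v = (\<Sum>y\<in>?F. f y (y * fst v - snd v))" for v
  have ind: "(\<Sum>v\<in>W. ?ind S v) = card S" if "S \<subseteq> W" "finite W" for S W :: "(int \<times> int) set"
  proof -
    have "W \<inter> S = S" using that by blast
    then show ?thesis using that by (simp add: sum.If_cases Int_def)
  qed
  have line: "(\<Sum>y\<in>?F. ?ind S (y, (y * fst v - snd v) mod int p)) = card {u \<in> S. parsons_adj u v}"
    if S: "S \<subseteq> ?V" for S v
  proof -
    let ?g = "\<lambda>y. (y, (y * fst v - snd v) mod int p)"
    have "{u \<in> S. parsons_adj u v} = ?g ` {y \<in> ?F. ?g y \<in> S}"
    proof (rule subset_antisym; rule subsetI)
      fix u assume u: "u \<in> {u \<in> S. parsons_adj u v}"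
      then have "u \<in> ?F \<times> ?F" using S sub by blast
      moreover have "[fst u * fst v - snd v = snd u + snd v - snd v] (mod int p)"
        using u by (intro cong_diff cong_refl) (simp add: parsons_adj_def cong_sym_eq)
      ultimately have "?g (fst u) = u"
        by (auto simp: cong_def prod_eq_iff)
      then show "u \<in> ?g ` {y \<in> ?F. ?g y \<in> S}" using u \<open>u \<in> ?F \<times> ?F\<close> by (auto intro!: image_eqI[of _ _ "fst u"])
    next
      fix u assume "u \<in> ?g ` {y \<in> ?F. ?g y \<in> S}"
      then obtain y where y: "?g y \<in> S" "u = ?g y" by blast
      have "parsons_adj u v" unfolding y(2) parsons_adj_def by (simp add: cong_def mod_simps)
      then show "u \<in> {u \<in> S. parsons_adj u v}" using y by simp
    qed
    moreover have "inj_on ?g {y \<in> ?F. ?g y \<in> S}" by (rule inj_onI) simp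
    ultimately have "card {u \<in> S. parsons_adj u v} = card {y \<in> ?F. ?g y \<in> S}" by (simp add: card_image)
    then show ?thesis by (simp add: sum.If_cases Int_def)
  qed
  have deg: "real (card {u \<in> ?V. parsons_adj u v}) = d" if "v \<in> ?V" for v
    using parsons_degree[OF that] unfolding d_def by (simp add: parsons_adj_sym[of _ v])
  have t: "t v = card {u \<in> A. parsons_adj u v} - \<alpha> * card {u \<in> ?V. parsons_adj u v}" for v
    unfolding t_def f_def sum_subtractf sum_distrib_left[symmetric] using line[OF AB(1), of v] line[of ?V v] by simp
  have h0: "(\<Sum>v\<in>?V. h v) = 0"
    unfolding h_def sum_subtractf sum_distrib_left[symmetric]
    using ind[OF AB(2)] ind[of ?V ?V] fin \<alpha>\<beta> by simp
  have "(\<Sum>v\<in>?V. h v * t v) = (\<Sum>v\<in>?V. h v * card {u \<in> A. parsons_adj u v}) - \<alpha> * d * (\<Sum>v\<in>?V. h v)"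
    by (simp add: t deg algebra_simps sum_subtractf sum_distrib_left)
  also have "\<dots> = (\<Sum>v\<in>?V. - \<beta> * card {u \<in> A. parsons_adj u v})"
  proof -
    have "h v * card {u \<in> A. parsons_adj u v} = - \<beta> * card {u \<in> A. parsons_adj u v}" if "v \<in> ?V" for v
    proof (cases "v \<in> B")
      case True
      then have e: "{u \<in> A. parsons_adj u v} = {}" using no by blast
      show ?thesis unfolding e by simp
    next
      case False
      then show ?thesis using that by (simp add: h_def)
    qed
    then show ?thesis using h0 by simp
  qed
  also have "\<dots> = - \<beta> * (\<Sum>v\<in>?V. \<Sum>u\<in>A. if parsons_adj u v then 1 else 0)"
    using fin by (simp add: sum_distrib_left sum.If_cases Int_def)
  also have "(\<Sum>v\<in>?V. \<Sum>u\<in>A. if parsons_adj u v then 1 else 0) = (\<Sum>u\<in>A. \<Sum>v\<in>?V. if parsons_adj v u then 1 else 0 :: real)"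
    by (subst sum.swap) (simp only: parsons_adj_sym)
  also have "\<dots> = (\<Sum>u\<in>A. card {v \<in> ?V. parsons_adj v u})"
    using fin by (simp add: sum.If_cases Int_def)
  also have "\<dots> = (\<Sum>u\<in>A. d)"
    unfolding of_nat_sum by (rule sum.cong) (use deg AB in auto)
  finally have ht: "(\<Sum>v\<in>?V. h v * t v) = - \<beta> * d * (\<alpha> * ?n)" using \<alpha>\<beta> by simp
  have sq: "(\<Sum>v\<in>W. (?ind S v - c * ?ind ?V v)\<^sup>2) = card S - 2 * c * card S + c\<^sup>2 * ?n"
    if "?V \<subseteq> W" "finite W" "S \<subseteq> ?V" for S W and c :: real
  proof -
    have "(?ind S v - c * ?ind ?V v)\<^sup>2 = ?ind S v - 2 * c * ?ind S v + c\<^sup>2 * ?ind ?V v" for v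
      using that(3) by (auto simp: power2_eq_square algebra_simps)
    moreover have "S \<subseteq> W" using that by blast
    ultimately show ?thesis
      using ind[of S W] ind[of ?V W] that by (simp add: sum.distrib sum_subtractf sum_distrib_left[symmetric])
  qed
  have hh: "(\<Sum>v\<in>?V. (h v)\<^sup>2) = \<beta> * (1 - \<beta>) * ?n"
    unfolding h_def sq[OF order.refl fin(1) AB(2)] \<alpha>\<beta>(6) by (simp add: power2_eq_square algebra_simps)
  \<comment> \<open>Passing to all points of the plane only enlarges the sum and makes the exact
    computation over lines available.\<close>
  have "(\<Sum>v\<in>?V. (t v)\<^sup>2) \<le> (\<Sum>v\<in>?F \<times> ?F. (t v)\<^sup>2)"
    by (rule sum_mono2) (use sub in auto)
  also have "\<dots> = (\<Sum>Y\<in>?F. \<Sum>Z\<in>?F. (\<Sum>y\<in>?F. f y (y * Y - Z))\<^sup>2)"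
    by (simp add: sum.cartesian_product t_def split_def)
  also have "\<dots> \<le> p * (\<Sum>y\<in>?F. \<Sum>z\<in>?F. (f y z)\<^sup>2)"
  proof (rule codegree_form_le)
    show "f y (z mod int p) = f y z" for y z by (simp add: f_def)
    have "(\<Sum>y\<in>?F. \<Sum>z\<in>?F. f y z) = (\<Sum>v\<in>?F \<times> ?F. ?ind A v - \<alpha> * ?ind ?V v)"
      unfolding sum.cartesian_product by (rule sum.cong) (auto simp: f_def)
    also have "\<dots> = 0"
      unfolding sum_subtractf sum_distrib_left[symmetric]
      using ind[of A "?F \<times> ?F"] ind[of ?V "?F \<times> ?F"] sub AB(1) \<alpha>\<beta>(5) by auto
    finally show "(\<Sum>y\<in>?F. \<Sum>z\<in>?F. f y z) = 0" .
  qed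
  also have "(\<Sum>y\<in>?F. \<Sum>z\<in>?F. (f y z)\<^sup>2) = (\<Sum>v\<in>?F \<times> ?F. (?ind A v - \<alpha> * ?ind ?V v)\<^sup>2)"
    unfolding sum.cartesian_product by (rule sum.cong) (auto simp: f_def)
  also have "\<dots> = \<alpha> * (1 - \<alpha>) * ?n"
    using sq[OF sub _ AB(1), of \<alpha>] unfolding \<alpha>\<beta>(5) by (simp add: power2_eq_square algebra_simps)
  finally have tt: "(\<Sum>v\<in>?V. (t v)\<^sup>2) \<le> p * (\<alpha> * (1 - \<alpha>) * ?n)" .
  have x1: "0 < 1 / real x" using x by simp
  then have pos: "0 < \<alpha>" "0 < \<beta>" using \<alpha>\<beta> by linarith+
  have "(\<beta> * d * (\<alpha> * ?n))\<^sup>2 \<le> (\<Sum>v\<in>?V. (h v)\<^sup>2) * (\<Sum>v\<in>?V. (t v)\<^sup>2)"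
    using Cauchy_Schwarz_ineq_sum[of h t ?V] unfolding ht by simp
  also have "\<dots> \<le> (\<beta> * (1 - \<beta>) * ?n) * (p * (\<alpha> * (1 - \<alpha>) * ?n))"
    unfolding hh by (intro mult_left_mono tt) (use \<alpha>\<beta> pos in simp)
  finally have "(\<alpha> * \<beta> * ?n * ?n) * (\<alpha> * \<beta> * d\<^sup>2) \<le> (\<alpha> * \<beta> * ?n * ?n) * (p * ((1 - \<alpha>) * (1 - \<beta>)))"
    by (simp add: power2_eq_square algebra_simps)
  then have "\<alpha> * \<beta> * d\<^sup>2 \<le> p * ((1 - \<alpha>) * (1 - \<beta>))"
    using pos n0 by (simp only: mult_le_cancel_left_pos mult_pos_pos)
  \<comment> \<open>The densities enter monotonically, so the worst case is 1 / x for both; it gives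
    d <= sqrt p * (x - 1) with d = (p + 1) / 2, against \<open>big\<close>.\<close>
  also have "\<dots> \<le> p * ((1 - 1 / x) * (1 - 1 / x))"
    using \<alpha>\<beta> pos x by (intro mult_left_mono mult_mono) auto
  finally have "\<alpha> * \<beta> * d\<^sup>2 \<le> p * ((1 - 1 / x) * (1 - 1 / x))" .
  moreover have "(1 / x * (1 / x)) * d\<^sup>2 \<le> \<alpha> * \<beta> * d\<^sup>2"
    using \<alpha>\<beta>(1,2) less_imp_le[OF pos(1)] by (intro mult_right_mono mult_mono) simp_all
  ultimately have "(1 / x * (1 / x)) * d\<^sup>2 \<le> p * ((1 - 1 / x) * (1 - 1 / x))" by linarith
  then have "d\<^sup>2 \<le> p * (real x - 1)\<^sup>2" using x by (simp add: field_simps power2_eq_square)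
  then have "real ((p + 1)\<^sup>2) \<le> real (4 * (x - 1)\<^sup>2 * p)"
    using x by (simp add: d_def power_divide of_nat_diff mult_ac)
  then have "(p + 1)\<^sup>2 \<le> 4 * (x - 1)\<^sup>2 * p" by (simp only: of_nat_le_iff)
  then show False using big by linarith
qed

end

section \<open>Joining the parts along a fixed graph\<close>

text \<open>For symmetric \<open>R\<close>, the direct (tensor) product of \<open>G\<close> with the
  graph of \<open>R\<close> on \<open>n\<close> points; it sits inside the blow-up as soon as
  \<open>n \<le> m\<close>.\<close>

definition fibred_graph :: "'a ugraph \<Rightarrow> nat \<Rightarrow> (nat \<Rightarrow> nat \<Rightarrow> bool) \<Rightarrow> ('a \<times> nat) ugraph" where
  "fibred_graph G n R =
     (verts G \<times> {..<n}, {{(a, i), (b, j)} | a b i j. {a, b} \<in> edges G \<and> i < n \<and> j < n \<and> R i j})"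

lemma fibred_graph_edge_iff:
  assumes "\<And>i j. R i j \<longleftrightarrow> R j i"
  shows "{(a, i), (b, j)} \<in> edges (fibred_graph G n R) \<longleftrightarrow> {a, b} \<in> edges G \<and> i < n \<and> j < n \<and> R i j"
  using assms[of i j] unfolding fibred_graph_def by (auto simp: doubleton_eq_iff insert_commute)

lemma is_subgraph_fibred_graph:
  assumes "simple_graph G" "n \<le> m"
  shows "is_subgraph (fibred_graph G n R) (blow_up G m)"
proof -
  have e: "edges (fibred_graph G n R) \<subseteq> edges (blow_up G n)" "edges (fibred_graph G n R) \<subseteq> edges (blow_up G m)"
    using assms(2) by (fastforce simp: fibred_graph_def blow_up_def)+
  have v: "verts (fibred_graph G n R) = verts (blow_up G n)" by (simp add: fibred_graph_def blow_up_def)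
  have "simple_graph (fibred_graph G n R)"
    using simple_graph_blow_up[OF assms(1), of n] e(1) unfolding simple_graph_def v by blast
  then show ?thesis using e(2) assms(2) by (auto simp: is_subgraph_def v blow_up_def)
qed

lemma ex_large_colour_class:
  assumes "0 < x" "\<And>i. i < n \<Longrightarrow> f i < x"
  shows "\<exists>k<x. n \<le> x * card {i. i < n \<and> f i = k}"
proof (rule ccontr)
  assume "\<not> ?thesis"
  then have less: "x * card {i. i < n \<and> f i = k} < n" if "k < x" for k using that by auto
  have n: "n = (\<Sum>k<x. card {i. i < n \<and> f i = k})"
  proof -
    have "f ` {..<n} \<subseteq> {..<x}" using assms(2) by auto
    then show ?thesis using sum.group[of "{..<n}" "{..<x}" f "\<lambda>_. 1::nat"] by simp
  qed
  have "x * n = x * (\<Sum>k<x. card {i. i < n \<and> f i = k})" by (rule arg_cong[OF n])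
  also have "\<dots> = (\<Sum>k<x. x * card {i. i < n \<and> f i = k})" by (rule sum_distrib_left)
  also have "\<dots> < (\<Sum>k<x. n)"
    by (rule sum_strict_mono) (use less assms(1) in auto)
  finally show False by simp
qed

text \<open>Give each vertex of \<open>G\<close> a colour used on at least \<open>n / x\<close>
  points of its part. \<open>R\<close> joins any two sets of that size, so adjacent vertices get
  different colours and \<open>G\<close> would be \<open>x\<close>-colourable.\<close>

lemma fibred_graph_not_colourable:
  assumes x: "0 < x" and G: "simple_graph G" "\<nexists>c. proper_colouring G x c"
    and sym: "\<And>i j. R i j \<longleftrightarrow> R j i"
    and R: "\<And>A B. A \<subseteq> {..<n} \<Longrightarrow> B \<subseteq> {..<n} \<Longrightarrow> n \<le> x * card A \<Longrightarrow> n \<le> x * card B \<Longrightarrow> \<exists>i\<in>A. \<exists>j\<in>B. R i j"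
  shows "\<nexists>c. proper_colouring (fibred_graph G n R) x c"
proof
  assume "\<exists>c. proper_colouring (fibred_graph G n R) x c"
  then obtain c where c: "proper_colouring (fibred_graph G n R) x c" by blast
  have "\<exists>k<x. n \<le> x * card {i. i < n \<and> c (a, i) = k}" if "a \<in> verts G" for a
    by (rule ex_large_colour_class[OF x]) (use that c in \<open>auto simp: proper_colouring_def fibred_graph_def\<close>)
  then obtain k where k: "\<And>a. a \<in> verts G \<Longrightarrow> k a < x \<and> n \<le> x * card {i. i < n \<and> c (a, i) = k a}" by metis
  have "proper_colouring G x k"
    unfolding proper_colouring_def
  proof (intro conjI ballI allI impI)
    fix a b assume ab: "{a, b} \<in> edges G"
    then have "a \<in> verts G" "b \<in> verts G" using G(1) by (auto simp: simple_graph_def)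
    then obtain i j where ij: "i < n" "c (a, i) = k a" "j < n" "c (b, j) = k b" "R i j"
      using R[of "{i. i < n \<and> c (a, i) = k a}" "{j. j < n \<and> c (b, j) = k b}"] k by auto
    then have "{(a, i), (b, j)} \<in> edges (fibred_graph G n R)"
      using ab by (simp add: fibred_graph_edge_iff[OF sym])
    then have "c (a, i) \<noteq> c (b, j)" using c unfolding proper_colouring_def by blast
    then show "k a \<noteq> k b" using ij by simp
  qed (use k in auto)
  then show False using G(2) by blast
qed

text \<open>The second coordinates of a triangle are pairwise related by \<open>R\<close>, whatever
  triangles \<open>G\<close> contains.\<close>

lemma fibred_graph_triangle_free:
  assumes sym: "\<And>i j. R i j \<longleftrightarrow> R j i"
    and R: "\<And>i j k. i < n \<Longrightarrow> j < n \<Longrightarrow> k < n \<Longrightarrow> R i j \<Longrightarrow> R j k \<Longrightarrow> R k i \<Longrightarrow> False"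
    and q: "is_cycle (fibred_graph G n R) q"
  shows "3 < length q"
proof (rule ccontr)
  assume "\<not> 3 < length q"
  then have l: "length q = 3" using q by (simp add: is_cycle_def)
  then obtain a i b j c k where abc: "q = [(a, i), (b, j), (c, k)]"
    by (auto simp: numeral_3_eq_3 length_Suc_conv)
  have e: "{q ! s, q ! (Suc s mod 3)} \<in> edges (fibred_graph G n R)" if "s < 3" for s
    using q that l by (auto simp: is_cycle_def)
  show False
    using e[of 0] e[of 1] e[of 2] R[of i j k] by (simp add: abc fibred_graph_edge_iff[OF sym])
qed

lemma triangle_free_fibred_graph:
  assumes x: "0 < x" and G: "simple_graph G" "\<nexists>c. proper_colouring G x c"
    and p: "prime p" "p mod 4 = 1" "4 * (x - 1)\<^sup>2 * p < (p + 1)\<^sup>2" and m: "p * (p - 1) \<le> 2 * m"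
  shows "has_sparse_subgraph G m 3 x"
proof -
  let ?V = "parsons_verts p"
  define n where "n = card ?V"
  obtain f where f: "bij_betw f {..<n} ?V"
    using ex_bij_betw_nat_finite[OF finite_parsons_verts[OF p(1,2)]] unfolding n_def atLeast0LessThan by blast
  let ?R = "\<lambda>i j. parsons_adj p (f i) (f j)"
  have sym: "?R i j \<longleftrightarrow> ?R j i" for i j by (rule parsons_adj_sym[OF p(1,2)])
  have fV: "f i \<in> ?V" if "i < n" for i using f that by (auto simp: bij_betw_def)
  have "n \<le> m" using card_parsons_verts[OF p(1,2)] m by (simp add: n_def)
  then have "is_subgraph (fibred_graph G n ?R) (blow_up G m)" by (rule is_subgraph_fibred_graph[OF G(1)])
  moreover have "girth (fibred_graph G n ?R) > enat 3"
    unfolding girth_gt_iff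
  proof (intro allI impI, rule fibred_graph_triangle_free[OF sym])
    fix i j k assume "i < n" "j < n" "k < n" "?R i j" "?R j k" "?R k i"
    then show False using parsons_triangle_free[OF p(1,2) fV fV fV] by blast
  qed
  moreover have "\<nexists>c. proper_colouring (fibred_graph G n ?R) x c"
  proof (rule fibred_graph_not_colourable[OF x G sym])
    fix A B assume AB: "A \<subseteq> {..<n}" "B \<subseteq> {..<n}" "n \<le> x * card A" "n \<le> x * card B"
    have "card (f ` A) = card A" "card (f ` B) = card B"
      using AB f by (auto simp: bij_betw_def intro!: card_image intro: inj_on_subset)
    moreover have "f ` A \<subseteq> ?V" "f ` B \<subseteq> ?V" using AB fV by auto
    ultimately have "\<exists>a\<in>f ` A. \<exists>b\<in>f ` B. parsons_adj p a b"
      using AB by (intro parsons_expander[OF p(1,2) _ _ _ _ x p(3)]) (auto simp: n_def)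
    then show "\<exists>i\<in>A. \<exists>j\<in>B. ?R i j" by blast
  qed
  ultimately show ?thesis by blast
qed

section \<open>Girth above 3 for x from 3 to 22\<close>

lemma prime_by_trial:
  assumes "1 < n" "n < k * k" "\<forall>d\<in>{2..<k}. \<not> d dvd n"
  shows "prime (n :: nat)"
proof (rule ccontr)
  assume "\<not> prime n"
  then obtain a b where ab: "n = a * b" "1 < a" "1 < b"
  proof -
    obtain a where a: "a dvd n" "a \<noteq> 1" "a \<noteq> n" using \<open>\<not> prime n\<close> assms(1) by (auto simp: prime_nat_iff)
    then obtain b where b: "n = a * b" by (auto simp: dvd_def)
    have "a \<noteq> 0" "b \<noteq> 0" using b assms(1) by (cases "a = 0"; cases "b = 0"; simp)+
    moreover have "b \<noteq> 1" using a(3) b by simp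
    ultimately show ?thesis using that[OF b] a(2) by linarith
  qed
  have "\<not> (k \<le> a \<and> k \<le> b)" using assms(2) mult_le_mono[of k a k b] ab(1) by linarith
  then have "a \<in> {2..<k} \<or> b \<in> {2..<k}" using ab by auto
  then show False using assms(3) ab(1) by (metis dvd_triv_left dvd_triv_right)
qed

lemma sparse_subgraph_lt_23:
  assumes G: "simple_graph G" "\<nexists>c. proper_colouring G x c" and x: "3 \<le> x" "x < 23"
    and m: "x ^ 5 \<le> m"
  shows "has_sparse_subgraph G m 3 x"
proof -
  define Q where "Q \<longleftrightarrow> ?thesis"
  \<comment> \<open>One prime serves an interval of values of \<open>x\<close>: expansion is hardest
    at its upper end \<open>u\<close>, and the room in the blow-up is smallest at its lower end
    \<open>l\<close>.\<close>
  have *: Q if p: "prime p" "p mod 4 = 1" and lu: "l \<le> x" "x \<le> u"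
    and pl: "4 * (u - 1)\<^sup>2 * p < (p + 1)\<^sup>2" "p * (p - 1) \<le> 2 * l ^ 5" for p l u :: nat
    unfolding Q_def
  proof (rule triangle_free_fibred_graph[OF _ G p])
    have "4 * (x - 1)\<^sup>2 * p \<le> 4 * (u - 1)\<^sup>2 * p"
      using lu(2) by (intro mult_le_mono power_mono) auto
    then show "4 * (x - 1)\<^sup>2 * p < (p + 1)\<^sup>2" using pl(1) by linarith
    have "2 * l ^ 5 \<le> 2 * x ^ 5" using lu(1) by (intro mult_le_mono power_mono) auto
    then show "p * (p - 1) \<le> 2 * m" using pl(2) m by linarith
  qed (use x in simp)
  \<comment> \<open>43 * 43 = 1849 exceeds all four numbers, so the same trial bound fits
    each.\<close>
  have "prime (409::nat)" "prime (701::nat)" "prime (1229::nat)" "prime (1777::nat)"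
    by (rule prime_by_trial[where k = 43]; simp add: atLeastLessThan_nat_numeral)+
  note * = *[of 17 3 3, simplified]
    *[of 37 4 4, simplified]
    *[of 73 5 5, simplified]
    *[of 101 6 6, simplified]
    *[of 149 7 7, simplified]
    *[of 197 8 8, simplified]
    *[of 257 9 9, simplified]
    *[OF this(1), of 10 11, simplified]
    *[OF this(2), of 12 14, simplified]
    *[OF this(3), of 15 18, simplified]
    *[OF this(4), of 19 22, simplified]
  have "x = 3 \<or> x = 4 \<or> x = 5 \<or> x = 6 \<or> x = 7 \<or> x = 8 \<or> x = 9 \<or> 10 \<le> x \<and> x \<le> 11 \<or> 12 \<le> x \<and> x \<le> 14 \<or> 15 \<le> x \<and> x \<le> 18 \<or> 19 \<le> x \<and> x \<le> 22"
    using x by presburger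
  then have Q using * by blast
  then show ?thesis by (simp only: Q_def)
qed

section \<open>Two colours\<close>

text \<open>In an edge-minimal non-bipartite subgraph, drop an edge of an even cycle and 2-colour
  the rest. Colours alternate along the remaining path of odd length, so the ends of the dropped
  edge differ and the colouring extends, a contradiction. Hence no even cycle is left.\<close>

lemma non_bipartite_subgraph_girth:
  assumes H: "simple_graph H" "finite (edges H)" "\<nexists>c. proper_colouring H 2 c"
    and even: "\<And>q. is_cycle H q \<Longrightarrow> length q \<le> g \<Longrightarrow> even (length q)"
  shows "\<exists>K. is_subgraph K H \<and> (\<forall>q. is_cycle K q \<longrightarrow> g < length q) \<and> (\<nexists>c. proper_colouring K 2 c)"
proof -
  define P where "P E \<longleftrightarrow> E \<subseteq> edges H \<and> (\<nexists>c. proper_colouring (verts H, E) 2 c)" for E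
  have "P (edges H)" using H(3) by (simp add: P_def)
  then obtain E where E: "P E" and min: "\<And>F. P F \<Longrightarrow> card E \<le> card F"
    using ex_has_least_nat[of P "edges H" card] by blast
  have "finite E" using E H(2) finite_subset unfolding P_def by blast
  have "g < length q" if q: "is_cycle (verts H, E) q" for q
  proof (rule ccontr)
    assume "\<not> g < length q"
    moreover have "is_cycle H q" using q E by (auto simp: is_cycle_def P_def)
    ultimately have "even (length q)" using even by simp
    then obtain l where l: "length q = Suc l" "odd l" "2 \<le> l"
      using q by (cases "length q") (auto simp: is_cycle_def)
    let ?e = "{q ! l, q ! 0}"
    have edge: "{q ! i, q ! (Suc i mod Suc l)} \<in> E" if "i < Suc l" for i
      using q that l by (simp add: is_cycle_def)
    have e: "?e \<in> E" using edge[of l] by simp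
    have dist: "distinct q" using q by (simp add: is_cycle_def)
    have "card (E - {?e}) < card E" using \<open>finite E\<close> e by (rule card_Diff1_less)
    then have "\<not> P (E - {?e})" using min leD by blast
    then obtain c where c: "proper_colouring (verts H, E - {?e}) 2 c" using E unfolding P_def by blast
    have "even (c (q ! i)) \<longleftrightarrow> even (c (q ! 0) + i)" if "i \<le> l" for i
      using that
    proof (induction i)
      case (Suc i)
      have "{q ! i, q ! Suc i} \<in> E" using edge[of i] Suc.prems by simp
      moreover have "{q ! i, q ! Suc i} \<noteq> ?e"
        using Suc.prems l dist by (auto simp: doubleton_eq_iff nth_eq_iff_index_eq)
      ultimately have ne: "c (q ! i) \<noteq> c (q ! Suc i)" using c by (auto simp: proper_colouring_def)
      have "{q ! i, q ! Suc i} \<subseteq> verts H"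
        using \<open>{q ! i, q ! Suc i} \<in> E\<close> E H(1) unfolding P_def simple_graph_def by blast
      then have "c (q ! i) < 2" "c (q ! Suc i) < 2" using c by (auto simp: proper_colouring_def)
      then have "even (c (q ! Suc i)) \<longleftrightarrow> odd (c (q ! i))" using ne by (auto simp: less_2_cases_iff)
      then show ?case using Suc by simp
    qed simp
    from this[of l] have "c (q ! l) \<noteq> c (q ! 0)" using l(2) by auto
    then have "proper_colouring (verts H, E) 2 c"
      using c unfolding proper_colouring_def by (fastforce simp: doubleton_eq_iff)
    then show False using E by (auto simp: P_def)
  qed
  moreover have "is_subgraph (verts H, E) H" using E H(1) by (auto simp: is_subgraph_def simple_graph_def P_def)
  ultimately show ?thesis using E unfolding P_def by blast
qed

lemma sum_nth_shift:
  assumes "0 < l"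
  shows "(\<Sum>i<l. f (Suc i mod l)) = (\<Sum>i<l. f i :: 'b :: comm_monoid_add)"
proof -
  obtain k where k: "l = Suc k" using assms by (cases l) auto
  have "(\<Sum>i<Suc k. f (Suc i mod Suc k)) = (\<Sum>i<k. f (Suc i)) + f 0" by simp
  also have "\<dots> = (\<Sum>i<Suc k. f i)" by (simp only: sum.lessThan_Suc_shift add.commute)
  finally show ?thesis by (simp only: k)
qed

text \<open>The cycle on the residues modulo \<open>n\<close>; integers are used so that the step
  \<open>- 1\<close> needs no truncated subtraction.\<close>

definition circ_adj :: "nat \<Rightarrow> nat \<Rightarrow> nat \<Rightarrow> bool" where
  "circ_adj n i j \<longleftrightarrow> [int j = int i + 1] (mod int n) \<or> [int j = int i - 1] (mod int n)"

lemma circ_adj_sym: "circ_adj n i j \<longleftrightarrow> circ_adj n j i"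
proof -
  have "int n dvd int j - (int i + 1) \<longleftrightarrow> int n dvd int i - (int j - 1)" for i j
    using dvd_minus_iff[of "int n" "int j - (int i + 1)"] by (simp only: minus_diff_eq) (simp add: algebra_simps)
  then show ?thesis unfolding circ_adj_def cong_iff_dvd_diff by blast
qed

text \<open>Along the cycle the second coordinate moves by steps of 1 or -1 modulo \<open>n\<close>.
  Their sum is a multiple of \<open>n\<close> of absolute value below \<open>n\<close>, hence 0, and
  a vanishing sum of signs has an even number of terms.\<close>

lemma short_cycle_even:
  assumes q: "is_cycle (fibred_graph G n (circ_adj n)) q" "length q < n"
  shows "even (length q)"
proof -
  let ?l = "length q" and ?t = "\<lambda>i. int (snd (q ! i))"
  have "\<exists>d\<in>{-1, 1}. int n dvd ?t (Suc i mod ?l) - ?t i - d" if "i < ?l" for i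
  proof -
    obtain a s b t where ab: "q ! i = (a, s)" "q ! (Suc i mod ?l) = (b, t)" by fastforce
    have "{q ! i, q ! (Suc i mod ?l)} \<in> edges (fibred_graph G n (circ_adj n))"
      using q that by (simp add: is_cycle_def)
    then have "circ_adj n s t"
      unfolding ab fibred_graph_edge_iff[OF circ_adj_sym] by blast
    then have "int n dvd int t - int s - 1 \<or> int n dvd int t - int s - - 1"
      unfolding circ_adj_def cong_iff_dvd_diff by (simp add: algebra_simps)
    then show ?thesis unfolding ab by auto
  qed
  then obtain d where d: "\<And>i. i < ?l \<Longrightarrow> d i \<in> {-1, 1} \<and> int n dvd ?t (Suc i mod ?l) - ?t i - d i" by metis
  have "int n dvd (\<Sum>i<?l. ?t (Suc i mod ?l) - ?t i - d i)"
    by (rule dvd_sum) (use d in auto)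
  also have "(\<Sum>i<?l. ?t (Suc i mod ?l) - ?t i - d i) = - (\<Sum>i<?l. d i)"
  proof -
    have "0 < ?l" using q by (auto simp: is_cycle_def)
    then show ?thesis unfolding sum_subtractf sum_nth_shift[OF \<open>0 < ?l\<close>, of ?t] by simp
  qed
  finally have n: "int n dvd (\<Sum>i<?l. d i)" by simp
  have "\<bar>\<Sum>i<?l. d i\<bar> \<le> (\<Sum>i<?l. \<bar>d i\<bar>)" by (rule sum_abs)
  also have "\<dots> \<le> (\<Sum>i<?l. 1)" by (rule sum_mono) (use d in force)
  also have "\<dots> < int n" using q(2) by simp
  finally have "\<not> \<bar>int n\<bar> \<le> \<bar>\<Sum>i<?l. d i\<bar>" by simp
  then have 0: "(\<Sum>i<?l. d i) = 0" using dvd_imp_le_int[OF _ n] by blast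
  have "even (\<Sum>i<?l. d i + 1)"
  proof (rule dvd_sum)
    fix i assume "i \<in> {..<?l}"
    then have "d i = -1 \<or> d i = 1" using d[of i] by simp
    then show "even (d i + 1)" by auto
  qed
  then show ?thesis using 0 by (simp add: sum.distrib)
qed

text \<open>Over an edge ab, two steps along the circle through the part of \<open>a\<close> return
  to the same colour in the part of \<open>b\<close>. As \<open>n\<close> is odd, repeating this
  leads from index 0 to index 1, so the copies of \<open>b\<close> at 0 and 1 agree and the colours
  at index 0 would properly colour \<open>G\<close>.\<close>

lemma fibred_graph_circ_not_2_colourable:
  assumes G: "simple_graph G" "\<nexists>c. proper_colouring G 2 c" and n: "odd n"
  shows "\<nexists>c. proper_colouring (fibred_graph G n (circ_adj n)) 2 c"
proof
  let ?H = "fibred_graph G n (circ_adj n)"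
  assume "\<exists>c. proper_colouring ?H 2 c"
  then obtain c where c: "proper_colouring ?H 2 c" by blast
  have n0: "0 < n" using n by (cases n) auto
  have cl: "c (a, i mod n) < 2" if "a \<in> verts G" for a i
    using c that n0 by (auto simp: proper_colouring_def fibred_graph_def)
  have ce: "c (a, i mod n) \<noteq> c (b, Suc i mod n)" if "{a, b} \<in> edges G" for a b i
  proof -
    have "circ_adj n (i mod n) (Suc i mod n)"
      unfolding circ_adj_def by (simp add: cong_def zmod_int mod_simps add.commute)
    then have "{(a, i mod n), (b, Suc i mod n)} \<in> edges ?H"
      using that n0 by (simp add: fibred_graph_edge_iff[OF circ_adj_sym])
    then show ?thesis using c unfolding proper_colouring_def by blast
  qed
  have const: "c (b, 1 mod n) = c (b, 0)" if ab: "{a, b} \<in> edges G" for a b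
  proof -
    have V: "a \<in> verts G" "b \<in> verts G" using ab G(1) by (auto simp: simple_graph_def)
    have ba: "{b, a} \<in> edges G" using ab by (simp add: insert_commute)
    have step: "c (b, i mod n) = c (b, Suc (Suc i) mod n)" for i
      using ce[OF ba, of i] ce[OF ab, of "Suc i"] cl[OF V(2), of i] cl[OF V(2), of "Suc (Suc i)"] cl[OF V(1), of "Suc i"]
      by linarith
    have even: "c (b, (2 * k) mod n) = c (b, 0)" for k
    proof (induction k)
      case (Suc k)
      then show ?case using step[of "2 * k"] by simp
    qed simp
    obtain k where "n = 2 * k + 1" using n by (rule oddE)
    then have "2 * Suc k = 1 + n" by simp
    then have "2 * Suc k mod n = 1 mod n" by (simp only: mod_add_self2)
    then show ?thesis using even[of "Suc k"] by simp
  qed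
  have "proper_colouring G 2 (\<lambda>a. c (a, 0))"
    unfolding proper_colouring_def
  proof (intro conjI ballI allI impI)
    show "c (a, 0) < 2" if "a \<in> verts G" for a using cl[OF that, of 0] by simp
    show "c (a, 0) \<noteq> c (b, 0)" if "{a, b} \<in> edges G" for a b
      using ce[OF that, of 0] const[OF that] by simp
  qed
  then show False using G(2) by blast
qed

lemma sparse_subgraph_2:
  assumes G: "simple_graph G" "finite (verts G)" "\<nexists>c. proper_colouring G 2 c" and m: "g + 2 \<le> m"
  shows "has_sparse_subgraph G m g 2"
proof -
  \<comment> \<open>One of \<open>g + 1\<close> and \<open>g + 2\<close> is odd; this is where the
    assumption \<open>g + 2 \<le> m\<close> comes from.\<close>
  obtain n where n: "odd n" "g < n" "n \<le> m"
    using m by (cases "even g") (auto intro: that[of "g + 1"] that[of "g + 2"])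
  let ?H = "fibred_graph G n (circ_adj n)"
  have sub: "is_subgraph ?H (blow_up G m)" by (rule is_subgraph_fibred_graph[OF G(1) n(3)])
  then have fin: "finite (edges ?H)"
    using finite_edges_blow_up[OF G(2,1)] finite_subset unfolding is_subgraph_def by blast
  have "\<exists>K. is_subgraph K ?H \<and> (\<forall>q. is_cycle K q \<longrightarrow> g < length q) \<and> (\<nexists>c. proper_colouring K 2 c)"
  proof (rule non_bipartite_subgraph_girth[OF _ fin fibred_graph_circ_not_2_colourable[OF G(1,3) n(1)]])
    show "simple_graph ?H" using sub by (simp add: is_subgraph_def)
    show "even (length q)" if "is_cycle ?H q" "length q \<le> g" for q
      using short_cycle_even[OF that(1)] that(2) n(2) by simp
  qed
  then show ?thesis using is_subgraph_trans[OF _ sub] unfolding girth_gt_iff by blast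
qed

section \<open>One colour, and the assembly of all cases\<close>

lemma sparse_subgraph_1:
  assumes G: "simple_graph G" "\<nexists>c. proper_colouring G 1 c" and m: "0 < m"
  shows "has_sparse_subgraph G m g 1"
proof -
  have "\<not> proper_colouring G 1 (\<lambda>_. 0)" using G(2) by blast
  then obtain a b where ab: "{a, b} \<in> edges G" by (auto simp: proper_colouring_def)
  then have V: "a \<noteq> b" "a \<in> verts G" "b \<in> verts G" using G(1) by (auto simp: simple_graph_def)
  let ?e = "{(a, 0), (b, 0)} :: ('a \<times> nat) set"
  let ?H = "(?e, {?e})"
  have "\<not> is_cycle ?H q" for q
  proof
    assume "is_cycle ?H q"
    then have l: "3 \<le> length q" and d: "distinct q"
      and e: "\<And>i. i < length q \<Longrightarrow> {q ! i, q ! (Suc i mod length q)} = ?e"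
      by (auto simp: is_cycle_def)
    have len: "0 < length q" "1 < length q" "2 < length q" using l by linarith+
    have "Suc 0 mod length q = 1" "Suc 1 mod length q = 2" using len by simp_all
    then have "{q ! 0, q ! 1} = {q ! 1, q ! 2}" using e[OF len(1)] e[OF len(2)] by metis
    then have "q ! 0 = q ! 2" by (auto simp: doubleton_eq_iff)
    moreover note len
    ultimately show False using d nth_eq_iff_index_eq[of q 0 2] by simp
  qed
  then have "girth ?H > enat g" by (simp add: girth_gt_iff)
  moreover have "is_subgraph ?H (blow_up G m)"
    using V ab m blow_up_edge_iff[of a 0 b 0 G m] by (simp add: is_subgraph_def simple_graph_def) (simp add: blow_up_def)
  moreover have "\<nexists>c. proper_colouring ?H 1 c"
  proof
    assume "\<exists>c. proper_colouring ?H 1 c"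
    then obtain c where c: "proper_colouring ?H 1 c" by blast
    then have "c (a, 0) \<noteq> c (b, 0)" unfolding proper_colouring_def by (metis singletonI snd_conv)
    moreover have "c (a, 0) < 1" "c (b, 0) < 1" using c by (simp_all add: proper_colouring_def)
    ultimately show False by simp
  qed
  ultimately show ?thesis by blast
qed

lemma critical_sparse_subgraph:
  assumes G: "critical x G" and \<Delta>: "\<And>v. card (neighbours G v) \<le> \<Delta>" "x \<le> \<Delta>" and x: "0 < x" and g: "3 \<le> g"
    and m: "real m > real x * (real x * real \<Delta>) ^ (2 * g - 4)"
  shows "has_sparse_subgraph G m g x"
proof -
  have G': "simple_graph G" "finite (verts G)" "\<nexists>c. proper_colouring G x c" using G by (auto simp: critical_def)
  have m': "x * (x * \<Delta>) ^ (2 * g - 4) < m"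
    using m by (simp flip: of_nat_mult of_nat_power)
  have pow: "x * (x * x) ^ (2 * g - 4) \<le> x * (x * \<Delta>) ^ (2 * g - 4)"
    using \<Delta>(2) by (intro mult_le_mono power_mono) auto
  consider "x = 1" | "x = 2" | "3 \<le> x" "4 \<le> g" | "3 \<le> x" "x < 23" "g = 3" | "23 \<le> x" "g = 3"
    using x g by linarith
  then show ?thesis
  proof cases
    case 1
    then show ?thesis using sparse_subgraph_1[OF G'(1)] G'(3) m' by simp
  next
    case 2
    \<comment> \<open>With x = 2 the hypothesis makes \<open>m\<close> exceed 2 * 4^(2g-4), far more
      than the \<open>g + 2\<close> that the odd circle takes up.\<close>
    have "2 * g - 4 < 2 ^ (2 * g - 4)" by (rule less_exp)
    also have "\<dots> \<le> 4 ^ (2 * g - 4)" by (rule power_mono) auto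
    finally have "g + 2 \<le> m" using pow m' 2 g by simp
    then show ?thesis using sparse_subgraph_2[OF G'(1,2)] G'(3) 2 by simp
  next
    case 3
    then show ?thesis using sparse_subgraph_large_girth[OF G \<Delta> 3(2,1) m] by blast
  next
    case 4
    have "x ^ 5 = x * (x * x) ^ (2 * g - 4)" using 4 by (simp add: eval_nat_numeral)
    then have "x ^ 5 \<le> m" using pow m' by linarith
    then show ?thesis using sparse_subgraph_lt_23[OF G'(1,3) 4(1,2)] 4(3) by simp
  next
    case 5
    then show ?thesis using sparse_subgraph_ge_23[OF G \<Delta>] m by simp
  qed
qed

theorem theorem3p1:
  fixes G :: "'a ugraph" and x \<Delta> g m :: nat
  assumes "x > 0" and "\<Delta> > 0" and "g > 0"
    and "simple_graph G"
    and "max_degree G \<le> enat \<Delta>"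
    and "chromatic_number G > enat x"
    and "real m > real x * (real x * real \<Delta>) powi (2 * int g - 4)"
  shows "\<exists>H. is_subgraph H (blow_up G m) \<and> girth H > enat g \<and> chromatic_number H > enat x"
proof -
  have no: "\<nexists>c. proper_colouring G x c" using assms(6) by (simp add: chromatic_number_gt_iff)
  show ?thesis
  proof (cases "g \<le> 2")
    case True
    \<comment> \<open>The exponent is -2 for g = 1 and 0 for g = 2. In both cases the bound is
      nonnegative, which yields one vertex in each part.\<close>
    have "0 \<le> real x * (real x * real \<Delta>) powi (2 * int g - 4)" by simp
    then have m: "1 \<le> m" using assms(7) by linarith
    \<comment> \<open>A plain copy of \<open>G\<close>: by definition a cycle has at least three
      vertices, so the girth exceeds 2 anyway.\<close>
    let ?H = "fibred_graph G 1 (\<lambda>_ _. True)"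
    have "\<nexists>c. proper_colouring ?H x c"
    proof (rule fibred_graph_not_colourable[OF assms(1,4) no])
      fix A B :: "nat set" assume "1 \<le> x * card A" "1 \<le> x * card B"
      then have "A \<noteq> {}" "B \<noteq> {}" by auto
      then show "\<exists>i\<in>A. \<exists>j\<in>B. True" by blast
    qed simp
    moreover have "girth ?H > enat g" using True by (auto simp: girth_gt_iff is_cycle_def)
    moreover have "is_subgraph ?H (blow_up G m)" by (rule is_subgraph_fibred_graph[OF assms(4) m])
    ultimately show ?thesis unfolding chromatic_number_gt_iff by blast
  next
    case False
    then have g: "3 \<le> g" by simp
    obtain S where S: "S \<subseteq> verts G" "critical x (induced G S)"
      by (rule critical_subgraph[OF assms(4,1) no])
    let ?K = "induced G S"
    have verts: "verts ?K = S" by (simp add: induced_def)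
    have deg: "finite (neighbours ?K v) \<and> card (neighbours ?K v) \<le> \<Delta>" for v
    proof (cases "v \<in> S")
      case True
      then have "finite (neighbours G v)" "card (neighbours G v) \<le> \<Delta>"
        using card_neighbours_le[OF assms(5)] S(1) by auto
      then show ?thesis
        using neighbours_induced_subset[of G S v] finite_subset card_mono le_trans by meson
    next
      case False
      then have "neighbours ?K v = {}" by (auto simp: neighbours_def induced_def)
      then show ?thesis by simp
    qed
    \<comment> \<open>A vertex is required to compare \<open>x\<close> with \<Delta> through its
      degree; the resulting \<open>x \<le> \<Delta>\<close> makes \<Delta> = x the worst case of the
      estimates.\<close>
    have "S \<noteq> {}"
    proof
      assume "S = {}"
      then have "proper_colouring ?K x (\<lambda>_. 0)"
        using S(2) by (auto simp: proper_colouring_def induced_def)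
      then show False using S(2) by (auto simp: critical_def)
    qed
    then obtain v where "v \<in> S" by blast
    then have "x \<le> card (neighbours ?K v)" using critical_degree[OF S(2)] verts deg by simp
    then have "x \<le> \<Delta>" using deg[of v] by linarith
    have "2 * int g - 4 = int (2 * g - 4)" using g by linarith
    then have "(real x * real \<Delta>) powi (2 * int g - 4) = (real x * real \<Delta>) ^ (2 * g - 4)"
      by (simp only: power_int_of_nat)
    then have "\<exists>H. is_subgraph H (blow_up ?K m) \<and> girth H > enat g \<and> (\<nexists>c. proper_colouring H x c)"
      using critical_sparse_subgraph[OF S(2) _ \<open>x \<le> \<Delta>\<close> assms(1) g] deg assms(7) by simp
    then show ?thesis
      unfolding chromatic_number_gt_iff
      using is_subgraph_trans[OF _ is_subgraph_blow_up_induced[OF assms(4) S(1)]] by blast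
  qed
qed

end
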